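(* Let $R=k[x,y]$ be a polynomial ring over an infinite field $k$, and let $I=(x^n,y^n,x^{n-k_1}y^{k_1},\ldots,x^{n-k_s}y^{k_s})$ with integers $0<k_1<\cdots<k_s<n$ such that $\gcd(k_1,\ldots,k_s,n)=1$. Then $\mathrm{core}(I)=\mathrm{adj}(I^2)$.
   Context: A subideal $J$ of an ideal $I$ is a reduction of $I$ if $I^{r+1}=JI^r$ for some integer $r\ge0$. $\mathrm{core}(I)$ is the intersection of all reductions of $I$. $\mathrm{adj}(L)$ denotes the adjoint of $L$ in the sense of Lipman: for a regular domain $R$ with fraction field $Q$, $\mathrm{adj}(L)=\bigcap_v\{r\in Q: v(r)\ge v(L)-v(\mathcal J_{R_v/R})\}$, where $v$ ranges over all divisorial valuations of $Q$ nonnegative on $R$ with valuation ring $R_v$ essentially of finite type over $R$, and $\mathcal J_{R_v/R}$ is the Jacobian ideal (the $0$-th Fitting ideal of $\Omega_{R_v/R}$). For a monomial ideal $L$ in a polynomial ring in $d$ variables, a theorem of Howald (see also Huneke–Swanson) describes $\mathrm{adj}(L)$ as the monomial ideal with exponent set $\{\alpha\in\mathbb Z_{\ge0}^d:\alpha+(1,\ldots,1)\in \mathrm{NP}^{\circ}(L)\}$, where $\mathrm{NP}^\circ(L)$ is the interior of the Newton polyhedron of $L$ (the convex hull in $\mathbb R^d$ of the exponents of all monomials in $L$). *)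

theory Defs
  imports
    "HOL-Computational_Algebra.Computational_Algebra"
    "HOL-Library.Extended_Real"
    "HOL-Library.Poly_Mapping"
    "Jordan_Normal_Form.Determinant"
begin

section \<open>Ideals, reductions and the core\<close>

text \<open>A commutative ring, given by a type, is regarded as a module over itself: its ideals are the
  sets satisfying \<^const>\<open>module.subspace\<close>, and \<^const>\<open>module.span\<close> generates ideals.\<close>

abbreviation is_ideal :: "'r::comm_ring_1 set \<Rightarrow> bool" where
  "is_ideal \<equiv> module.subspace (*)"

abbreviation ideal_generated :: "'r::comm_ring_1 set \<Rightarrow> 'r set" where
  "ideal_generated \<equiv> module.span (*)"

definition ideal_prod :: "'r::comm_ring_1 set \<Rightarrow> 'r set \<Rightarrow> 'r set" where
  "ideal_prod I J = ideal_generated {a * b | a b. a \<in> I \<and> b \<in> J}"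

primrec ideal_power :: "'r::comm_ring_1 set \<Rightarrow> nat \<Rightarrow> 'r set" where
  "ideal_power I 0 = UNIV"
| "ideal_power I (Suc r) = ideal_prod I (ideal_power I r)"

definition is_reduction :: "'r::comm_ring_1 set \<Rightarrow> 'r set \<Rightarrow> bool" where
  "is_reduction J I \<longleftrightarrow> is_ideal J \<and> J \<subseteq> I \<and>
     (\<exists>r. ideal_power I (Suc r) = ideal_prod J (ideal_power I r))"

definition core :: "'r::comm_ring_1 set \<Rightarrow> 'r set" where
  "core I = \<Inter>{J. is_reduction J I}"


section \<open>Subrings of a field, and algebras essentially of finite type\<close>

definition is_subring :: "'q::comm_ring_1 set \<Rightarrow> bool" where
  "is_subring A \<longleftrightarrow> 0 \<in> A \<and> 1 \<in> A \<and> (\<forall>a\<in>A. \<forall>b\<in>A. a - b \<in> A \<and> a * b \<in> A)"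

text \<open>\<open>A\<close> is a localization of a finitely generated \<open>A0\<close>-subalgebra \<open>A0[Z]\<close>. For an \<open>A0\<close>-algebra
  \<open>A\<close> inside a field nothing is lost by taking the finitely generated algebra inside the field
  too: replace it by its image in \<open>A\<close>.\<close>

definition ess_finite_type :: "'q::field set \<Rightarrow> 'q set \<Rightarrow> bool" where
  "ess_finite_type A0 A \<longleftrightarrow>
     (\<exists>Z S. finite Z \<and> S \<subseteq> is_subring hull (A0 \<union> Z) \<and>
        1 \<in> S \<and> 0 \<notin> S \<and> (\<forall>s\<in>S. \<forall>t\<in>S. s * t \<in> S) \<and>
        A = {a / s | a s. a \<in> is_subring hull (A0 \<union> Z) \<and> s \<in> S})"


section \<open>Kaehler differentials, Fitting ideals and the Jacobian ideal\<close>

text \<open>Modules over a subring \<open>A\<close> of \<open>'q\<close> are given as quotients \<open>M / N\<close> of \<open>A\<close>-submodules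
  \<open>N \<subseteq> M\<close> of an abelian group with a scalar multiplication by \<open>'q\<close>.\<close>

definition is_submodule ::
    "('q::comm_ring_1 \<Rightarrow> 'm::ab_group_add \<Rightarrow> 'm) \<Rightarrow> 'q set \<Rightarrow> 'm set \<Rightarrow> bool" where
  "is_submodule scale A N \<longleftrightarrow>
     0 \<in> N \<and> (\<forall>x\<in>N. \<forall>y\<in>N. x + y \<in> N) \<and> (\<forall>a\<in>A. \<forall>x\<in>N. scale a x \<in> N)"

text \<open>The classes of \<open>w 0, \<dots>, w (n - 1)\<close> generate the \<open>A\<close>-module \<open>M / N\<close>.\<close>

definition generates_quotient ::
    "('q::comm_ring_1 \<Rightarrow> 'm::ab_group_add \<Rightarrow> 'm) \<Rightarrow> 'q set \<Rightarrow> 'm set \<Rightarrow> 'm set \<Rightarrow>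
      nat \<Rightarrow> (nat \<Rightarrow> 'm) \<Rightarrow> bool" where
  "generates_quotient scale A M N n w \<longleftrightarrow>
     (\<forall>j<n. w j \<in> M) \<and>
     (\<forall>m\<in>M. \<exists>c. (\<forall>j<n. c j \<in> A) \<and> m - (\<Sum>j<n. scale (c j) (w j)) \<in> N)"

text \<open>The \<open>0\<close>-th Fitting ideal of a finitely generated \<open>A\<close>-module \<open>M / N\<close>: the ideal of \<open>A\<close>
  generated by the determinants of the \<open>n \<times> n\<close> matrices whose rows are relations among \<open>n\<close>
  generators \<open>w 0, \<dots>, w (n - 1)\<close>. By Fitting's lemma this ideal is the same for all finite
  systems of generators, so all of them are allowed at once.\<close>

definition fitting_ideal0 ::
    "('q::comm_ring_1 \<Rightarrow> 'm::ab_group_add \<Rightarrow> 'm) \<Rightarrow> 'q set \<Rightarrow> 'm set \<Rightarrow> 'm set \<Rightarrow> 'q set" where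
  "fitting_ideal0 scale A M N = is_submodule (*) A hull
     {det X | X n w. generates_quotient scale A M N n w \<and> X \<in> carrier_mat n n \<and>
        (\<forall>i<n. \<forall>j<n. X $$ (i, j) \<in> A) \<and>
        (\<forall>i<n. (\<Sum>j<n. scale (X $$ (i, j)) (w j)) \<in> N)}"

text \<open>The module of Kaehler differentials of \<open>A\<close> over \<open>A0\<close> is the free \<open>A\<close>-module on the
  symbols \<open>d a\<close> for \<open>a \<in> A\<close> modulo additivity, the Leibniz rule and \<open>d r = 0\<close> for
  \<open>r \<in> A0\<close>. The formal sum \<open>\<Sum> c\<^sub>a d a\<close> is the finitely supported function \<open>a \<mapsto> c\<^sub>a\<close>.\<close>

definition formal_scale :: "'q::comm_ring_1 \<Rightarrow> ('q \<Rightarrow>\<^sub>0 'q) \<Rightarrow> ('q \<Rightarrow>\<^sub>0 'q)" where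
  "formal_scale c f = Poly_Mapping.map (\<lambda>x. c * x) f"

definition formal_d :: "'q::comm_ring_1 \<Rightarrow> ('q \<Rightarrow>\<^sub>0 'q)" where
  "formal_d a = Poly_Mapping.single a 1"

definition formal_differentials :: "'q::comm_ring_1 set \<Rightarrow> ('q \<Rightarrow>\<^sub>0 'q) set" where
  "formal_differentials A = {f. Poly_Mapping.keys f \<subseteq> A \<and> (\<forall>a. Poly_Mapping.lookup f a \<in> A)}"

definition kaehler_relations :: "'q::comm_ring_1 set \<Rightarrow> 'q set \<Rightarrow> ('q \<Rightarrow>\<^sub>0 'q) set" where
  "kaehler_relations A0 A = is_submodule formal_scale A hull
     ({formal_d (a + b) - formal_d a - formal_d b | a b. a \<in> A \<and> b \<in> A} \<union>
      {formal_d (a * b) - formal_scale a (formal_d b) - formal_scale b (formal_d a) | a b.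
         a \<in> A \<and> b \<in> A} \<union>
      {formal_d r | r. r \<in> A0})"

definition jacobian_ideal :: "'q::comm_ring_1 set \<Rightarrow> 'q set \<Rightarrow> 'q set" where
  "jacobian_ideal A0 A =
     fitting_ideal0 formal_scale A (formal_differentials A) (kaehler_relations A0 A)"


section \<open>Divisorial valuations and the adjoint of an ideal\<close>

definition discrete_valuation :: "('q::field \<Rightarrow> ereal) \<Rightarrow> bool" where
  "discrete_valuation v \<longleftrightarrow>
     v 0 = \<infinity> \<and>
     (\<forall>x. x \<noteq> 0 \<longrightarrow> (\<exists>m::int. v x = ereal (of_int m))) \<and>
     (\<exists>x. v x = 1) \<and>
     (\<forall>x y. v (x * y) = v x + v y) \<and>
     (\<forall>x y. min (v x) (v y) \<le> v (x + y))"

definition valuation_ring :: "('q::field \<Rightarrow> ereal) \<Rightarrow> 'q set" where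
  "valuation_ring v = {x. 0 \<le> v x}"

text \<open>Divisorial valuations over \<open>'r\<close>, in the sense of Lipman: the valuation ring is a discrete
  valuation ring of the fraction field that contains \<open>'r\<close> and is essentially of finite type over
  it. Over a (universally catenary) regular domain the dimension formula then gives the
  residual transcendence degree \<open>height (center) - 1\<close>.\<close>

definition divisorial_valuation :: "('r::idom fract \<Rightarrow> ereal) \<Rightarrow> bool" where
  "divisorial_valuation v \<longleftrightarrow>
     discrete_valuation v \<and> (\<forall>r. 0 \<le> v (to_fract r)) \<and>
     ess_finite_type (range to_fract) (valuation_ring v)"

text \<open>The value of an ideal is the least value of its elements, with value \<open>\<infinity>\<close> for the zero ideal.\<close>

definition value_of_set :: "('q::field \<Rightarrow> ereal) \<Rightarrow> 'q set \<Rightarrow> ereal" where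
  "value_of_set v L = (INF l\<in>L. v l)"

text \<open>Lipman's adjoint, as a subset of the fraction field; the notion is meant for regular \<open>'r\<close>.\<close>

definition adjoint :: "'r::idom set \<Rightarrow> 'r fract set" where
  "adjoint L = (\<Inter>v\<in>{v. divisorial_valuation v}.
     {r. value_of_set v (to_fract ` L)
           - value_of_set v (jacobian_ideal (range to_fract) (valuation_ring v)) \<le> v r})"


section \<open>The polynomial ring in two variables\<close>

text \<open>\<open>k[x,y]\<close> is the type \<open>'a poly poly\<close>, that is \<open>k[x][y]\<close>.\<close>

definition var_x :: "'a::field poly poly" where
  "var_x = [:[:0, 1:]:]"

definition var_y :: "'a::field poly poly" where
  "var_y = [:0, 1:]"

end

theory Submission
  imports Defs "Berlekamp_Zassenhaus.Unique_Factorization_Poly"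
begin

text \<open>Both sides are the power \<open>m ^ (2 n - 1)\<close> of \<open>m = (x, y)\<close>.

  A reduction \<open>J\<close> of \<open>I\<close> contains this power: the degree \<open>n\<close> parts of \<open>J\<close>, dehomogenized by \<open>x = 1\<close>,
  generate the unit ideal of \<open>k[t]\<close> and include a polynomial of degree \<open>n\<close>, and therefore their
  multiples fill every degree \<open>\<ge> 2 n - 1\<close>. Conversely, for \<open>a \<noteq> 0\<close> let \<open>f = t ^ n - a ^ n\<close> and let \<open>g\<close> be a general
  linear combination of the \<open>t ^ k - a ^ k\<close> for the given exponents \<open>k\<close>; the gcd condition
  yields \<open>gcd f g = t - a\<close>. For all but finitely many \<open>e\<close> the forms \<open>f\<close> and \<open>g + e\<close> are coprime, hence
  generate a reduction of \<open>I\<close> (determinant trick on \<open>m ^ (n - 1)\<close>). In degree \<open>2 n - 2\<close> this reduction is a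
  hyperplane that for \<open>e \<rightarrow> 0\<close> tends to the polynomials vanishing at \<open>a\<close>. So the leading form of an element
  of the core of order at most \<open>2 n - 2\<close> would vanish at all \<open>a \<noteq> 0\<close>.

  For the adjoint, let \<open>v\<close> be divisorial with valuation ring \<open>V\<close> and, say, \<open>v x \<le> v y\<close>. The derivation
  \<open>d/dy\<close> induces a map from the differentials of \<open>V\<close> to \<open>Q / V\<close> that sends \<open>d (y/x)\<close> to \<open>1/x\<close>, so the Jacobian
  ideal lies in \<open>x V\<close>; this gives \<open>m ^ (2 n - 1) \<subseteq> adj (I\<^sup>2)\<close>. Conversely, the valuations of prime elements have
  trivial Jacobian ideal and force the adjoint into \<open>k[x,y]\<close>, and the order at the origin, whose Jacobian
  ideal contains \<open>x\<close>, forces it into \<open>m ^ (2 n - 1)\<close>.\<close>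

section \<open>Ideals and reductions\<close>

interpretation ring_module: Modules.module "(*) :: 'r::comm_ring_1 \<Rightarrow> 'r \<Rightarrow> 'r"
  by unfold_locales (auto simp: algebra_simps)

text \<open>For this scalar multiplication, \<open>scale_scale\<close> is \<open>mult.assoc\<close> reversed and makes the simplifier loop.\<close>

declare ring_module.scale_scale [simp del]

lemmas ideal_zero = ring_module.subspace_0
  and ideal_add = ring_module.subspace_add
  and ideal_diff = ring_module.subspace_diff
  and ideal_mult_left = ring_module.subspace_scale
  and ideal_sum = ring_module.subspace_sum
  and ideal_generated_least = ring_module.span_minimal
  and is_ideal_generated = ring_module.subspace_span
  and ideal_generated_base = ring_module.span_base

lemma ideal_mult_right: "is_ideal I \<Longrightarrow> a \<in> I \<Longrightarrow> a * (r::'r::comm_ring_1) \<in> I"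
  by (metis ideal_mult_left mult.commute)

lemma is_idealI:
  fixes I :: "'r::comm_ring_1 set"
  assumes "0 \<in> I" and "\<And>a b. a \<in> I \<Longrightarrow> b \<in> I \<Longrightarrow> a + b \<in> I" and "\<And>r a. a \<in> I \<Longrightarrow> r * a \<in> I"
  shows "is_ideal I"
  using assms by (simp add: ring_module.subspace_def)

text \<open>The colon ideal of \<open>L\<close> by \<open>c\<close>: with it, a claim about
  \<open>a * c\<close> for all \<open>a\<close> in a generated ideal needs to be checked only on
  generators.\<close>

lemma is_ideal_colon:
  fixes L :: "'r::comm_ring_1 set"
  assumes "is_ideal L"
  shows "is_ideal {a. a * c \<in> L}"
proof (rule is_idealI)
  show "r * a \<in> {a. a * c \<in> L}" if "a \<in> {a. a * c \<in> L}" for r a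
    using ideal_mult_left[OF assms, of "a * c" r] that by (simp add: mult.assoc)
qed (use ideal_zero[OF assms] ideal_add[OF assms] in \<open>auto simp: distrib_right\<close>)

lemma is_ideal_ideal_prod: "is_ideal (ideal_prod I J)"
  by (simp add: ideal_prod_def is_ideal_generated)

lemma ideal_prod_base: "a \<in> I \<Longrightarrow> b \<in> J \<Longrightarrow> a * b \<in> ideal_prod I J"
  unfolding ideal_prod_def by (intro ideal_generated_base) blast

lemma ideal_prod_least:
  assumes "is_ideal K" and "\<And>a b. a \<in> I \<Longrightarrow> b \<in> J \<Longrightarrow> a * b \<in> K"
  shows "ideal_prod I J \<subseteq> K"
  unfolding ideal_prod_def using assms by (intro ideal_generated_least) auto

lemma ideal_prod_mono: "I \<subseteq> I' \<Longrightarrow> J \<subseteq> J' \<Longrightarrow> ideal_prod I J \<subseteq> ideal_prod I' J'"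
  by (intro ideal_prod_least is_ideal_ideal_prod ideal_prod_base) auto

lemma ideal_prod_commute: "ideal_prod I J = ideal_prod J I"
  unfolding ideal_prod_def by (rule arg_cong[where f = ideal_generated]) (use mult.commute in blast)

lemma ideal_prod_assoc: "ideal_prod (ideal_prod I J) K = ideal_prod I (ideal_prod J K)"
proof -
  have *: "ideal_prod (ideal_prod I J) K \<subseteq> ideal_prod I (ideal_prod J K)" for I J K :: "'a set"
  proof (rule ideal_prod_least[OF is_ideal_ideal_prod])
    fix a c assume "a \<in> ideal_prod I J" and c: "c \<in> K"
    moreover have "ideal_prod I J \<subseteq> {a. a * c \<in> ideal_prod I (ideal_prod J K)}"
    proof (rule ideal_prod_least[OF is_ideal_colon[OF is_ideal_ideal_prod]])
      fix a b assume "a \<in> I" "b \<in> J"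
      then show "a * b \<in> {a. a * c \<in> ideal_prod I (ideal_prod J K)}"
        using ideal_prod_base[OF \<open>a \<in> I\<close> ideal_prod_base[OF \<open>b \<in> J\<close> c]] by (simp add: mult.assoc)
    qed
    ultimately show "a * c \<in> ideal_prod I (ideal_prod J K)" by blast
  qed
  show ?thesis
  proof
    \<comment> \<open>Commutativity reverses the order of the factors, which turns the remaining
      inclusion into an instance of the one already shown.\<close>
    have "ideal_prod I (ideal_prod J K) = ideal_prod (ideal_prod K J) I"
      by (metis ideal_prod_commute)
    also have "\<dots> \<subseteq> ideal_prod K (ideal_prod J I)" by (rule *)
    also have "\<dots> = ideal_prod (ideal_prod I J) K"
      by (metis ideal_prod_commute)
    finally show "ideal_prod I (ideal_prod J K) \<subseteq> ideal_prod (ideal_prod I J) K" .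
  qed (rule *)
qed

lemma ideal_prod_left_commute: "ideal_prod I (ideal_prod J K) = ideal_prod J (ideal_prod I K)"
  by (metis ideal_prod_assoc ideal_prod_commute)

lemma ideal_prod_UNIV: "is_ideal I \<Longrightarrow> ideal_prod I UNIV = I"
  using ideal_prod_base[of _ I 1 UNIV]
  by (intro subset_antisym ideal_prod_least) (auto intro: ideal_mult_right)

lemma is_ideal_ideal_power: "is_ideal (ideal_power I r)"
  by (cases r) (auto simp: is_ideal_ideal_prod)

lemma ideal_power_base:
  "(\<And>i. i \<in> S \<Longrightarrow> f i \<in> I) \<Longrightarrow> finite S \<Longrightarrow> prod f S \<in> ideal_power I (card S)"
  by (induction S rule: infinite_finite_induct) (auto intro: ideal_prod_base)

lemma power_in_ideal_power: "a \<in> I \<Longrightarrow> a ^ r \<in> ideal_power I r"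
  by (induction r) (auto intro: ideal_prod_base)

lemma ideal_power_add:
  "ideal_prod (ideal_power I a) (ideal_power I b) = ideal_power I (a + b)"
proof (induction a)
  case 0
  show ?case
    using ideal_prod_UNIV[OF is_ideal_ideal_power, of I b] ideal_prod_commute[of UNIV "ideal_power I b"]
    by simp
qed (simp add: ideal_prod_assoc)

section \<open>Calculus of reductions\<close>

text \<open>The opposite inclusion is automatic, because \<open>J \<subseteq> I\<close> and products
  are monotone.\<close>

lemma is_reductionI:
  assumes "is_ideal J" and "J \<subseteq> I" and "ideal_power I (Suc r) \<subseteq> ideal_prod J (ideal_power I r)"
  shows "is_reduction J I"
  unfolding is_reduction_def
  using assms ideal_prod_mono[OF assms(2) subset_refl, of "ideal_power I r"] by auto

lemma reduction_power:
  assumes "ideal_power I (Suc r) = ideal_prod K (ideal_power I r)"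
  shows "ideal_power I (a + r) = ideal_prod (ideal_power K a) (ideal_power I r)"
proof (induction a)
  case 0
  show ?case
    using ideal_prod_UNIV[OF is_ideal_ideal_power, of I r] ideal_prod_commute[of UNIV "ideal_power I r"]
    by simp
next
  case (Suc a)
  have "ideal_power I (Suc a + r) = ideal_prod (ideal_power K a) (ideal_power I (Suc r))"
    using Suc ideal_prod_left_commute[of I "ideal_power K a"] by simp
  also have "\<dots> = ideal_prod (ideal_power K (Suc a)) (ideal_power I r)"
    unfolding assms by (simp add: ideal_prod_assoc ideal_prod_left_commute[of K "ideal_power K a"])
  finally show ?case .
qed

text \<open>If \<open>a\<close> and \<open>b\<close> are exponents for \<open>J\<close> in
  \<open>K\<close> and for \<open>K\<close> in \<open>I\<close>, then
  \<open>I^(a+b+1) = K^(a+1) I^b = J K^a I^b = J I^(a+b)\<close>.\<close>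

lemma reduction_trans:
  assumes "is_reduction J K" and "is_reduction K I"
  shows "is_reduction J I"
proof -
  from assms obtain a b
    where a: "ideal_power K (Suc a) = ideal_prod J (ideal_power K a)"
      and b: "ideal_power I (Suc b) = ideal_prod K (ideal_power I b)"
      and "is_ideal J" "J \<subseteq> K" "K \<subseteq> I"
    unfolding is_reduction_def by auto
  have "ideal_power I (Suc a + b) = ideal_prod (ideal_prod J (ideal_power K a)) (ideal_power I b)"
    unfolding reduction_power[OF b] a ..
  also have "\<dots> = ideal_prod J (ideal_power I (a + b))"
    unfolding reduction_power[OF b] ideal_prod_assoc ..
  finally have "ideal_power I (Suc a + b) = ideal_prod J (ideal_power I (a + b))" .
  then have "ideal_power I (Suc (a + b)) \<subseteq> ideal_prod J (ideal_power I (a + b))"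
    by simp
  moreover have "J \<subseteq> I" using \<open>J \<subseteq> K\<close> \<open>K \<subseteq> I\<close> by blast
  ultimately show ?thesis using is_reductionI \<open>is_ideal J\<close> by blast
qed

lemma is_reduction_refl: "is_ideal I \<Longrightarrow> is_reduction I I"
  by (auto simp: is_reduction_def)

section \<open>Integral dependence and the determinant trick\<close>

text \<open>In the expansion of the product, every term other than the product of the
  \<open>u i\<close> contains some factor \<open>a i\<close> from \<open>J\<close>, and its
  remaining \<open>card S - 1\<close> factors lie in \<open>I\<close>.\<close>

lemma prod_diff_in_ideal:
  fixes u a :: "'i \<Rightarrow> 'r::comm_ring_1"
  assumes "is_ideal J" "is_ideal I" "J \<subseteq> I" "finite S"
    and "\<And>i. i \<in> S \<Longrightarrow> u i \<in> I" "\<And>i. i \<in> S \<Longrightarrow> a i \<in> J"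
  shows "(\<Prod>i\<in>S. u i - a i) - (\<Prod>i\<in>S. u i) \<in> ideal_prod J (ideal_power I (card S - 1))"
  using assms(4-)
proof (induction S rule: finite_induct)
  case empty
  then show ?case by (simp add: ideal_zero is_ideal_ideal_prod)
next
  case (insert x S)
  let ?P' = "\<Prod>i\<in>S. u i - a i" and ?P = "\<Prod>i\<in>S. u i"
  have u: "u i \<in> I" and a: "a i \<in> J" if "i \<in> insert x S" for i
    using insert.prems that by blast+
  have IH: "?P' - ?P \<in> ideal_prod J (ideal_power I (card S - 1))"
    using insert.IH u a by blast
  have "u i - a i \<in> I" if "i \<in> S" for i
    using u[of i] a[of i] that assms(3) by (intro ideal_diff[OF assms(2)]) blast+
  then have "?P' \<in> ideal_power I (card S)"
    using ideal_power_base[of S "\<lambda>i. u i - a i" I] insert.hyps(1) by simp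
  then have 1: "a x * ?P' \<in> ideal_prod J (ideal_power I (card S))"
    by (intro ideal_prod_base a) simp_all
  have 2: "u x * (?P' - ?P) \<in> ideal_prod J (ideal_power I (card S))"
  \<comment> \<open>The exponent \<open>card S - 1\<close> in the induction hypothesis truncates for
    empty \<open>S\<close>.\<close>
  proof (cases "card S")
    case 0
    then have "S = {}" using insert.hyps(1) by simp
    then show ?thesis by (simp add: ideal_zero is_ideal_ideal_prod)
  next
    case (Suc c)
    have "u x * (?P' - ?P) \<in> ideal_prod I (ideal_prod J (ideal_power I c))"
      using IH Suc by (intro ideal_prod_base u) simp_all
    then show ?thesis
      unfolding Suc ideal_power.simps ideal_prod_left_commute[of I] .
  qed
  have "(\<Prod>i\<in>insert x S. u i - a i) - (\<Prod>i\<in>insert x S. u i) = u x * (?P' - ?P) - a x * ?P'"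
    using insert.hyps by (simp add: algebra_simps)
  moreover have "card (insert x S) - 1 = card S" using insert.hyps by simp
  ultimately show ?case
    using ideal_diff[OF is_ideal_ideal_prod 2 1] by (simp only:)
qed

text \<open>The matrix \<open>z - C\<close> annihilates a nonzero vector over a domain, so its
  determinant is zero. Term by term, this determinant differs from that of the scalar matrix
  \<open>z\<close> by elements of \<open>J I^(N-1)\<close>. Keeping the power of \<open>I\<close>,
  and not only \<open>z ^ N \<in> J\<close>, is what yields a reduction.\<close>

lemma determinant_trick:
  fixes w :: "nat \<Rightarrow> 'r::idom"
  assumes J: "is_ideal J" and I: "is_ideal I" and "J \<subseteq> I" and z: "z \<in> I"
    and rel: "\<And>i. i < N \<Longrightarrow> z * w i = (\<Sum>j<N. C i j * w j)"
    and C: "\<And>i j. i < N \<Longrightarrow> j < N \<Longrightarrow> C i j \<in> J"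
    and w: "i0 < N" "w i0 \<noteq> 0"
  shows "z ^ N \<in> ideal_prod J (ideal_power I (N - 1))"
proof -
  define D where "D = mat N N (\<lambda>(i,j). (if i = j then z else 0))"
  define X where "X = mat N N (\<lambda>(i,j). (if i = j then z else 0) - C i j)"
  have carr: "X \<in> carrier_mat N N" "D \<in> carrier_mat N N" by (auto simp: X_def D_def)
  have "D = z \<cdot>\<^sub>m 1\<^sub>m N" by (auto simp: D_def)
  then have detD: "det D = z ^ N" by (simp add: det_smult)
  have "X *\<^sub>v vec N w = 0\<^sub>v N"
  proof (rule eq_vecI)
    fix i assume "i < dim_vec (0\<^sub>v N :: 'r vec)"
    then have i: "i < N" by simp
    then have "(X *\<^sub>v vec N w) $ i = (\<Sum>j<N. ((if i = j then z else 0) - C i j) * w j)"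
      by (simp add: X_def scalar_prod_def atLeast0LessThan)
    also have "\<dots> = (\<Sum>j<N. if i = j then z * w j else 0) - (\<Sum>j<N. C i j * w j)"
      by (simp only: sum_subtractf[symmetric]) (intro sum.cong, auto simp: algebra_simps)
    also have "\<dots> = 0" using i rel[OF i] by simp
    finally show "(X *\<^sub>v vec N w) $ i = 0\<^sub>v N $ i" using i by simp
  qed (simp add: X_def)
  moreover have "vec N w \<noteq> 0\<^sub>v N"
    using w by (metis index_vec index_zero_vec(1))
  ultimately have "det X = 0"
    using carr(1) by (subst det_0_iff_vec_prod_zero[OF carr(1)]) (intro exI[of _ "vec N w"], simp)
  have "det X - det D = (\<Sum>p | p permutes {0..<N}. signof p *
      ((\<Prod>i=0..<N. (if i = p i then z else 0) - C i (p i)) - (\<Prod>i=0..<N. if i = p i then z else 0)))"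
    unfolding det_def'[OF carr(1)] det_def'[OF carr(2)] sum_subtractf[symmetric] right_diff_distrib
  proof (intro sum.cong refl arg_cong2[where f = "(-)"] arg_cong[where f = "(*) _"] prod.cong)
    fix p i assume "p \<in> {p. p permutes {0..<N}}" "i \<in> {0..<N}"
    then have "p i < N" "i < N" using permutes_in_image[of p "{0..<N}" i] by auto
    then show "X $$ (i, p i) = (if i = p i then z else 0) - C i (p i)"
      and "D $$ (i, p i) = (if i = p i then z else 0)" by (simp_all add: X_def D_def)
  qed
  also have "\<dots> \<in> ideal_prod J (ideal_power I (N - 1))"
  proof (intro ideal_sum ideal_mult_left is_ideal_ideal_prod)
    fix p assume "p \<in> {p. p permutes {0..<N}}"
    then have "p permutes {0..<N}" by simp
    then have "p i < N" if "i < N" for i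
      using that permutes_in_image[of p "{0..<N}" i] by simp
    then have "(\<Prod>i\<in>{0..<N}. (if i = p i then z else 0) - C i (p i)) - (\<Prod>i\<in>{0..<N}. if i = p i then z else 0)
        \<in> ideal_prod J (ideal_power I (card {0..<N} - 1))"
      using z ideal_zero[OF I] by (intro prod_diff_in_ideal J I \<open>J \<subseteq> I\<close>) (auto intro: C)
    then show "(\<Prod>i=0..<N. (if i = p i then z else 0) - C i (p i)) - (\<Prod>i=0..<N. if i = p i then z else 0)
        \<in> ideal_prod J (ideal_power I (N - 1))" by simp
  qed
  finally have "0 - z ^ N \<in> ideal_prod J (ideal_power I (N - 1))"
    using \<open>det X = 0\<close> detD by simp
  from ideal_diff[OF is_ideal_ideal_prod ideal_zero[OF is_ideal_ideal_prod] this]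
  show ?thesis by simp
qed

text \<open>Let \<open>K\<close> be the larger ideal. Its power \<open>K^(N+1)\<close> is generated
  by products of \<open>N + 1\<close> factors, each equal to \<open>z\<close> or taken from
  \<open>J\<close>. Those with a factor from \<open>J\<close> lie in \<open>J K^N\<close>; the only
  other one is \<open>z^(N+1)\<close>.\<close>

lemma reduction_insert:
  fixes J :: "'r::comm_ring_1 set"
  assumes J: "is_ideal J" and z: "z ^ Suc N \<in> ideal_prod J (ideal_power (ideal_generated (insert z J)) N)"
  shows "is_reduction J (ideal_generated (insert z J))"
proof -
  define K where "K = ideal_generated (insert z J)"
  have K: "is_ideal K" "J \<subseteq> K"
    unfolding K_def using is_ideal_generated ring_module.span_superset[of "insert z J"] by auto
  have step: "ideal_prod K Y \<subseteq> T"
    if "is_ideal T" "ideal_prod J Y \<subseteq> T" "\<And>y. y \<in> Y \<Longrightarrow> z * y \<in> T" for Y T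
  proof (rule ideal_prod_least)
    fix a b assume "a \<in> K" "b \<in> Y"
    have "K \<subseteq> {a. a * b \<in> T}"
      unfolding K_def using that \<open>b \<in> Y\<close> ideal_prod_base[of _ J b Y]
      by (intro ideal_generated_least is_ideal_colon) auto
    with \<open>a \<in> K\<close> show "a * b \<in> T" by auto
  qed fact
  define T where "T = ideal_prod J (ideal_power K N)"
  have T: "is_ideal T" by (simp add: T_def is_ideal_ideal_prod)
  \<comment> \<open>The induction runs from \<open>m = Suc N\<close>, which is the hypothesis, down
    to \<open>m = 0\<close>, which is the claim: one factor from \<open>K\<close> is split off and
    is either \<open>z\<close> or an element of \<open>J\<close>.\<close>
  have *: "z ^ m * y \<in> T" if "m \<le> Suc N" "y \<in> ideal_power K (Suc N - m)" for m y
    using that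
  proof (induction "Suc N - m" arbitrary: m y)
    case 0
    then have "m = Suc N" by simp
    then show ?case using z T by (auto simp: T_def K_def intro: ideal_mult_right)
  next
    case (Suc d)
    have "ideal_prod K (ideal_power K d) \<subseteq> {y. y * z ^ m \<in> T}"
    proof (rule step[OF is_ideal_colon[OF T]])
      have "ideal_prod (ideal_prod J (ideal_power K d)) (ideal_power K m) = T"
        unfolding T_def ideal_prod_assoc ideal_power_add using Suc.hyps(2) Suc.prems(1)
        by (metis add.commute add_Suc_right diff_Suc_1 le_add_diff_inverse)
      moreover have "y * z ^ m \<in> ideal_prod (ideal_prod J (ideal_power K d)) (ideal_power K m)"
        if "y \<in> ideal_prod J (ideal_power K d)" for y
        using that by (intro ideal_prod_base power_in_ideal_power)
          (auto simp: K_def intro: ideal_generated_base)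
      ultimately show "ideal_prod J (ideal_power K d) \<subseteq> {y. y * z ^ m \<in> T}" by auto
    next
      fix y assume "y \<in> ideal_power K d"
      moreover have "d = Suc N - Suc m" "Suc m \<le> Suc N" using Suc.hyps(2) by auto
      ultimately have "z ^ Suc m * y \<in> T" using Suc.hyps(1)[of "Suc m" y] by blast
      then show "z * y \<in> {y. y * z ^ m \<in> T}" by (simp add: algebra_simps)
    qed
    moreover have "y \<in> ideal_prod K (ideal_power K d)"
      using Suc.prems(2) unfolding Suc.hyps(2)[symmetric] by simp
    ultimately show ?case by (auto simp: mult.commute)
  qed
  show ?thesis
    unfolding K_def[symmetric]
    by (rule is_reductionI[OF J K(2), of N]) (use *[of 0] T_def in auto)
qed

text \<open>If \<open>w 0, \<dots>, w (N - 1)\<close> span the module \<open>M\<close>, the hypothesis \<open>rel\<close> says that \<open>z M \<subseteq> J M\<close>.\<close>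

lemma reduction_of_multiplier:
  fixes w :: "nat \<Rightarrow> 'r::idom"
  assumes J: "is_ideal J" and "finite Z"
    and rel: "\<And>z i. z \<in> Z \<Longrightarrow> i < N \<Longrightarrow> \<exists>c. (\<forall>j<N. c j \<in> J) \<and> z * w i = (\<Sum>j<N. c j * w j)"
    and w: "i0 < N" "w i0 \<noteq> 0"
  shows "is_reduction J (ideal_generated (J \<union> Z))"
  using \<open>finite Z\<close> rel
proof (induction Z rule: finite_induct)
  case empty
  then show ?case using J by (simp add: is_reduction_refl ring_module.span_eq_iff[THEN iffD2])
next
  case (insert z Z)
  define K where "K = ideal_generated (J \<union> Z)"
  have K: "is_ideal K" "J \<subseteq> K" "is_reduction J K"
    using insert ring_module.span_superset[of "J \<union> Z"]
    by (auto simp: K_def is_ideal_generated)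
  define L where "L = ideal_generated (insert z K)"
  have L: "is_ideal L" "K \<subseteq> L" "z \<in> L"
    using ring_module.span_superset[of "insert z K"] by (auto simp: L_def is_ideal_generated)
  have "\<exists>C. \<forall>i<N. (\<forall>j<N. C i j \<in> J) \<and> z * w i = (\<Sum>j<N. C i j * w j)"
    using insert.prems[of z] by (intro choice) auto
  then obtain C where C: "\<And>i j. i < N \<Longrightarrow> j < N \<Longrightarrow> C i j \<in> J"
      "\<And>i. i < N \<Longrightarrow> z * w i = (\<Sum>j<N. C i j * w j)" by blast
  \<comment> \<open>The relations have coefficients in \<open>J \<subseteq> K\<close>, so the
    determinant trick applies over \<open>K\<close>, which contains the elements of \<open>Z\<close>
    adjoined so far.\<close>
  have "z ^ N \<in> ideal_prod K (ideal_power L (N - 1))"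
    using C K(2) by (intro determinant_trick[OF K(1) L, of N w C i0]) (auto simp: w)
  moreover have "N = Suc (N - 1)" using w by simp
  ultimately have "is_reduction K L"
    unfolding L_def by (intro reduction_insert[OF K(1), of z "N - 1"]) simp
  moreover have "L = ideal_generated (J \<union> insert z Z)"
  proof
    show "L \<subseteq> ideal_generated (J \<union> insert z Z)"
      unfolding L_def K_def using ring_module.span_mono[of "J \<union> Z" "J \<union> insert z Z"]
      by (intro ideal_generated_least is_ideal_generated) (auto intro: ideal_generated_base)
    show "ideal_generated (J \<union> insert z Z) \<subseteq> L"
      using L K(2) ring_module.span_superset[of "J \<union> Z"]
      by (intro ideal_generated_least) (auto simp: K_def)
  qed
  ultimately show ?case using reduction_trans[OF K(3)] by simp
qed

section \<open>Homogeneous parts and powers of the ideal of the origin\<close>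

text \<open>The substitution \<open>x \<mapsto> z\<close>, \<open>y \<mapsto> t z\<close> from \<open>k[x,y]\<close> to \<open>k[t][z]\<close>: the coefficient of
  \<open>z ^ d\<close> is the homogeneous part of degree \<open>d\<close>, dehomogenized by \<open>x = 1\<close>.\<close>

definition blowup :: "'a::field poly poly \<Rightarrow> 'a poly poly" where
  "blowup p = poly (map_poly (map_poly (\<lambda>a. [:a:])) p) (monom [:0, 1:] 1)"

definition form :: "nat \<Rightarrow> 'a::field poly poly \<Rightarrow> 'a poly" where
  "form d p = coeff (blowup p) d"

text \<open>Coefficients of \<open>u\<close> beyond degree \<open>d\<close> are discarded, so
  \<open>form d\<close> recovers \<open>u\<close> only if its degree is at most
  \<open>d\<close>.\<close>

definition homogenize :: "nat \<Rightarrow> 'a::field poly \<Rightarrow> 'a poly poly" where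
  "homogenize d u = (\<Sum>j\<le>d. monom (monom (coeff u j) (d - j)) j)"

text \<open>The power \<open>(x, y)^d\<close>, encoded through orders of vanishing so that
  membership can be read off homogeneous parts.\<close>

definition origin_power :: "nat \<Rightarrow> 'a::field poly poly set" where
  "origin_power d = {p. \<forall>e<d. form e p = 0}"

interpretation blowup_hom: comm_ring_hom "blowup :: 'a::field poly poly \<Rightarrow> _"
proof -
  interpret c: map_poly_comm_ring_hom "\<lambda>a::'a. [:a:]" ..
  interpret m: map_poly_comm_ring_hom "map_poly (\<lambda>a::'a. [:a:])" ..
  show "comm_ring_hom (blowup :: 'a poly poly \<Rightarrow> _)"
    by unfold_locales (simp_all add: blowup_def m.hom_add m.hom_mult)
qed

lemma coeff_form: "coeff (form d p) j = (if j \<le> d then coeff (coeff p j) (d - j) else 0)"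
proof -
  have z: "monom [:0, 1::'a:] 1 ^ i = monom (monom 1 i) i" for i
    using monom_altdef[of "1::'a" i] by (simp add: monom_power)
  have d: "degree (map_poly (map_poly (\<lambda>a. [:a:])) p) = degree p"
  proof (rule Polynomial.degree_map_poly)
    fix c :: "'a poly" assume "c \<noteq> 0"
    then have "coeff (map_poly (\<lambda>a. [:a:]) c) (degree c) \<noteq> 0" by (simp add: coeff_map_poly)
    then show "map_poly (\<lambda>a. [:a:]) c \<noteq> 0" by force
  qed
  have "form d p = (\<Sum>i\<le>degree p. coeff (monom (monom 1 i) i * map_poly (\<lambda>a. [:a:]) (coeff p i)) d)"
    unfolding form_def blowup_def poly_altdef d coeff_sum z by (simp add: coeff_map_poly mult.commute)
  also have "\<dots> = (\<Sum>i\<le>degree p. if i \<le> d then monom (coeff (coeff p i) (d - i)) i else 0)"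
    by (intro sum.cong refl) (auto simp: coeff_monom_mult coeff_map_poly smult_monom
        mult.commute[of "monom 1 _"])
  finally have "coeff (form d p) j = (\<Sum>i\<le>degree p. if i = j then (if i \<le> d then coeff (coeff p i) (d - i) else 0) else 0)"
    by (simp only: coeff_sum) (intro sum.cong refl, auto)
  then show ?thesis by (auto simp: coeff_eq_0)
qed

lemma degree_form: "degree (form d p) \<le> d"
  by (rule degree_le) (simp add: coeff_form)

lemma form_add: "form d (p + q) = form d p + form d q"
  and form_diff: "form d (p - q) = form d p - form d q"
  and form_0 [simp]: "form d 0 = 0"
  by (simp_all add: form_def blowup_hom.hom_add blowup_hom.hom_minus)

lemma poly_eqI_form:
  assumes "\<And>d. form d p = form d q"
  shows "p = q"
proof (intro poly_eqI)
  fix j i show "coeff (coeff p j) i = coeff (coeff q j) i"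
    using arg_cong[OF assms[of "i + j"], of "\<lambda>u. coeff u j"] by (simp add: coeff_form)
qed

lemma blowup_eq_0_iff: "blowup p = 0 \<longleftrightarrow> p = 0"
  using poly_eqI_form[of p 0] by (auto simp: form_def)

lemma blowup_eq_iff: "blowup p = blowup q \<longleftrightarrow> p = q"
  using blowup_eq_0_iff[of "p - q"] by (simp add: blowup_hom.hom_minus)

lemma coeff_homogenize: "coeff (coeff (homogenize d u) j) i = (if i + j = d then coeff u j else 0)"
proof -
  have "coeff (coeff (homogenize d u) j) i = (\<Sum>k\<le>d. if k = j then (if d - k = i then coeff u k else 0) else 0)"
    by (auto simp: homogenize_def coeff_sum intro!: sum.cong)
  also have "\<dots> = (if i + j = d then coeff u j else 0)" by auto
  finally show ?thesis .
qed

lemma blowup_homogenize: "degree u \<le> d \<Longrightarrow> blowup (homogenize d u) = monom u d"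
proof (intro poly_eqI)
  fix e j assume "degree u \<le> d"
  then show "coeff (coeff (blowup (homogenize d u)) e) j = coeff (coeff (monom u d) e) j"
    by (auto simp flip: form_def simp: coeff_form coeff_homogenize coeff_eq_0)
qed

lemma form_homogenize: "degree u \<le> d \<Longrightarrow> form e (homogenize d u) = (if e = d then u else 0)"
  by (simp add: form_def blowup_homogenize)

lemma form_homogenize_mult:
  "degree u \<le> d \<Longrightarrow> form e (homogenize d u * p) = (if d \<le> e then u * form (e - d) p else 0)"
  by (simp add: form_def blowup_hom.hom_mult blowup_homogenize coeff_monom_mult)

text \<open>Both sides have the same image under the injective homomorphism \<open>blowup\<close>,
  which turns forms into monomials in \<open>z\<close>.\<close>

lemma homogenize_mult:
  "degree u \<le> d \<Longrightarrow> degree w \<le> e \<Longrightarrow> homogenize d u * homogenize e w = homogenize (d + e) (u * w)"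
proof -
  assume a: "degree u \<le> d" "degree w \<le> e"
  then have "degree (u * w) \<le> d + e" using degree_mult_le[of u w] by linarith
  with a show ?thesis
    by (subst blowup_eq_iff[symmetric]) (simp add: blowup_hom.hom_mult blowup_homogenize mult_monom)
qed

lemma homogenize_add: "homogenize d (u + w) = homogenize d u + homogenize d w"
  by (simp add: homogenize_def sum.distrib flip: add_monom)

lemma homogenize_0 [simp]: "homogenize d 0 = 0"
  by (simp add: homogenize_def)

lemma homogenize_sum: "homogenize d (sum f A) = (\<Sum>a\<in>A. homogenize d (f a))"
  by (induction A rule: infinite_finite_induct) (simp_all add: homogenize_add)

lemma monomial_eq: "var_x ^ i * var_y ^ j = homogenize (i + j) (monom 1 j)"
proof -
  have 1: "blowup var_x = monom 1 1" "blowup var_y = monom [:0, 1:] 1"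
    by (simp_all add: blowup_def var_x_def var_y_def map_poly_pCons poly_monom monom_altdef)
  have "[:0, 1:] ^ j = (monom 1 j :: 'a poly)" by (simp add: monom_altdef)
  then have "blowup (var_x ^ i * var_y ^ j) = monom (monom (1::'a) j) (i + j)"
    by (simp add: blowup_hom.hom_mult blowup_hom.hom_power 1 monom_power mult_monom)
  then show ?thesis
    by (subst blowup_eq_iff[symmetric]) (simp add: blowup_homogenize degree_monom_eq)
qed

section \<open>The filtration by powers of (x, y)\<close>

lemma is_ideal_origin_power: "is_ideal (origin_power d)"
proof (rule is_idealI)
  fix r p :: "'a poly poly" assume p: "p \<in> origin_power d"
  have "form e (r * p) = 0" if "e < d" for e
    unfolding form_def blowup_hom.hom_mult coeff_mult
    using p that by (auto simp: origin_power_def form_def intro!: sum.neutral)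
  then show "r * p \<in> origin_power d" by (simp add: origin_power_def)
qed (auto simp: origin_power_def form_add)

lemma homogenize_in_origin_power: "degree u \<le> d \<Longrightarrow> homogenize d u \<in> origin_power d"
  by (simp add: origin_power_def form_homogenize)

text \<open>Homogeneous parts of a product are convolutions; up to degree \<open>d + e\<close> the
  only pair of degrees that can contribute is \<open>(d, e)\<close>.\<close>

lemma origin_power_mult:
  assumes "p \<in> origin_power d" and "q \<in> origin_power e"
  shows "p * q \<in> origin_power (d + e)" and "form (d + e) (p * q) = form d p * form e q"
proof -
  have 0: "form i p * form j q = 0" if "i < d \<or> j < e" for i j
    using assms that by (auto simp: origin_power_def)
  have f: "form m (p * q) = (\<Sum>i\<le>m. form i p * form (m - i) q)" for m
    by (simp add: form_def blowup_hom.hom_mult coeff_mult)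
  show "p * q \<in> origin_power (d + e)"
    unfolding origin_power_def mem_Collect_eq f by (intro allI impI sum.neutral ballI 0) auto
  have "(\<Sum>i\<le>d + e. form i p * form (d + e - i) q) = (\<Sum>i\<in>{d}. form i p * form (d + e - i) q)"
  proof (intro sum.mono_neutral_right ballI 0)
    fix i assume "i \<in> {..d + e} - {d}"
    then show "i < d \<or> d + e - i < e" by auto
  qed auto
  then show "form (d + e) (p * q) = form d p * form e q"
    unfolding f by simp
qed

lemma le_add_of_coeff_nonzero:
  assumes "p \<in> origin_power d" and c: "coeff (coeff p j) i \<noteq> 0"
  shows "d \<le> i + j"
proof (rule ccontr)
  assume "\<not> d \<le> i + j"
  then have "form (i + j) p = 0" using assms(1) by (simp add: origin_power_def)
  from arg_cong[OF this, of "\<lambda>u. coeff u j"] c show False by (simp add: coeff_form)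
qed

lemma monomial_ideal_subset_origin_power:
  assumes "X \<subseteq> {..n}"
  shows "ideal_generated ((\<lambda>i. var_x ^ (n - i) * var_y ^ i) ` X) \<subseteq> (origin_power n :: 'a::field poly poly set)"
proof (intro ideal_generated_least is_ideal_origin_power image_subsetI)
  fix i assume "i \<in> X"
  then have "i \<le> n" using assms by auto
  then show "var_x ^ (n - i) * var_y ^ i \<in> (origin_power n :: 'a poly poly set)"
    using homogenize_in_origin_power[of "monom (1 :: 'a) i" n] by (simp add: monomial_eq degree_monom_eq)
qed

text \<open>Together with \<open>le_add_of_coeff_nonzero\<close> this reduces claims about
  \<open>origin_power d\<close> to monomials of degree at least \<open>d\<close>; scalars are
  absorbed by the ideal.\<close>

lemma in_ideal_of_monomials:
  assumes L: "is_ideal L" and "\<And>i j. coeff (coeff p j) i \<noteq> 0 \<Longrightarrow> var_x ^ i * var_y ^ j \<in> L"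
  shows "p \<in> L"
proof -
  have m: "monom (monom a i) j = [:[:a:]:] * (var_x ^ i * var_y ^ j)" for a :: 'a and i j
  proof -
    have "var_x ^ i = ([:[:0, 1:] ^ i:] :: 'a poly poly)" by (simp add: var_x_def poly_const_pow)
    moreover have "var_y ^ j = (monom 1 j :: 'a poly poly)" by (simp add: var_y_def monom_altdef)
    ultimately show ?thesis by (simp add: smult_monom monom_altdef[of a i])
  qed
  have "monom (monom (coeff (coeff p j) i) i) j \<in> L" for i j
  proof (cases "coeff (coeff p j) i = 0")
    case False
    then show ?thesis unfolding m by (intro ideal_mult_left[OF L] assms(2))
  qed (simp add: ideal_zero[OF L])
  then have "(\<Sum>j\<le>degree p. \<Sum>i\<le>degree (coeff p j). monom (monom (coeff (coeff p j) i) i) j) \<in> L"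
    by (intro ideal_sum[OF L])
  moreover have "(\<Sum>j\<le>degree p. \<Sum>i\<le>degree (coeff p j). monom (monom (coeff (coeff p j) i) i) j) = p"
    by (simp add: poly_as_sum_of_monoms flip: monom_sum)
  ultimately show ?thesis by simp
qed

section \<open>Every reduction contains a power of the ideal of the origin\<close>

text \<open>On the lowest part, in degree \<open>d\<close>, multiplication by \<open>r\<close> acts
  as the scalar \<open>form 0 r\<close>. Hence \<open>D\<close> has to be only a linear subspace of
  \<open>k[t]\<close>.\<close>

lemma is_ideal_form:
  assumes "0 \<in> D" and "\<And>u w. u \<in> D \<Longrightarrow> w \<in> D \<Longrightarrow> u + w \<in> D" and "\<And>c u. u \<in> D \<Longrightarrow> Polynomial.smult c u \<in> D"
  shows "is_ideal {p \<in> origin_power d. form d p \<in> D}"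
proof (rule is_idealI)
  fix r p :: "'a poly poly" assume p: "p \<in> {p \<in> origin_power d. form d p \<in> D}"
  have r: "r \<in> origin_power 0" by (simp add: origin_power_def)
  obtain c where "form 0 r = [:c:]"
    using degree_form[of 0 r] by (auto elim: degree_eq_zeroE)
  then have "form d (r * p) = Polynomial.smult c (form d p)"
    using origin_power_mult(2)[OF r, of p d] p by simp
  then show "r * p \<in> {p \<in> origin_power d. form d p \<in> D}"
    using p assms(3) ideal_mult_left[OF is_ideal_origin_power] by auto
qed (use assms in \<open>auto simp: form_add ideal_zero[OF is_ideal_origin_power]
      intro: ideal_add[OF is_ideal_origin_power]\<close>)

lemma ideal_power_subset_origin_power:
  "I \<subseteq> origin_power n \<Longrightarrow> ideal_power I r \<subseteq> origin_power (n * r)"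
proof (induction r)
  case 0
  then show ?case by (simp add: origin_power_def)
next
  case (Suc r)
  have "ideal_prod I (ideal_power I r) \<subseteq> origin_power (n + n * r)"
    by (rule ideal_prod_least[OF is_ideal_origin_power]) (use Suc in \<open>blast intro: origin_power_mult(1)\<close>)
  then show ?case by simp
qed

text \<open>A linear test for reductions: in degree \<open>n + n * r\<close>, a product from
  \<open>J I^r\<close> has as its part a product of the degree \<open>n\<close> part of an element
  of \<open>J\<close> and a polynomial of degree at most \<open>n * r\<close>. The space
  \<open>D\<close> will be an ideal of \<open>k[t]\<close> or the kernel of a coefficient.\<close>

lemma form_reduction:
  fixes J I :: "'a::field poly poly set"
  assumes "ideal_power I (Suc r) = ideal_prod J (ideal_power I r)" and "J \<subseteq> I" and "I \<subseteq> origin_power n"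
    and "0 \<in> D" and "\<And>u w. u \<in> D \<Longrightarrow> w \<in> D \<Longrightarrow> u + w \<in> D" and "\<And>c u. u \<in> D \<Longrightarrow> Polynomial.smult c u \<in> D"
    and D: "\<And>a u. a \<in> J \<Longrightarrow> degree u \<le> n * r \<Longrightarrow> form n a * u \<in> D"
    and "p \<in> ideal_power I (Suc r)"
  shows "form (n + n * r) p \<in> D"
proof -
  have "ideal_prod J (ideal_power I r) \<subseteq> {p \<in> origin_power (n + n * r). form (n + n * r) p \<in> D}"
  proof (rule ideal_prod_least[OF is_ideal_form[OF assms(4-6)]])
    fix a b assume ab: "a \<in> J" "b \<in> ideal_power I r"
    then have "a \<in> origin_power n" "b \<in> origin_power (n * r)"
      using assms(2,3) ideal_power_subset_origin_power by blast+
    then show "a * b \<in> {p \<in> origin_power (n + n * r). form (n + n * r) p \<in> D}"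
      using D[OF ab(1) degree_form, of b] by (simp add: origin_power_mult)
  qed
  then show ?thesis using assms(1,8) by blast
qed

text \<open>A Bezout identity with bounded coefficients. A coefficient can be replaced by its
  remainder modulo \<open>f\<close> at the cost of a multiple of \<open>f\<close>; remainders have
  degree at most \<open>n - 1 \<le> e - n\<close>. This leaves \<open>h = s + q * f\<close> with
  \<open>s \<in> S\<close>, and comparing degrees bounds \<open>q\<close>.\<close>

lemma bounded_combination:
  fixes W :: "'a::field poly set"
  assumes W: "1 \<in> ideal_generated W" and f: "f \<in> W" "degree f = n" "n > 0" and e: "2 * n - 1 \<le> e"
    and S: "0 \<in> S" "\<And>u w. u \<in> S \<Longrightarrow> w \<in> S \<Longrightarrow> u + w \<in> S" "\<And>u. u \<in> S \<Longrightarrow> degree u \<le> e"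
    and WS: "\<And>c w. w \<in> W \<Longrightarrow> degree c \<le> e - n \<Longrightarrow> c * w \<in> S"
    and h: "degree h \<le> e"
  shows "h \<in> S"
proof -
  \<comment> \<open>Quantifying over all multipliers \<open>r\<close> makes \<open>T\<close> an
    ideal, so \<open>W \<subseteq> T\<close> implies \<open>1 \<in> T\<close>. The degree of
    \<open>q\<close> is left open until the end.\<close>
  define T where "T = {u. \<forall>r. \<exists>s\<in>S. \<exists>q. r * u = s + q * f}"
  have "is_ideal T"
  proof (rule is_idealI)
    show "0 \<in> T" using S(1) by (auto simp: T_def intro!: bexI[of _ 0] exI[of _ 0])
  next
    fix a b assume "a \<in> T" "b \<in> T"
    show "a + b \<in> T" unfolding T_def mem_Collect_eq
    proof
      fix r
      from \<open>a \<in> T\<close> \<open>b \<in> T\<close> obtain s q s' q'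
        where "s \<in> S" "r * a = s + q * f" "s' \<in> S" "r * b = s' + q' * f"
        unfolding T_def by blast
      then show "\<exists>s\<in>S. \<exists>q. r * (a + b) = s + q * f"
        by (intro bexI[of _ "s + s'"] exI[of _ "q + q'"]) (auto simp: S(2) algebra_simps)
    qed
  next
    fix r a assume "a \<in> T"
    then have "\<exists>s\<in>S. \<exists>q. (r' * r) * a = s + q * f" for r' unfolding T_def by blast
    then show "r * a \<in> T" unfolding T_def by (simp only: mem_Collect_eq mult.assoc simp_thms)
  qed
  moreover have "W \<subseteq> T"
  proof
    fix w assume w: "w \<in> W"
    show "w \<in> T" unfolding T_def mem_Collect_eq
    proof
      fix r
      have "f \<noteq> 0" using f by auto
      then have "r mod f = 0 \<or> degree (r mod f) < n" using degree_mod_less f by metis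
      then have "degree (r mod f) \<le> e - n" using e f by auto
      then have "(r mod f) * w \<in> S" by (intro WS w)
      moreover have "r * w = (r mod f) * w + (r div f * w) * f"
        by (subst div_mult_mod_eq[of r f, symmetric]) (simp only: distrib_right distrib_left mult_ac add_ac)
      ultimately show "\<exists>s\<in>S. \<exists>q. r * w = s + q * f" by blast
    qed
  qed
  ultimately have "1 \<in> T" using W ideal_generated_least by blast
  then have "\<exists>s\<in>S. \<exists>q. h * 1 = s + q * f" unfolding T_def by blast
  then obtain s q where s: "s \<in> S" "h = s + q * f" by auto
  then have "q * f = h - s" by simp
  then have "degree (q * f) \<le> e" using degree_diff_le[OF h S(3)[OF s(1)]] by simp
  then have "degree q \<le> e - n"
    using f e by (cases "q = 0"; cases "f = 0") (auto simp: degree_mult_eq)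
  then show ?thesis using s WS[OF f(1)] S(2) by blast
qed

lemma origin_power_subset_reduction:
  fixes J I :: "'a::field poly poly set"
  assumes J: "is_reduction J I" and I: "I \<subseteq> origin_power n" "var_x ^ n \<in> I" "var_y ^ n \<in> I" and n: "n > 0"
  shows "origin_power (2 * n - 1) \<subseteq> J"
proof -
  from J obtain r where "is_ideal J" "J \<subseteq> I"
    and r: "ideal_power I (Suc r) = ideal_prod J (ideal_power I r)"
    unfolding is_reduction_def by auto
  define W where "W = form n ` J"
  define m where "m = n + n * r"
  have m: "m = n * Suc r" by (simp add: m_def)
  have xy: "var_x ^ m \<in> ideal_power I (Suc r)" "var_y ^ m \<in> ideal_power I (Suc r)"
    unfolding m power_mult using I(2,3) by (auto intro!: power_in_ideal_power simp del: power_Suc ideal_power.simps)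
  note fr = form_reduction[OF r \<open>J \<subseteq> I\<close> I(1), folded m_def]
  \<comment> \<open>The linear test with the ideal generated by \<open>W\<close> as
    \<open>D\<close>: the part of \<open>var_x ^ m\<close> is \<open>1\<close>, so \<open>W\<close>
    generates the unit ideal.\<close>
  have "form m (var_x ^ m) \<in> ideal_generated W"
  proof (intro fr xy ideal_zero ideal_add is_ideal_generated)
    show "Polynomial.smult c u \<in> ideal_generated W" if "u \<in> ideal_generated W" for c u
      using ideal_mult_left[OF is_ideal_generated that, of "[:c:]"] by simp
    show "form n a * u \<in> ideal_generated W" if "a \<in> J" for a u
      using that by (intro ideal_mult_right is_ideal_generated ideal_generated_base) (simp add: W_def)
  qed
  moreover have "form m (var_x ^ m) = (1 :: 'a poly)"
    using monomial_eq[of m 0, where ?'a = 'a] form_homogenize[of "1 :: 'a poly" m m] by simp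
  ultimately have W1: "1 \<in> ideal_generated W" by simp
  \<comment> \<open>Otherwise no element of \<open>J I^r\<close> could have a nonzero coefficient at
    \<open>t^m\<close> in degree \<open>m\<close>, whereas \<open>var_y ^ m\<close> has the part
    \<open>t^m\<close>.\<close>
  have "\<exists>f\<in>W. degree f = n"
  proof (rule ccontr)
    assume *: "\<not> (\<exists>f\<in>W. degree f = n)"
    have "form m (var_y ^ m :: 'a poly poly) \<in> {u. coeff u m = 0}"
    proof (intro fr xy)
      fix a and u :: "'a poly" assume "a \<in> J" "degree u \<le> n * r"
      moreover from \<open>a \<in> J\<close> have "degree (form n a) < n"
        using * degree_form[of n a] by (auto simp: W_def nat_less_le)
      ultimately have "degree (form n a * u) < m"
        using degree_mult_le[of "form n a" u] by (simp add: m_def)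
      then show "form n a * u \<in> {u. coeff u m = 0}" by (simp add: coeff_eq_0)
    qed auto
    moreover have "form m (var_y ^ m) = (monom 1 m :: 'a poly)"
      using monomial_eq[of 0 m, where ?'a = 'a] by (simp add: form_homogenize degree_monom_eq)
    ultimately show False by simp
  qed
  then obtain f where f: "f \<in> W" "degree f = n" by blast
  \<comment> \<open>In each degree \<open>e \<ge> 2 * n - 1\<close> the lowest parts of elements of
    \<open>J\<close> exhaust all forms. Multiplication by forms of degree \<open>e - n\<close>
    supplies the bounded coefficients.\<close>
  have form_J: "h \<in> form e ` (J \<inter> origin_power e)" if e: "2 * n - 1 \<le> e" and h: "degree h \<le> e" for e h
  proof (rule bounded_combination[OF W1 f n e _ _ _ _ h])
    let ?S = "form e ` (J \<inter> origin_power e)"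
    show "0 \<in> ?S"
      using ideal_zero[OF \<open>is_ideal J\<close>] ideal_zero[OF is_ideal_origin_power, of e]
      by (intro image_eqI[of _ _ 0]) auto
    show "u + w \<in> ?S" if "u \<in> ?S" "w \<in> ?S" for u w
    proof -
      from that obtain p q where "u = form e p" "w = form e q" "p \<in> J \<inter> origin_power e" "q \<in> J \<inter> origin_power e"
        by blast
      then show ?thesis
        using ideal_add[OF \<open>is_ideal J\<close>] ideal_add[OF is_ideal_origin_power]
        by (intro image_eqI[of _ _ "p + q"]) (auto simp: form_add)
    qed
    show "degree u \<le> e" if "u \<in> ?S" for u using that degree_form by auto
    show "c * w \<in> ?S" if "w \<in> W" "degree c \<le> e - n" for c w
    proof -
      from that obtain j where j: "j \<in> J" "w = form n j" by (auto simp: W_def)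
      have ne: "n \<le> e" "e - (e - n) = n" "e - n + n = e" using e n by auto
      have "j \<in> origin_power n" using j \<open>J \<subseteq> I\<close> I(1) by blast
      from origin_power_mult(1)[OF homogenize_in_origin_power[OF that(2)] this]
      have "homogenize (e - n) c * j \<in> origin_power e" using ne by simp
      moreover have "form e (homogenize (e - n) c * j) = c * w"
        using form_homogenize_mult[OF that(2)] ne j by simp
      ultimately show ?thesis
        using ideal_mult_left[OF \<open>is_ideal J\<close> j(1)] by (metis IntI image_eqI)
    qed
  qed
  \<comment> \<open>A monomial of degree at least \<open>2 * m\<close> is divisible by
    \<open>var_x ^ m\<close> or \<open>var_y ^ m\<close>, and both lie in \<open>J\<close>.\<close>
  define E where "E = 2 * m"
  have "ideal_prod J (ideal_power I r) \<subseteq> J"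
    by (intro ideal_prod_least \<open>is_ideal J\<close> ideal_mult_right)
  then have xyJ: "var_x ^ m \<in> J" "var_y ^ m \<in> J" using xy r by auto
  have "2 * n - 1 \<le> E" by (simp add: E_def m_def)
  moreover have "origin_power E \<subseteq> J"
  proof
    fix p :: "'a poly poly" assume p: "p \<in> origin_power E"
    show "p \<in> J"
    proof (rule in_ideal_of_monomials[OF \<open>is_ideal J\<close>])
      fix i j assume c: "coeff (coeff p j) i \<noteq> 0"
      have "i + j \<ge> E" using le_add_of_coeff_nonzero[OF p c] .
      then have "m \<le> i \<or> m \<le> j" by (auto simp: E_def)
      then show "var_x ^ i * var_y ^ j \<in> J"
      proof
        assume "m \<le> i"
        then have "var_x ^ i = var_x ^ (i - m) * (var_x ^ m :: 'a poly poly)" by (simp flip: power_add)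
        then show ?thesis using ideal_mult_left[OF \<open>is_ideal J\<close> xyJ(1)] ideal_mult_right[OF \<open>is_ideal J\<close>] by simp
      next
        assume "m \<le> j"
        then have "var_y ^ j = var_y ^ (j - m) * (var_y ^ m :: 'a poly poly)" by (simp flip: power_add)
        then show ?thesis using ideal_mult_left[OF \<open>is_ideal J\<close> xyJ(2)] ideal_mult_left[OF \<open>is_ideal J\<close>] by simp
      qed
    qed
  qed
  \<comment> \<open>Descending induction from \<open>E\<close>: an element of
    \<open>origin_power d\<close> agrees in degree \<open>d\<close> with an element of
    \<open>J\<close>, and the difference lies in the next power.\<close>
  ultimately show ?thesis
  proof (induction rule: inc_induct)
    case (step d)
    show ?case
    proof
      fix h :: "'a poly poly" assume h: "h \<in> origin_power d"
      obtain j where j: "j \<in> J" "j \<in> origin_power d" "form d h = form d j"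
        using form_J[OF step.hyps(1) degree_form, of h] by blast
      have "h - j \<in> origin_power (Suc d)"
        using h j by (auto simp: origin_power_def form_diff less_Suc_eq)
      then have "h - j \<in> J" using step by blast
      from ideal_add[OF \<open>is_ideal J\<close> this j(1)] show "h \<in> J" by simp
    qed
  qed
qed

section \<open>Generic coprimality and limits in one variable\<close>

lemma ideal_generated_mono: "A \<subseteq> ideal_generated B \<Longrightarrow> ideal_generated A \<subseteq> ideal_generated B"
  by (intro ideal_generated_least is_ideal_generated)

section \<open>Generic members of pencils of polynomials\<close>

lemma poly_ideal_principal:
  fixes L :: "'a::field poly set"
  assumes L: "is_ideal L"
  obtains d where "d \<in> L" and "\<And>u. u \<in> L \<Longrightarrow> d dvd u"
proof (cases "L \<subseteq> {0}")
  case True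
  then show ?thesis by (intro that[of 0]) (use ideal_zero[OF L] in auto)
next
  case False
  then obtain d where d: "d \<in> L" "d \<noteq> 0" "\<And>u. u \<in> L \<Longrightarrow> u \<noteq> 0 \<Longrightarrow> degree d \<le> degree u"
    using exists_least_iff[of "\<lambda>m. \<exists>u\<in>L. u \<noteq> 0 \<and> degree u = m"] by (metis insertI1 not_le subsetI)
  have "d dvd u" if "u \<in> L" for u
  proof -
    have "u - (u div d) * d \<in> L" using ideal_diff[OF L that ideal_mult_left[OF L d(1)]] .
    then have "u mod d \<in> L" by (simp add: minus_div_mult_eq_mod)
    then have "u mod d = 0" using d(3)[of "u mod d"] degree_mod_less[OF d(2), of u] by (metis not_le)
    then show ?thesis by (simp add: mod_eq_0_iff_dvd)
  qed
  with d(1) that show ?thesis by blast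
qed

text \<open>Induction on the degree of \<open>f\<close>. If \<open>c0\<close> is a bad parameter,
  the gcd \<open>d\<close> of \<open>f\<close> and the member at \<open>c0\<close> is split off from
  \<open>f\<close>; every other bad parameter is already bad for the cofactor.\<close>

lemma finite_not_coprime_pencil:
  fixes f h1 h2 :: "'a::field poly"
  assumes "f \<noteq> 0" and "1 \<in> ideal_generated {f, h1, h2}"
  shows "finite {c. 1 \<notin> ideal_generated {f, h1 + Polynomial.smult c h2}}"
  using assms
proof (induction "degree f" arbitrary: f rule: less_induct)
  case less
  define g where "g c = h1 + Polynomial.smult c h2" for c
  show ?case
  proof (cases "{c. 1 \<notin> ideal_generated {f, g c}} = {}")
    case False
    then obtain c0 where c0: "1 \<notin> ideal_generated {f, g c0}" by blast
    obtain d where d: "d \<in> ideal_generated {f, g c0}" "\<And>u. u \<in> ideal_generated {f, g c0} \<Longrightarrow> d dvd u"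
      using poly_ideal_principal[OF is_ideal_generated] by blast
    have "d dvd f" "d dvd g c0" by (auto intro!: d(2) ideal_generated_base)
    then obtain f' e where f': "f = f' * d" and e: "g c0 = e * d" by (metis dvd_def mult.commute)
    have nz: "f' \<noteq> 0" "d \<noteq> 0" using less.prems f' by auto
    have "\<not> d dvd 1"
      using d(1) c0 ideal_mult_left[OF is_ideal_generated d(1)] by (metis dvd_def mult.commute)
    then have "degree d > 0" using nz is_unit_iff_degree by auto
    then have "degree f' < degree f" using f' nz by (simp add: degree_mult_eq)
    moreover have "1 \<in> ideal_generated {f', h1, h2}"
    proof -
      have "f \<in> ideal_generated {f', h1, h2}"
        unfolding f' by (intro ideal_mult_right is_ideal_generated ideal_generated_base) simp
      then have "ideal_generated {f, h1, h2} \<subseteq> ideal_generated {f', h1, h2}"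
        by (intro ideal_generated_mono) (auto intro: ideal_generated_base)
      then show ?thesis using less.prems by blast
    qed
    ultimately have fin: "finite {c. 1 \<notin> ideal_generated {f', g c}}"
      using less.hyps[of f'] nz by (simp add: g_def)
    have "1 \<in> ideal_generated {f, g c}" if c: "c \<noteq> c0" "1 \<in> ideal_generated {f', g c}" for c
    proof -
      let ?K = "ideal_generated {f, g c}" and ?D = "ideal_generated {d, g c}"
      have base: "d \<in> ?D" "g c \<in> ?D" "f \<in> ?K" "g c \<in> ?K" by (auto intro: ideal_generated_base)
      \<comment> \<open>Two distinct members \<open>g c\<close> and \<open>g c0\<close> of the
        pencil span \<open>h1\<close> and \<open>h2\<close>. As \<open>?D\<close> also contains
        \<open>f\<close>, it is the unit ideal.\<close>
      have gc0: "g c0 \<in> ?D" and fD: "f \<in> ?D" unfolding e f' by (auto intro: ideal_mult_left is_ideal_generated base)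
      have "g c - g c0 = [:c - c0:] * h2" by (simp add: g_def smult_diff_left)
      then have "h2 = [:inverse (c - c0):] * (g c - g c0)" using c by simp
      then have h2: "h2 \<in> ?D" using ideal_mult_left[OF is_ideal_generated ideal_diff[OF is_ideal_generated base(2) gc0]] by metis
      have "h1 = g c - [:c:] * h2" by (simp add: g_def)
      then have h1: "h1 \<in> ?D" using ideal_diff[OF is_ideal_generated base(2) ideal_mult_left[OF is_ideal_generated h2]] by metis
      have "1 \<in> ?D" using ideal_generated_mono[of "{f, h1, h2}" "{d, g c}"] fD h1 h2 less.prems by blast
      \<comment> \<open>Because \<open>f' * d = f\<close>, coprimality of \<open>f'\<close> and
        \<open>g c\<close> puts \<open>d\<close> into \<open>?K\<close>, so that
        \<open>?D \<subseteq> ?K\<close>.\<close>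
      have "ideal_generated {f', g c} \<subseteq> {u. u * d \<in> ?K}"
        using base by (intro ideal_generated_least is_ideal_colon is_ideal_generated)
          (auto simp: f'[symmetric] intro: ideal_mult_right is_ideal_generated)
      then have "d \<in> ?K" using c(2) by auto
      then have "?D \<subseteq> ?K" using base by (intro ideal_generated_mono) auto
      then show ?thesis using \<open>1 \<in> ?D\<close> by blast
    qed
    then have "{c. 1 \<notin> ideal_generated {f, g c}} \<subseteq> insert c0 {c. 1 \<notin> ideal_generated {f', g c}}" by blast
    then show ?thesis using fin finite_subset unfolding g_def by blast
  qed (simp add: g_def)
qed

text \<open>After division by the gcd \<open>e\<close> of the three polynomials, all but finitely
  many parameters are good, and an infinite field contains a good one. Multiplying back puts
  \<open>e\<close>, hence \<open>h1\<close> and \<open>h2\<close>, into the ideal.\<close>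

lemma ex_generic_sum:
  fixes f h1 h2 :: "'a::field poly"
  assumes inf: "infinite (UNIV :: 'a set)" and f: "f \<noteq> 0"
  obtains c where "h1 \<in> ideal_generated {f, h1 + Polynomial.smult c h2}"
    and "h2 \<in> ideal_generated {f, h1 + Polynomial.smult c h2}"
proof -
  let ?L = "ideal_generated {f, h1, h2}"
  obtain e where e: "e \<in> ?L" "\<And>u. u \<in> ?L \<Longrightarrow> e dvd u"
    using poly_ideal_principal[OF is_ideal_generated] by blast
  have "e dvd f" "e dvd h1" "e dvd h2" by (auto intro!: e(2) ideal_generated_base)
  then obtain f' h1' h2' where eq: "f = f' * e" "h1 = h1' * e" "h2 = h2' * e"
    unfolding dvd_def by (metis mult.commute)
  have nz: "e \<noteq> 0" "f' \<noteq> 0" using f eq by auto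
  have "?L \<subseteq> {u. \<exists>v\<in>ideal_generated {f', h1', h2'}. u = v * e}"
  proof (intro ideal_generated_least is_idealI)
    show "{f, h1, h2} \<subseteq> {u. \<exists>v\<in>ideal_generated {f', h1', h2'}. u = v * e}"
      using eq by (auto intro: ideal_generated_base)
  next
    fix r u assume "u \<in> {u. \<exists>v\<in>ideal_generated {f', h1', h2'}. u = v * e}"
    then obtain v where "v \<in> ideal_generated {f', h1', h2'}" "u = v * e" by blast
    then show "r * u \<in> {u. \<exists>v\<in>ideal_generated {f', h1', h2'}. u = v * e}"
      by (intro CollectI bexI[of _ "r * v"] ideal_mult_left is_ideal_generated) (simp_all add: mult.assoc)
  next
    fix u w assume "u \<in> {u. \<exists>v\<in>ideal_generated {f', h1', h2'}. u = v * e}" "w \<in> {u. \<exists>v\<in>ideal_generated {f', h1', h2'}. u = v * e}"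
    then obtain v v' where "v \<in> ideal_generated {f', h1', h2'}" "u = v * e"
      "v' \<in> ideal_generated {f', h1', h2'}" "w = v' * e" by blast
    then show "u + w \<in> {u. \<exists>v\<in>ideal_generated {f', h1', h2'}. u = v * e}"
      by (intro CollectI bexI[of _ "v + v'"] ideal_add is_ideal_generated) (simp_all add: distrib_right)
  qed (auto intro!: bexI[of _ 0] ideal_zero is_ideal_generated)
  with e(1) obtain v where "v \<in> ideal_generated {f', h1', h2'}" "e = v * e" by blast
  then have "1 \<in> ideal_generated {f', h1', h2'}" using nz by simp
  from finite_not_coprime_pencil[OF nz(2) this]
  have "{c. 1 \<notin> ideal_generated {f', h1' + Polynomial.smult c h2'}} \<noteq> UNIV" using inf by auto
  then obtain c where c: "1 \<in> ideal_generated {f', h1' + Polynomial.smult c h2'}" by blast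
  let ?K = "ideal_generated {f, h1 + Polynomial.smult c h2}"
  have "ideal_generated {f', h1' + Polynomial.smult c h2'} \<subseteq> {u. u * e \<in> ?K}"
    by (intro ideal_generated_least is_ideal_colon is_ideal_generated)
      (auto simp: eq distrib_right intro!: ideal_generated_base)
  then have "e \<in> ?K" using c by auto
  then show ?thesis
    using ideal_mult_left[OF is_ideal_generated] by (intro that[of c]) (auto simp: eq(2,3))
qed

text \<open>The elements of \<open>H\<close> are absorbed into one \<open>g\<close> successively; at
  each step the ideal of \<open>f\<close> and \<open>g\<close> grows.\<close>

lemma ex_generic_combination:
  fixes f :: "'a::field poly"
  assumes inf: "infinite (UNIV :: 'a set)" and f: "f \<noteq> 0" and "finite H" and "H \<subseteq> V"
    and V: "0 \<in> V" "\<And>u w. u \<in> V \<Longrightarrow> w \<in> V \<Longrightarrow> u + w \<in> V" "\<And>c u. u \<in> V \<Longrightarrow> Polynomial.smult c u \<in> V"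
  shows "\<exists>g\<in>V. H \<subseteq> ideal_generated {f, g}"
  using assms(3,4)
proof (induction H rule: finite_induct)
  case (insert h H)
  then obtain g where g: "g \<in> V" "H \<subseteq> ideal_generated {f, g}" by auto
  obtain c where c: "g \<in> ideal_generated {f, g + Polynomial.smult c h}"
      "h \<in> ideal_generated {f, g + Polynomial.smult c h}"
    using ex_generic_sum[OF inf f, of g h] .
  have "ideal_generated {f, g} \<subseteq> ideal_generated {f, g + Polynomial.smult c h}"
    using c by (intro ideal_generated_mono) (auto intro: ideal_generated_base)
  moreover have "g + Polynomial.smult c h \<in> V" using V g insert.prems by auto
  ultimately show ?case using c g by (intro bexI[of _ "g + Polynomial.smult c h"]) auto
qed (use V in auto)

section \<open>Binomials and the gcd of their exponents\<close>

text \<open>Euclid's algorithm by repeated subtraction. The form of \<open>sub\<close> avoids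
  truncated differences.\<close>

lemma Gcd_closed:
  fixes X T :: "nat set"
  assumes "finite X" and "X \<subseteq> T" and "0 \<in> T" and sub: "\<And>m l. m + l \<in> T \<Longrightarrow> l \<in> T \<Longrightarrow> m \<in> T"
  shows "Gcd X \<in> T"
proof -
  have mod: "m mod l \<in> T" if "m \<in> T" "l \<in> T" for m l
    using that
  proof (induction m rule: less_induct)
    case (less m)
    show ?case
    proof (cases "m < l \<or> l = 0")
      case False
      then have "m - l \<in> T" "m - l < m" using sub[of "m - l" l] less.prems by auto
      then show ?thesis using less False by (simp add: le_mod_geq)
    qed (use less in auto)
  qed
  have gcd: "gcd m l \<in> T" if "m \<in> T" "l \<in> T" for m l
    using that by (induction m l rule: gcd_nat_induct) (auto simp: mod gcd_red_nat[symmetric] gcd.commute)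
  from assms(1,2) show ?thesis
    by (induction X rule: finite_induct) (auto simp: \<open>0 \<in> T\<close> gcd)
qed

text \<open>The exponents \<open>m\<close> with \<open>t^m - a^m \<in> L\<close> are closed under
  subtraction, since \<open>a^l (t^m - a^m) = (t^(m+l) - a^(m+l)) - t^m (t^l - a^l)\<close> and
  \<open>a\<close> is invertible. The gcd condition on the exponents of \<open>I\<close> takes
  effect here.\<close>

lemma linear_in_ideal_of_binomials:
  fixes a :: "'a::field"
  assumes L: "is_ideal L" and a: "a \<noteq> 0" and "finite X" and "Gcd X = 1"
    and X: "\<And>m. m \<in> X \<Longrightarrow> monom 1 m - [:a ^ m:] \<in> L"
  shows "[:-a, 1:] \<in> L"
proof -
  define T where "T = {m. monom 1 m - [:a ^ m:] \<in> L}"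
  have "Gcd X \<in> T"
  proof (rule Gcd_closed[OF \<open>finite X\<close>])
    show "0 \<in> T" using ideal_zero[OF L] by (simp add: T_def pCons_one flip: one_pCons)
    fix m l assume "m + l \<in> T" "l \<in> T"
    then have "(monom 1 (m + l) - [:a ^ (m + l):]) - monom 1 m * (monom 1 l - [:a ^ l:]) \<in> L"
      unfolding T_def by (simp only: mem_Collect_eq ideal_diff[OF L] ideal_mult_left[OF L])
    also have "(monom 1 (m + l) - [:a ^ (m + l):]) - monom 1 m * (monom 1 l - [:a ^ l:])
        = [:a ^ l:] * (monom 1 m - [:a ^ m:])"
      by (simp add: algebra_simps mult_monom power_add smult_monom)
    finally have "[:inverse (a ^ l):] * ([:a ^ l:] * (monom 1 m - [:a ^ m:])) \<in> L"
      by (rule ideal_mult_left[OF L])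
    then show "m \<in> T" using a by (simp add: T_def mult.assoc[symmetric])
  qed (use X in \<open>auto simp: T_def\<close>)
  then show ?thesis using assms(4) by (simp add: T_def monom_altdef)
qed

section \<open>Limits of linear dependencies\<close>

text \<open>The determinant of \<open>A + e B\<close> is a polynomial in \<open>e\<close>. With
  infinitely many roots it vanishes identically, in particular at \<open>e = 0\<close>; this
  replaces a passage to the limit.\<close>

lemma singular_limit:
  fixes A B :: "nat \<Rightarrow> nat \<Rightarrow> 'a::field"
  assumes "infinite {e. \<exists>v. (\<exists>j<N. v j \<noteq> 0) \<and> (\<forall>i<N. (\<Sum>j<N. (A i j + e * B i j) * v j) = 0)}"
  shows "\<exists>v. (\<exists>j<N. v j \<noteq> 0) \<and> (\<forall>i<N. (\<Sum>j<N. A i j * v j) = 0)"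
proof -
  define M where "M = mat N N (\<lambda>(i, j). [:A i j, B i j:])"
  have M: "M \<in> carrier_mat N N" by (simp add: M_def)
  have det: "det (map_mat (\<lambda>q. poly q e) M) = poly (det M) e" for e
    by (rule comm_ring_hom.hom_det) (unfold_locales; simp)
  have iff: "poly (det M) e = 0 \<longleftrightarrow> (\<exists>v. (\<exists>j<N. v j \<noteq> 0) \<and> (\<forall>i<N. (\<Sum>j<N. (A i j + e * B i j) * v j) = 0))" for e
  proof -
    have Me: "map_mat (\<lambda>q. poly q e) M \<in> carrier_mat N N" using M by simp
    have ent: "(map_mat (\<lambda>q. poly q e) M *\<^sub>v v) = 0\<^sub>v N \<longleftrightarrow> (\<forall>i<N. (\<Sum>j<N. (A i j + e * B i j) * vec_index v j) = 0)"
      if "v \<in> carrier_vec N" for v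
      using that by (auto simp: vec_eq_iff M_def scalar_prod_def atLeast0LessThan mult.commute[of e])
    show ?thesis
      unfolding det[symmetric] det_0_iff_vec_prod_zero[OF Me]
    proof safe
      fix v assume v: "v \<in> carrier_vec N" "v \<noteq> 0\<^sub>v N" "map_mat (\<lambda>q. poly q e) M *\<^sub>v v = 0\<^sub>v N"
      then have "\<exists>j<N. vec_index v j \<noteq> 0" by (auto simp: vec_eq_iff)
      then show "\<exists>v. (\<exists>j<N. v j \<noteq> 0) \<and> (\<forall>i<N. (\<Sum>j<N. (A i j + e * B i j) * v j) = 0)"
        using ent[OF v(1)] v(3) by blast
    next
      fix v :: "nat \<Rightarrow> 'a" and j assume v: "\<forall>i<N. (\<Sum>j<N. (A i j + e * B i j) * v j) = 0" "j < N" "v j \<noteq> 0"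
      then have "map_mat (\<lambda>q. poly q e) M *\<^sub>v vec N v = 0\<^sub>v N" by (subst ent) auto
      moreover have "vec N v \<noteq> 0\<^sub>v N" using v by (metis index_vec index_zero_vec(1))
      ultimately show "\<exists>v. v \<in> carrier_vec N \<and> v \<noteq> 0\<^sub>v N \<and> map_mat (\<lambda>q. poly q e) M *\<^sub>v v = 0\<^sub>v N"
        by (intro exI[of _ "vec N v"]) simp
    qed
  qed
  from assms have "infinite {e. poly (det M) e = 0}" unfolding iff .
  then have "det M = 0" using poly_roots_finite by blast
  then have "poly (det M) 0 = 0" by simp
  then show ?thesis unfolding iff by simp
qed

text \<open>The coefficients below \<open>N\<close> give a square system. As the \<open>c j\<close>
  have degree below \<open>N\<close>, a solution of this system at \<open>e = 0\<close> is a linear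
  relation among them.\<close>

lemma dependent_limit:
  fixes c d :: "nat \<Rightarrow> 'a::field poly"
  assumes inf: "infinite {e. \<exists>v. (\<exists>j<N. v j \<noteq> 0) \<and> (\<Sum>j<N. Polynomial.smult (v j) (c j + Polynomial.smult e (d j))) = 0}"
    and deg: "\<And>j. j < N \<Longrightarrow> degree (c j) < N"
  shows "\<exists>v. (\<exists>j<N. v j \<noteq> 0) \<and> (\<Sum>j<N. Polynomial.smult (v j) (c j)) = 0"
proof -
  have "\<exists>v. (\<exists>j<N. v j \<noteq> 0) \<and> (\<forall>i<N. (\<Sum>j<N. coeff (c j) i * v j) = 0)"
  proof (rule singular_limit, rule infinite_super[OF _ inf], safe)
    fix e v j assume v: "(\<Sum>j<N. Polynomial.smult (v j) (c j + Polynomial.smult e (d j))) = 0" "j < N" "v j \<noteq> 0"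
    have "(\<Sum>j<N. (coeff (c j) i + e * coeff (d j) i) * v j) = 0" for i
      using arg_cong[OF v(1), of "\<lambda>p. coeff p i"] by (simp add: coeff_sum mult.commute)
    then show "\<exists>v. (\<exists>j<N. v j \<noteq> 0) \<and> (\<forall>i<N. (\<Sum>j<N. (coeff (c j) i + e * coeff (d j) i) * v j) = 0)"
      using v by blast
  qed
  then obtain v where v: "\<exists>j<N. v j \<noteq> 0" "\<And>i. i < N \<Longrightarrow> (\<Sum>j<N. coeff (c j) i * v j) = 0" by blast
  have "(\<Sum>j<N. Polynomial.smult (v j) (c j)) = 0"
  proof (rule poly_eqI)
    fix i
    have "coeff (\<Sum>j<N. Polynomial.smult (v j) (c j)) i = (\<Sum>j<N. coeff (c j) i * v j)"
      by (simp add: coeff_sum mult.commute)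
    also have "\<dots> = 0"
    proof (cases "i < N")
      case False
      then have "coeff (c j) i = 0" if "j < N" for j
        using deg[OF that] by (intro coeff_eq_0) simp
      then show ?thesis by simp
    qed (rule v)
    finally show "coeff (\<Sum>j<N. Polynomial.smult (v j) (c j)) i = coeff 0 i" by simp
  qed
  with v(1) show ?thesis by blast
qed

lemma sum_split_two_blocks:
  fixes F :: "nat \<Rightarrow> 'b::comm_monoid_add"
  shows "(\<Sum>j<2 * m + 1. F j) = (\<Sum>j<m. F j) + (\<Sum>j<m. F (m + j)) + F (2 * m)"
proof -
  have "{..<2 * m + 1} = insert (2 * m) ({..<m} \<union> (\<lambda>j. m + j) ` {..<m})"
  proof (intro equalityI subsetI)
    fix j assume "j \<in> {..<2 * m + 1}"
    then consider "j < m" | "j = 2 * m" | "j \<ge> m" "j - m < m" by fastforce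
    then show "j \<in> insert (2 * m) ({..<m} \<union> (\<lambda>j. m + j) ` {..<m})"
      by cases (auto intro: image_eqI[of _ _ "j - m"])
  qed auto
  also have "sum F \<dots> = F (2 * m) + sum F ({..<m} \<union> (\<lambda>j. m + j) ` {..<m})"
    by (intro sum.insert) auto
  also have "sum F ({..<m} \<union> (\<lambda>j. m + j) ` {..<m}) = sum F {..<m} + sum F ((\<lambda>j. m + j) ` {..<m})"
    by (intro sum.union_disjoint) auto
  also have "sum F ((\<lambda>j. m + j) ` {..<m}) = (\<Sum>j<m. F (m + j))"
    by (subst sum.reindex) (auto simp: inj_on_def)
  finally show ?thesis by (simp add: ac_simps)
qed

lemma poly_eq_sum_monom: "degree p < m \<Longrightarrow> (\<Sum>j<m. monom (coeff p j) j) = p"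
  using poly_as_sum_of_monoms'[of p "m - 1"] by (cases m) (auto simp: lessThan_Suc_atMost)

lemma degree_sum_monom_less: "m > 0 \<Longrightarrow> degree (\<Sum>j<m. monom (v j) j) < m"
  by (intro degree_lessI) (auto simp: coeff_sum)

text \<open>The space \<open>f P + (g + e) P\<close>, where \<open>P\<close> consists of the polynomials of degree at most \<open>n - 2\<close>,
  is a hyperplane in the polynomials of degree at most \<open>2 n - 2\<close> for generic \<open>e\<close>. Because
  \<open>gcd f g = t - a\<close>, its limit for \<open>e \<rightarrow> 0\<close> is the hyperplane of polynomials that vanish at \<open>a\<close>.\<close>

lemma root_of_limit:
  fixes f g u :: "'a::field poly"
  assumes n: "n \<ge> 2" and f: "degree f = n" and g: "degree g \<le> n" and u: "degree u \<le> 2 * n - 2"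
    and roots: "poly f a = 0" "poly g a = 0" and gcd: "[:-a, 1:] \<in> ideal_generated {f, g}"
    and inf: "infinite {e. \<exists>p q. degree p \<le> n - 2 \<and> degree q \<le> n - 2 \<and> u = p * f + q * (g + [:e:])}"
  shows "poly u a = 0"
proof -
  define m where "m = n - 1"
  have m: "n = m + 1" "m > 0" using n by (auto simp: m_def)
  \<comment> \<open>The \<open>2 * m + 1\<close> vectors are \<open>t^j f\<close> and
    \<open>t^j g\<close> for \<open>j < m\<close>, and \<open>u\<close>. Adding \<open>e\<close>
    times \<open>d\<close> replaces \<open>g\<close> by \<open>g + e\<close>.\<close>
  define c where "c j = (if j < m then monom 1 j * f else if j < 2 * m then monom 1 (j - m) * g else u)" for j
  define d :: "nat \<Rightarrow> 'a poly" where "d j = (if j < m then 0 else if j < 2 * m then monom 1 (j - m) else 0)" for j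
  have sum: "(\<Sum>j<2 * m + 1. Polynomial.smult (v j) (c j + Polynomial.smult e (d j)))
      = (\<Sum>j<m. monom (v j) j) * f + (\<Sum>j<m. monom (v (m + j)) j) * (g + [:e:]) + Polynomial.smult (v (2 * m)) u"
    for v e
  proof -
    have "(\<Sum>j<m. Polynomial.smult (v j) (c j + Polynomial.smult e (d j))) = (\<Sum>j<m. monom (v j) j) * f"
      unfolding sum_distrib_right by (intro sum.cong refl) (simp add: c_def d_def smult_monom flip: mult_smult_left)
    moreover have "(\<Sum>j<m. Polynomial.smult (v (m + j)) (c (m + j) + Polynomial.smult e (d (m + j))))
        = (\<Sum>j<m. monom (v (m + j)) j) * (g + [:e:])"
      unfolding sum_distrib_right
      by (intro sum.cong refl) (simp add: c_def d_def smult_monom distrib_left smult_add_right mult.commute[of e] flip: mult_smult_left)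
    moreover have "c (2 * m) = u" "d (2 * m) = 0" by (simp_all add: c_def d_def)
    ultimately show ?thesis unfolding sum_split_two_blocks by simp
  qed
  have "\<exists>v. (\<exists>j<2 * m + 1. v j \<noteq> 0) \<and> (\<Sum>j<2 * m + 1. Polynomial.smult (v j) (c j)) = 0"
  proof (rule dependent_limit[of _ _ d], rule infinite_super[OF _ inf], safe)
    fix e p q assume pq: "degree p \<le> n - 2" "degree q \<le> n - 2" "u = p * f + q * (g + [:e:])"
    \<comment> \<open>The coefficient \<open>-1\<close> at \<open>u\<close> makes the relation
      nontrivial for any \<open>p\<close> and \<open>q\<close>.\<close>
    define v where "v j = (if j < m then coeff p j else if j < 2 * m then coeff q (j - m) else -1)" for j
    have "degree p < m" "degree q < m" using pq m by auto
    then have "(\<Sum>j<m. monom (v j) j) = p" "(\<Sum>j<m. monom (v (m + j)) j) = q"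
      using poly_eq_sum_monom[of p m] poly_eq_sum_monom[of q m] by (auto simp: v_def intro: sum.cong)
    then have "(\<Sum>j<2 * m + 1. Polynomial.smult (v j) (c j + Polynomial.smult e (d j))) = 0"
      unfolding sum using pq(3) by (simp add: v_def)
    then show "\<exists>v. (\<exists>j<2 * m + 1. v j \<noteq> 0) \<and> (\<Sum>j<2 * m + 1. Polynomial.smult (v j) (c j + Polynomial.smult e (d j))) = 0"
      by (intro exI[of _ v] conjI exI[of _ "2 * m"]) (auto simp: v_def)
  next
    fix j assume "j < 2 * m + 1"
    then show "degree (c j) < 2 * m + 1"
      using f g u m degree_mult_le[of "monom 1 j" f] degree_mult_le[of "monom 1 (j - m)" g]
      by (auto simp: c_def degree_monom_eq)
  qed
  then obtain v where v: "\<exists>j<2 * m + 1. v j \<noteq> 0" "(\<Sum>j<2 * m + 1. Polynomial.smult (v j) (c j)) = 0" by blast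
  define p q where "p = (\<Sum>j<m. monom (v j) j)" and "q = (\<Sum>j<m. monom (v (m + j)) j)"
  have rel: "p * f + q * g + Polynomial.smult (v (2 * m)) u = 0"
    using sum[of v 0] v(2) by (simp add: p_def q_def)
  \<comment> \<open>If \<open>u\<close> occurs in the limit relation, evaluation at \<open>a\<close>
    suffices. Otherwise the relation is a syzygy of \<open>f\<close> and \<open>g\<close>. After
    cancelling \<open>t - a\<close> the cofactors are coprime, so \<open>f'\<close>, of degree
    \<open>m\<close>, divides \<open>q\<close>, of degree below \<open>m\<close>, and the relation
    is trivial.\<close>
  show ?thesis
  proof (cases "v (2 * m) = 0")
    case False
    then show ?thesis using arg_cong[OF rel, of "\<lambda>p. poly p a"] roots by simp
  next
    case True
    from roots obtain f' g' where eq: "f = [:-a, 1:] * f'" "g = [:-a, 1:] * g'"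
      by (auto simp: poly_eq_0_iff_dvd dvd_def)
    have "f \<noteq> 0" using f n by auto
    then have "f' \<noteq> 0" using eq by auto
    then have "degree f = degree [:-a, 1:] + degree f'" unfolding eq by (intro degree_mult_eq) auto
    then have "degree f' = m" using f m by simp
    obtain r s where "[:-a, 1:] = r * f + s * g"
      using gcd by (auto simp: ring_module.span_insert) (metis diff_add_cancel add.commute mult.commute)
    then have "[:-a, 1:] * 1 = [:-a, 1:] * (r * f' + s * g')" unfolding eq by (simp add: algebra_simps)
    then have rs: "1 = r * f' + s * g'" by (subst (asm) mult_left_cancel) auto
    have "[:-a, 1:] * (p * f' + q * g') = 0" using rel True unfolding eq by (simp add: algebra_simps)
    then have "p * f' + q * g' = 0" by (subst (asm) mult_eq_0_iff) auto
    then have qg: "q * g' = - (p * f')" by (simp add: eq_neg_iff_add_eq_0 add.commute)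
    have "q = q * (r * f' + s * g')" using rs by simp
    also have "\<dots> = q * r * f' + s * (q * g')" by (simp add: algebra_simps)
    also have "\<dots> = (q * r - s * p) * f'" unfolding qg by (simp add: algebra_simps)
    finally have "f' dvd q" by (metis dvd_triv_right)
    moreover have "degree q < degree f'"
      unfolding q_def \<open>degree f' = m\<close> by (intro degree_sum_monom_less m)
    ultimately have "q = 0" using dvd_imp_degree_le by (metis not_le)
    then have "p = 0" using rel True \<open>f \<noteq> 0\<close> by simp
    have "v j = 0" if "j < m" for j
      using arg_cong[OF \<open>p = 0\<close>, of "\<lambda>p. coeff p j"] that by (simp add: p_def coeff_sum)
    moreover have "v (m + j) = 0" if "j < m" for j
      using arg_cong[OF \<open>q = 0\<close>, of "\<lambda>p. coeff p j"] that by (simp add: q_def coeff_sum)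
    ultimately have "v j = 0" if "j < 2 * m + 1" for j
      using that True by (cases "j < m"; cases "j = 2 * m") (auto dest: le_Suc_ex simp: not_less)
    then show ?thesis using v(1) by blast
  qed
qed

section \<open>Reductions generated by two coprime forms\<close>

lemma homogenize_smult: "homogenize d (Polynomial.smult c u) = [:[:c:]:] * homogenize d u"
  by (simp add: homogenize_def sum_distrib_left smult_sum2 smult_monom)

lemma homogenize_eq_sum:
  assumes "degree p < m"
  shows "homogenize d p = (\<Sum>j<m. [:[:coeff p j:]:] * homogenize d (monom 1 j))"
proof -
  have "homogenize d p = homogenize d (\<Sum>j<m. Polynomial.smult (coeff p j) (monom 1 j))"
    using poly_eq_sum_monom[OF assms] by (simp add: smult_monom)
  then show ?thesis by (simp only: homogenize_sum homogenize_smult)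
qed

text \<open>Every polynomial of degree at most \<open>2 * n - 1\<close> is
  \<open>p * f + q * g\<close> with \<open>p\<close> and \<open>q\<close> of degree below
  \<open>n\<close>. Hence elements of \<open>Z\<close> multiply the forms of degree
  \<open>n - 1\<close> into combinations of such forms with coefficients in the ideal of the two
  forms, as the determinant trick requires.\<close>

lemma is_reduction_of_coprime_forms:
  fixes f g :: "'a::field poly"
  assumes n: "n > 0" and f: "degree f = n" and g: "degree g \<le> n" and coprime: "1 \<in> ideal_generated {f, g}"
    and "finite Z" and Z: "\<And>z. z \<in> Z \<Longrightarrow> \<exists>u. degree u \<le> n \<and> z = homogenize n u"
    and FG: "homogenize n f \<in> ideal_generated Z" "homogenize n g \<in> ideal_generated Z"
  shows "is_reduction (ideal_generated {homogenize n f, homogenize n g}) (ideal_generated Z)"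
proof -
  define J where "J = ideal_generated {homogenize n f, homogenize n g}"
  have J: "is_ideal J" "homogenize n f \<in> J" "homogenize n g \<in> J"
    by (auto simp: J_def is_ideal_generated intro: ideal_generated_base)
  let ?S = "{p * f + q * g | p q. degree p < n \<and> degree q < n}"
  have comb: "h \<in> ?S" if "degree h \<le> 2 * n - 1" for h
  proof (rule bounded_combination[OF coprime, of f n "2 * n - 1"])
    show "0 \<in> ?S" using n by (auto intro!: exI[of _ 0])
    show "u + w \<in> ?S" if "u \<in> ?S" "w \<in> ?S" for u w
    proof -
      from that obtain p q p' q' where "u = p * f + q * g" "w = p' * f + q' * g"
        "degree p < n" "degree q < n" "degree p' < n" "degree q' < n" by blast
      then show ?thesis
        by (intro CollectI exI[of _ "p + p'"] exI[of _ "q + q'"]) (auto simp: algebra_simps degree_add_less)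
    qed
    show "degree u \<le> 2 * n - 1" if u: "u \<in> ?S" for u
    proof -
      from u obtain p q where "u = p * f + q * g" "degree p < n" "degree q < n" by blast
      then show ?thesis
        using degree_mult_le[of p f] degree_mult_le[of q g] f g by (auto intro!: degree_add_le)
    qed
    show "c * w \<in> ?S" if w: "w \<in> {f, g}" and c: "degree c \<le> 2 * n - 1 - n" for c w
    proof -
      have "degree c < n" using c n by auto
      from w consider "w = f" | "w = g" by blast
      then show ?thesis
      proof cases
        case 1
        then show ?thesis using \<open>degree c < n\<close> n by (intro CollectI exI[of _ c] exI[of _ 0]) auto
      next
        case 2
        then show ?thesis using \<open>degree c < n\<close> n by (intro CollectI exI[of _ 0] exI[of _ c]) auto
      qed
    qed
  qed (use f n that in auto)
  \<comment> \<open>The monomials of degree \<open>n - 1\<close>, which generate the test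
    module.\<close>
  define w where "w j = homogenize (n - 1) (monom (1 :: 'a) j)" for j
  have "is_reduction J (ideal_generated (J \<union> Z))"
  proof (rule reduction_of_multiplier[OF J(1) \<open>finite Z\<close>, of n w 0])
    fix z i assume z: "z \<in> Z" and i: "i < n"
    from Z[OF z] obtain u where u: "degree u \<le> n" "z = homogenize n u" by blast
    have mi: "degree (monom (1::'a) i) \<le> n - 1" using i by (simp add: degree_monom_eq)
    have "degree (u * monom 1 i) \<le> 2 * n - 1" using degree_mult_le[of u "monom 1 i"] u mi n by linarith
    from comb[OF this] obtain p q where pq: "u * monom 1 i = p * f + q * g" "degree p < n" "degree q < n" by blast
    have pn: "degree p \<le> n - 1" "degree q \<le> n - 1" using pq by auto
    have "z * w i = homogenize (n + (n - 1)) (p * f + q * g)"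
      unfolding w_def u(2) homogenize_mult[OF u(1) mi] pq(1) ..
    also have "\<dots> = homogenize (n - 1) p * homogenize n f + homogenize (n - 1) q * homogenize n g"
      using homogenize_mult[of p "n - 1" f n] homogenize_mult[of q "n - 1" g n] pn f g
      by (simp add: homogenize_add add.commute)
    also have "\<dots> = (\<Sum>j<n. ([:[:coeff p j:]:] * homogenize n f + [:[:coeff q j:]:] * homogenize n g) * w j)"
      unfolding homogenize_eq_sum[OF pq(2)] homogenize_eq_sum[OF pq(3)] sum_distrib_right sum.distrib[symmetric]
        distrib_right w_def by (simp only: mult_ac)
    finally show "\<exists>c. (\<forall>j<n. c j \<in> J) \<and> z * w i = (\<Sum>j<n. c j * w j)"
      using J by (intro exI[of _ "\<lambda>j. [:[:coeff p j:]:] * homogenize n f + [:[:coeff q j:]:] * homogenize n g"] conjI)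
        (auto intro!: ideal_add ideal_mult_left simp del: mult_pCons_left)
  next
    have "coeff (coeff (w 0) 0) (n - 1) = 1" by (simp add: w_def coeff_homogenize)
    then show "w 0 \<noteq> 0" by force
  qed fact
  moreover have "ideal_generated (J \<union> Z) = ideal_generated Z"
  proof
    have "J \<subseteq> ideal_generated Z" unfolding J_def using FG by (intro ideal_generated_mono) auto
    then show "ideal_generated (J \<union> Z) \<subseteq> ideal_generated Z"
      by (intro ideal_generated_mono) (auto intro: ideal_generated_base)
    show "ideal_generated Z \<subseteq> ideal_generated (J \<union> Z)"
      by (intro ideal_generated_mono) (auto intro: ideal_generated_base)
  qed
  ultimately show ?thesis by (simp add: J_def)
qed

section \<open>The core\<close>

lemma core_subset_origin_power:
  fixes I :: "'a::field poly poly set"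
  assumes inf: "infinite (UNIV :: 'a set)" and n: "n > 0"
    and X: "X \<subseteq> {..n}" "0 \<in> X" "n \<in> X" "Gcd X = 1"
    and I: "I = ideal_generated ((\<lambda>i. var_x ^ (n - i) * var_y ^ i) ` X)"
  shows "core I \<subseteq> origin_power (2 * n - 1)"
proof
  fix h assume h: "h \<in> core I"
  have "finite X" using X(1) finite_subset by blast
  define Z where "Z = (\<lambda>i. homogenize n (monom (1 :: 'a) i)) ` X"
  have IZ: "I = ideal_generated Z"
    unfolding I Z_def using X(1) by (intro arg_cong[where f = ideal_generated] image_cong) (auto simp: monomial_eq)
  have Z: "\<exists>u. degree u \<le> n \<and> z = homogenize n u" if "z \<in> Z" for z
    using that X(1) by (force simp: Z_def degree_monom_eq)
  have "finite Z" using \<open>finite X\<close> by (simp add: Z_def)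
  have ideal_I: "is_ideal I" by (simp add: IZ is_ideal_generated)
  have mon: "homogenize n (monom 1 i) \<in> I" if "i \<in> X" for i
    unfolding IZ using that by (intro ideal_generated_base) (simp add: Z_def)
  have "I \<subseteq> origin_power n"
    unfolding IZ using Z by (intro ideal_generated_least is_ideal_origin_power) (auto intro: homogenize_in_origin_power)
  moreover have "h \<in> I"
    using h is_reduction_refl[OF ideal_I] by (auto simp: core_def)
  ultimately have hn: "h \<in> origin_power n" by blast
  show "h \<in> origin_power (2 * n - 1)"
  proof (rule ccontr)
    assume "h \<notin> origin_power (2 * n - 1)"
    then obtain d0 where "d0 < 2 * n - 1" "form d0 h \<noteq> 0" by (auto simp: origin_power_def)
    \<comment> \<open>The lowest part \<open>u\<close> of \<open>h\<close> will turn out to vanish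
      at every nonzero \<open>a\<close>, too many roots for a nonzero polynomial.\<close>
    define d where "d = (LEAST d. form d h \<noteq> 0)"
    define u where "u = form d h"
    have u: "u \<noteq> 0" and "d \<le> d0"
      unfolding u_def d_def using \<open>form d0 h \<noteq> 0\<close>
      by (rule LeastI[of "\<lambda>d. form d h \<noteq> 0"], rule Least_le)
    have "n \<le> d" using hn u by (force simp: u_def origin_power_def not_le[symmetric])
    have d: "n \<le> d" "d \<le> 2 * n - 2" using \<open>n \<le> d\<close> \<open>d \<le> d0\<close> \<open>d0 < 2 * n - 1\<close> by auto
    then have n2: "n \<ge> 2" using n by auto
    have "poly u a = 0" if a: "a \<noteq> 0" for a
    proof -
      define f where "f = monom 1 n - [:a ^ n:]"
      define b where "b i = monom 1 i - [:a ^ i:]" for i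
      \<comment> \<open>The dehomogenized forms of degree \<open>n\<close> in \<open>I\<close> that
        vanish at the point \<open>(1, a)\<close>; all the binomials \<open>b i\<close> are among
        them.\<close>
      define V where "V = {u. degree u \<le> n \<and> homogenize n u \<in> I \<and> poly u a = 0}"
      have f: "degree f = n" "poly f a = 0" "f \<noteq> 0"
      proof -
        have "degree [:a ^ n:] < degree (monom (1::'a) n)" using n by (simp add: degree_monom_eq)
        then show "degree f = n" unfolding f_def diff_conv_add_uminus
          by (subst degree_add_eq_left) (auto simp: degree_monom_eq)
        then show "f \<noteq> 0" using n by auto
      qed (simp add: f_def poly_monom)
      have bV: "b i \<in> V" if "i \<in> X" for i
      proof -
        have "homogenize n (b i) = homogenize n (monom 1 i) - [:[:a ^ i:]:] * homogenize n (monom 1 0)"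
        proof -
          have "monom 1 i = b i + Polynomial.smult (a ^ i) (monom 1 0)" by (simp add: b_def monom_0)
          then have "homogenize n (monom 1 i) = homogenize n (b i) + [:[:a ^ i:]:] * homogenize n (monom 1 0)"
            by (simp only: homogenize_add homogenize_smult)
          then show ?thesis by simp
        qed
        then have "homogenize n (b i) \<in> I"
          using ideal_diff[OF ideal_I mon[OF that] ideal_mult_left[OF ideal_I mon[OF X(2)]]] by (simp only:)
        moreover have "degree (b i) \<le> n"
          unfolding b_def using that X(1) by (intro degree_diff_le) (auto simp: degree_monom_eq)
        ultimately show ?thesis by (simp add: V_def b_def poly_monom)
      qed
      have "\<exists>g\<in>V. b ` X \<subseteq> ideal_generated {f, g}"
      proof (rule ex_generic_combination[OF inf f(3)])
        show "b ` X \<subseteq> V" using bV by blast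
        show "Polynomial.smult c w \<in> V" if "w \<in> V" for c w
          using that ideal_mult_left[OF ideal_I] by (auto simp: V_def homogenize_smult intro: order_trans[OF degree_smult_le] simp del: mult_pCons_left)
        show "w + w' \<in> V" if "w \<in> V" "w' \<in> V" for w w'
          using that ideal_add[OF ideal_I] by (auto simp: V_def homogenize_add intro: degree_add_le)
      qed (use \<open>finite X\<close> ideal_zero[OF ideal_I] in \<open>auto simp: V_def\<close>)
      then obtain g where g: "g \<in> V" "b ` X \<subseteq> ideal_generated {f, g}" by blast
      have gcd: "[:-a, 1:] \<in> ideal_generated {f, g}"
        using g(2) by (intro linear_in_ideal_of_binomials[OF is_ideal_generated a \<open>finite X\<close> X(4)]) (auto simp: b_def)
      have one: "1 \<in> ideal_generated {f, g, 1}" by (rule ideal_generated_base) simp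
      \<comment> \<open>The pencil spanned by \<open>g\<close> and \<open>1\<close>: adding a
        constant to \<open>g\<close> removes the common root \<open>a\<close>.\<close>
      have fin: "finite {e. 1 \<notin> ideal_generated {f, g + [:e:]}}"
        using finite_not_coprime_pencil[OF f(3) one] by (simp add: smult_one)
      show ?thesis
      proof (rule root_of_limit[OF n2 f(1) _ _ f(2) _ gcd])
        show "degree g \<le> n" "poly g a = 0" using g by (auto simp: V_def)
        show "degree u \<le> 2 * n - 2" unfolding u_def using degree_form[of d h] d by linarith
        have "infinite (UNIV - {e. 1 \<notin> ideal_generated {f, g + [:e:]}})" using inf fin by simp
        then show "infinite {e. \<exists>p q. degree p \<le> n - 2 \<and> degree q \<le> n - 2 \<and> u = p * f + q * (g + [:e:])}"
        proof (rule infinite_super[rotated], intro subsetI CollectI)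
          fix e assume "e \<in> UNIV - {e. 1 \<notin> ideal_generated {f, g + [:e:]}}"
          then have e: "1 \<in> ideal_generated {f, g + [:e:]}" by simp
          define F where "F = homogenize n f"
          define G where "G = homogenize n (g + [:e:])"
          have ge: "degree (g + [:e:]) \<le> n" using g n by (auto simp: V_def intro: degree_add_le)
          have "F \<in> I" using bV[OF X(3)] by (simp add: V_def F_def f_def b_def)
          moreover have "G \<in> I"
          proof -
            \<comment> \<open>The constant \<open>1\<close> homogenizes to \<open>var_x ^ n\<close>,
              which is in \<open>I\<close> because \<open>0 \<in> X\<close>; so the perturbation
              stays inside \<open>I\<close>.\<close>
            have "g + [:e:] = g + Polynomial.smult e (monom 1 0)" by (simp add: monom_0)
            then have "G = homogenize n g + [:[:e:]:] * homogenize n (monom 1 0)"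
              unfolding G_def by (simp only: homogenize_add homogenize_smult)
            then show ?thesis
              using g(1) ideal_add[OF ideal_I _ ideal_mult_left[OF ideal_I mon[OF X(2)]]]
              by (simp add: V_def del: mult_pCons_left)
          qed
          ultimately have "is_reduction (ideal_generated {F, G}) I"
            unfolding IZ F_def G_def
            by (intro is_reduction_of_coprime_forms n f ge e \<open>finite Z\<close> Z)
          then have "h \<in> ideal_generated {F, G}" using h by (auto simp: core_def)
          then obtain A B where "h = F * A + G * B"
            by (auto simp: ring_module.span_insert) (metis diff_add_cancel add.commute mult.commute)
          \<comment> \<open>Comparing parts of degree \<open>d\<close>: the cofactors have degree at
            most \<open>d - n \<le> n - 2\<close>.\<close>
          then have "u = f * form (d - n) A + (g + [:e:]) * form (d - n) B"
            using d f(1) ge by (simp add: u_def form_add F_def G_def form_homogenize_mult)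
          then have "u = form (d - n) A * f + form (d - n) B * (g + [:e:])"
            by (simp only: mult.commute)
          moreover have "d - n \<le> n - 2" using d by auto
          ultimately show "\<exists>p q. degree p \<le> n - 2 \<and> degree q \<le> n - 2 \<and> u = p * f + q * (g + [:e:])"
            using degree_form le_trans by blast
        qed
      qed
    qed
    then have "UNIV - {0} \<subseteq> {a. poly u a = 0}" by blast
    then have "finite (UNIV :: 'a set)"
      using poly_roots_finite[OF u] finite_subset by (metis finite_Diff2 finite.emptyI finite.insertI)
    then show False using inf by blast
  qed
qed

lemma core_eq_origin_power:
  fixes I :: "'a::field poly poly set"
  assumes inf: "infinite (UNIV :: 'a set)" and n: "n > 0"
    and X: "X \<subseteq> {..n}" "0 \<in> X" "n \<in> X" "Gcd X = 1"
    and I: "I = ideal_generated ((\<lambda>i. var_x ^ (n - i) * var_y ^ i) ` X)"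
  shows "core I = origin_power (2 * n - 1)"
proof
  have mem: "var_x ^ (n - i) * var_y ^ i \<in> I" if "i \<in> X" for i
    unfolding I using that by (intro ideal_generated_base) blast
  have "I \<subseteq> origin_power n"
    unfolding I by (rule monomial_ideal_subset_origin_power[OF X(1)])
  moreover have "var_x ^ n \<in> I" "var_y ^ n \<in> I" using mem[OF X(2)] mem[OF X(3)] by simp_all
  ultimately show "origin_power (2 * n - 1) \<subseteq> core I"
    unfolding core_def using origin_power_subset_reduction n by blast
qed (rule core_subset_origin_power[OF assms])

section \<open>Derivations and the Jacobian ideal\<close>

lemma is_submodule_hull: "is_submodule scale A (is_submodule scale A hull S)"
  by (rule hull_in) (auto simp: is_submodule_def)

lemma is_subring_hull: "is_subring (is_subring hull S)"
  by (rule hull_in) (auto simp: is_subring_def)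

lemma submodule_sum:
  "is_submodule scale A N \<Longrightarrow> (\<And>i. i \<in> S \<Longrightarrow> f i \<in> N) \<Longrightarrow> sum f S \<in> N"
  by (induction S rule: infinite_finite_induct) (auto simp: is_submodule_def)

lemma submodule_add: "is_submodule scale A N \<Longrightarrow> x \<in> N \<Longrightarrow> y \<in> N \<Longrightarrow> x + y \<in> N"
  and submodule_scale: "is_submodule scale A N \<Longrightarrow> a \<in> A \<Longrightarrow> x \<in> N \<Longrightarrow> scale a x \<in> N"
  and submodule_zero: "is_submodule scale A N \<Longrightarrow> 0 \<in> N"
  by (auto simp: is_submodule_def)

lemma subring_zero: "is_subring A \<Longrightarrow> 0 \<in> A"
  and subring_one: "is_subring A \<Longrightarrow> 1 \<in> A"
  and subring_diff: "is_subring A \<Longrightarrow> a \<in> A \<Longrightarrow> b \<in> A \<Longrightarrow> a - b \<in> A"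
  and subring_mult: "is_subring A \<Longrightarrow> a \<in> A \<Longrightarrow> b \<in> A \<Longrightarrow> a * b \<in> A"
  by (auto simp: is_subring_def)

lemma subring_uminus: "is_subring A \<Longrightarrow> a \<in> A \<Longrightarrow> - a \<in> A"
  using subring_diff[of A 0 a] subring_zero[of A] by simp

lemma subring_add: "is_subring A \<Longrightarrow> a \<in> A \<Longrightarrow> b \<in> A \<Longrightarrow> a + b \<in> A"
  using subring_diff[of A a "- b"] subring_uminus[of A b] by simp

lemma subring_sum: "is_subring A \<Longrightarrow> (\<And>i. i \<in> S \<Longrightarrow> f i \<in> A) \<Longrightarrow> sum f S \<in> A"
  by (induction S rule: infinite_finite_induct) (auto simp: subring_zero subring_add)

lemma subring_prod: "is_subring A \<Longrightarrow> (\<And>i. i \<in> S \<Longrightarrow> f i \<in> A) \<Longrightarrow> prod f S \<in> A"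
  by (induction S rule: infinite_finite_induct) (auto simp: subring_one subring_mult)

lemma subring_power: "is_subring A \<Longrightarrow> a \<in> A \<Longrightarrow> a ^ n \<in> A"
  by (induction n) (auto simp: subring_one subring_mult)

lemma det_in_subring:
  assumes A: "is_subring A" and X: "X \<in> carrier_mat n n"
    and "\<And>i j. i < n \<Longrightarrow> j < n \<Longrightarrow> X $$ (i, j) \<in> A"
  shows "det X \<in> A"
  unfolding det_def'[OF X]
proof (intro subring_sum subring_mult subring_prod A)
  fix p assume p: "p \<in> {p. p permutes {0..<n}}"
  show "signof p \<in> A"
    using subring_one[OF A] subring_uminus[OF A subring_one[OF A]] by (cases "signof p = (1 :: 'a)") (auto simp: sign_def)
  fix i assume "i \<in> {0..<n}"
  then show "X $$ (i, p i) \<in> A"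
    using p assms(3) permutes_in_image[of p "{0..<n}" i] by auto
qed

lemma cofactor_in_subring:
  assumes A: "is_subring A" and X: "X \<in> carrier_mat n n"
    and XA: "\<And>i j. i < n \<Longrightarrow> j < n \<Longrightarrow> X $$ (i, j) \<in> A" and "i < n" "j < n"
  shows "cofactor X i j \<in> A"
proof -
  have "mat_delete X i j \<in> carrier_mat (n - 1) (n - 1)" using X by (rule mat_delete_carrier)
  moreover have "mat_delete X i j $$ (k, l) \<in> A" if "k < n - 1" "l < n - 1" for k l
    using that X by (auto simp: mat_delete_def intro!: XA)
  ultimately have "det (mat_delete X i j) \<in> A" by (rule det_in_subring[OF A])
  moreover have "(- 1) ^ (i + j) \<in> A"
    by (intro subring_power A subring_uminus subring_one)
  ultimately show ?thesis unfolding cofactor_def by (intro subring_mult A)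
qed

lemma lookup_formal_scale [simp]: "Poly_Mapping.lookup (formal_scale c f) a = c * Poly_Mapping.lookup f a"
  by (simp add: formal_scale_def Poly_Mapping.map.rep_eq when_def)

lemma lookup_formal_d: "Poly_Mapping.lookup (formal_d a) b = (if a = b then 1 else 0)"
  by (simp add: formal_d_def lookup_single when_def)

lemma formal_scale_diff: "formal_scale c (f - g) = formal_scale c f - formal_scale c g"
  and formal_scale_add_left: "formal_scale (c + d) f = formal_scale c f + formal_scale d f"
  and formal_scale_mult: "formal_scale c (formal_scale d f) = formal_scale (c * d) f"
  and formal_scale_one: "formal_scale 1 f = f"
  and formal_scale_zero_left: "formal_scale 0 f = 0"
  by (rule poly_mapping_eqI; simp add: lookup_add lookup_minus algebra_simps)+

lemma formal_scale_sum_left: "formal_scale (sum c S) f = (\<Sum>i\<in>S. formal_scale (c i) f)"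
  by (induction S rule: infinite_finite_induct) (simp_all add: formal_scale_zero_left formal_scale_add_left)

section \<open>Evaluating differentials by a derivation\<close>

definition eval_derivation :: "('q::comm_ring_1 \<Rightarrow> 'q) \<Rightarrow> ('q \<Rightarrow>\<^sub>0 'q) \<Rightarrow> 'q" where
  "eval_derivation D f = (\<Sum>a\<in>Poly_Mapping.keys f. Poly_Mapping.lookup f a * D a)"

lemma eval_derivation_superset:
  "finite S \<Longrightarrow> Poly_Mapping.keys f \<subseteq> S \<Longrightarrow> eval_derivation D f = (\<Sum>a\<in>S. Poly_Mapping.lookup f a * D a)"
  unfolding eval_derivation_def by (intro sum.mono_neutral_left) (auto simp: in_keys_iff)

lemma eval_derivation_add: "eval_derivation D (f + g) = eval_derivation D f + eval_derivation D g"
proof -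
  let ?S = "Poly_Mapping.keys f \<union> Poly_Mapping.keys g"
  have "Poly_Mapping.keys (f + g) \<subseteq> ?S" by (rule Poly_Mapping.keys_add)
  then show ?thesis
    by (simp add: eval_derivation_superset[of ?S] lookup_add distrib_right sum.distrib)
qed

lemma eval_derivation_scale: "eval_derivation D (formal_scale c f) = c * eval_derivation D f"
proof -
  have "Poly_Mapping.keys (formal_scale c f) \<subseteq> Poly_Mapping.keys f" by (auto simp: in_keys_iff)
  then show ?thesis
    by (simp add: eval_derivation_superset[of "Poly_Mapping.keys f"] sum_distrib_left mult.assoc)
qed

lemma eval_derivation_0: "eval_derivation D 0 = 0"
  by (simp add: eval_derivation_def)

lemma eval_derivation_diff: "eval_derivation D (f - g) = eval_derivation D f - eval_derivation D g"
  using eval_derivation_add[of D "f - g" g] by simp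

lemma eval_derivation_sum: "eval_derivation D (sum f S) = (\<Sum>i\<in>S. eval_derivation D (f i))"
  by (induction S rule: infinite_finite_induct) (simp_all add: eval_derivation_0 eval_derivation_add)

lemma eval_derivation_formal_d: "eval_derivation D (formal_d a) = D a"
  by (subst eval_derivation_superset[of "{a}"]) (auto simp: formal_d_def)

definition is_derivation :: "('r::comm_ring_1 \<Rightarrow> 'r) \<Rightarrow> bool" where
  "is_derivation D \<longleftrightarrow> (\<forall>a b. D (a + b) = D a + D b \<and> D (a * b) = a * D b + b * D a)"

text \<open>Additivity and Leibniz relations are sent to \<open>0\<close>, and \<open>d r\<close> to
  \<open>D r \<in> A\<close>. Evaluation therefore descends to the differentials, with values in
  \<open>Q / A\<close>.\<close>

lemma eval_derivation_kaehler_relations: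
  assumes A: "is_subring A" and D: "is_derivation D" "D ` A0 \<subseteq> A" and f: "f \<in> kaehler_relations A0 A"
  shows "eval_derivation D f \<in> A"
proof -
  have "kaehler_relations A0 A \<subseteq> {f. eval_derivation D f \<in> A}"
    unfolding kaehler_relations_def
  proof (rule hull_minimal)
    show "is_submodule formal_scale A {f. eval_derivation D f \<in> A}"
      by (auto simp: is_submodule_def eval_derivation_0 eval_derivation_add eval_derivation_scale
          subring_zero[OF A] subring_add[OF A] subring_mult[OF A])
  qed (use D in \<open>auto simp: is_derivation_def eval_derivation_diff eval_derivation_formal_d
      eval_derivation_scale subring_zero[OF A]\<close>)
  then show ?thesis using f by blast
qed

text \<open>A derivation that maps \<open>A0\<close> to \<open>A\<close> induces an \<open>A\<close>-linear map from the differentials of \<open>A\<close> over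
  \<open>A0\<close> to \<open>Q / A\<close>, whose values are annihilated by the Fitting ideal (Cramer's rule).\<close>

lemma jacobian_ideal_mult_derivation:
  fixes A :: "'q::field set"
  assumes A: "is_subring A" and D: "is_derivation D" "D ` A0 \<subseteq> A" and w: "w \<in> A"
    and c: "c \<in> jacobian_ideal A0 A"
  shows "c * D w \<in> A"
proof -
  note rel = eval_derivation_kaehler_relations[OF A D]
  have "jacobian_ideal A0 A \<subseteq> {c. c * D w \<in> A}"
    unfolding jacobian_ideal_def fitting_ideal0_def
  proof (rule hull_minimal)
    show "is_submodule (*) A {c. c * D w \<in> A}"
      by (auto simp: is_submodule_def subring_zero[OF A] distrib_right mult.assoc intro: subring_add[OF A] subring_mult[OF A])
    show "{det X | X n w. generates_quotient formal_scale A (formal_differentials A) (kaehler_relations A0 A) n w \<and>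
        X \<in> carrier_mat n n \<and> (\<forall>i<n. \<forall>j<n. X $$ (i, j) \<in> A) \<and>
        (\<forall>i<n. (\<Sum>j<n. formal_scale (X $$ (i, j)) (w j)) \<in> kaehler_relations A0 A)} \<subseteq> {c. c * D w \<in> A}"
    proof safe
      fix X :: "'q mat" and n and u :: "nat \<Rightarrow> 'q \<Rightarrow>\<^sub>0 'q"
      assume gen: "generates_quotient formal_scale A (formal_differentials A) (kaehler_relations A0 A) n u"
        and X: "X \<in> carrier_mat n n" and XA: "\<forall>i<n. \<forall>j<n. X $$ (i, j) \<in> A"
        and N: "\<forall>i<n. (\<Sum>j<n. formal_scale (X $$ (i, j)) (u j)) \<in> kaehler_relations A0 A"
      define e where "e j = eval_derivation D (u j)" for j
      have Xe: "(\<Sum>j<n. X $$ (i, j) * e j) \<in> A" if "i < n" for i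
        using rel[of "\<Sum>j<n. formal_scale (X $$ (i, j)) (u j)"] N that
        by (simp add: eval_derivation_sum eval_derivation_scale e_def)
      \<comment> \<open>The vector \<open>X e\<close> has entries in \<open>A\<close>; multiplying
        it by the adjugate, also with entries in \<open>A\<close>, gives
        \<open>det X * e\<close>.\<close>
      have de: "det X * e i \<in> A" if i: "i < n" for i
      proof -
        have adj: "adj_mat X \<in> carrier_mat n n" "adj_mat X * X = det X \<cdot>\<^sub>m 1\<^sub>m n"
          using adj_mat[OF X] by auto
        have adjA: "adj_mat X $$ (i, k) \<in> A" if "k < n" for k
          using X i that cofactor_in_subring[OF A X] XA by (simp add: adj_mat_def)
        have "(\<Sum>k<n. adj_mat X $$ (i, k) * (\<Sum>j<n. X $$ (k, j) * e j))
            = (\<Sum>j<n. (\<Sum>k<n. adj_mat X $$ (i, k) * X $$ (k, j)) * e j)"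
          unfolding sum_distrib_left sum_distrib_right by (subst sum.swap) (simp add: mult.assoc)
        also have "\<dots> = (\<Sum>j<n. (adj_mat X * X) $$ (i, j) * e j)"
          using i X adj(1) by (intro sum.cong refl) (simp add: scalar_prod_def atLeast0LessThan)
        also have "\<dots> = (\<Sum>j<n. if i = j then det X * e j else 0)"
          unfolding adj(2) using i by (intro sum.cong refl) auto
        also have "\<dots> = det X * e i" using i by simp
        finally show ?thesis
          by (metis (no_types, lifting) A Xe adjA lessThan_iff subring_mult subring_sum)
      qed
      have "formal_d w \<in> formal_differentials A"
        using w by (auto simp: formal_differentials_def formal_d_def lookup_single when_def subring_zero[OF A] subring_one[OF A] split: if_splits)
      with gen obtain c where c: "\<forall>j<n. c j \<in> A" "formal_d w - (\<Sum>j<n. formal_scale (c j) (u j)) \<in> kaehler_relations A0 A"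
        unfolding generates_quotient_def by blast
      define r where "r = D w - (\<Sum>j<n. c j * e j)"
      have "r \<in> A"
        using rel[OF c(2)] by (simp add: eval_derivation_diff eval_derivation_sum eval_derivation_scale eval_derivation_formal_d e_def r_def)
      have "det X * D w = det X * r + (\<Sum>j<n. c j * (det X * e j))"
        by (simp add: r_def right_diff_distrib sum_distrib_left mult.left_commute)
      moreover have "det X \<in> A" using XA by (intro det_in_subring[OF A X]) auto
      moreover have "(\<Sum>j<n. c j * (det X * e j)) \<in> A"
        using c(1) de by (intro subring_sum[OF A]) (simp add: subring_mult[OF A])
      ultimately show "det X * D w \<in> A"
        using subring_add[OF A subring_mult[OF A _ \<open>r \<in> A\<close>]] by simp
    qed
  qed
  then show ?thesis using c by blast
qed

text \<open>By \<open>gen\<close> the differentials form a cyclic module on \<open>d w\<close>. An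
  annihilator of the generator is a relation matrix of size one, equal to its own
  determinant.\<close>

lemma annihilator_in_jacobian_ideal:
  fixes A :: "'q::field set"
  assumes A: "is_subring A" and w: "w \<in> A"
    and gen: "\<And>a. a \<in> A \<Longrightarrow> \<exists>e\<in>A. formal_d a - formal_scale e (formal_d w) \<in> kaehler_relations A0 A"
    and c: "c \<in> A" "formal_scale c (formal_d w) \<in> kaehler_relations A0 A"
  shows "c \<in> jacobian_ideal A0 A"
proof -
  let ?N = "kaehler_relations A0 A"
  have N: "is_submodule formal_scale A ?N" unfolding kaehler_relations_def by (rule is_submodule_hull)
  obtain e where e: "\<And>a. a \<in> A \<Longrightarrow> e a \<in> A" "\<And>a. a \<in> A \<Longrightarrow> formal_d a - formal_scale (e a) (formal_d w) \<in> ?N"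
    using gen by metis
  have "formal_d w \<in> formal_differentials A"
    using w by (auto simp: formal_differentials_def formal_d_def lookup_single when_def subring_zero[OF A] subring_one[OF A] split: if_splits)
  moreover have "\<exists>c. (\<forall>j<Suc 0. c j \<in> A) \<and> m - (\<Sum>j<Suc 0. formal_scale (c j) (formal_d w)) \<in> ?N"
    if m: "m \<in> formal_differentials A" for m
  proof -
    let ?K = "Poly_Mapping.keys m" and ?l = "Poly_Mapping.lookup m"
    have mA: "?K \<subseteq> A" "\<And>a. ?l a \<in> A" using m by (auto simp: formal_differentials_def)
    have "m = (\<Sum>a\<in>?K. formal_scale (?l a) (formal_d a))"
    proof (rule poly_mapping_eqI)
      fix b
      have "Poly_Mapping.lookup (\<Sum>a\<in>?K. formal_scale (?l a) (formal_d a)) b = (\<Sum>a\<in>?K. if a = b then ?l a else 0)"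
        by (simp only: lookup_sum lookup_formal_scale lookup_formal_d) (intro sum.cong, auto)
      then show "?l b = Poly_Mapping.lookup (\<Sum>a\<in>?K. formal_scale (?l a) (formal_d a)) b"
        by (simp add: in_keys_iff)
    qed
    then have "m - formal_scale (\<Sum>a\<in>?K. ?l a * e a) (formal_d w)
        = (\<Sum>a\<in>?K. formal_scale (?l a) (formal_d a - formal_scale (e a) (formal_d w)))"
      by (simp add: formal_scale_sum_left formal_scale_diff formal_scale_mult sum_subtractf)
    also have "\<dots> \<in> ?N"
      using mA e(2) by (intro submodule_sum[OF N] submodule_scale[OF N]) auto
    finally show ?thesis
      using mA e(1) by (intro exI[of _ "\<lambda>_. \<Sum>a\<in>?K. ?l a * e a"])
        (auto simp del: sum_constant intro!: subring_sum[OF A] subring_mult[OF A])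
  qed
  ultimately have "generates_quotient formal_scale A (formal_differentials A) ?N (Suc 0) (\<lambda>_. formal_d w)"
    by (simp add: generates_quotient_def del: sum_constant)
  moreover have "c = det (mat 1 1 (\<lambda>_. c))" by (simp add: det_single)
  ultimately show ?thesis
    unfolding jacobian_ideal_def fitting_ideal0_def using c
    by (intro hull_inc CollectI exI[of _ "mat 1 1 (\<lambda>_. c)"] exI[of _ "Suc 0"] exI[of _ "\<lambda>_. formal_d w"]) auto
qed

section \<open>Lower bound for the adjoint\<close>

text \<open>With primes read as derivatives, this is additivity of the quotient rule;
  \<open>quotient_rule_mult\<close> is its Leibniz rule.\<close>

lemma quotient_rule_add:
  fixes a b c d a' b' c' d' :: "'q::field"
  assumes "b \<noteq> 0" "d \<noteq> 0"
  shows "((a * d' + d * a' + (c * b' + b * c')) * (b * d) - (a * d + c * b) * (b * d' + d * b')) / (b * d)\<^sup>2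
    = (a' * b - a * b') / b\<^sup>2 + (c' * d - c * d') / d\<^sup>2"
proof -
  have "(a * d' + d * a' + (c * b' + b * c')) * (b * d) - (a * d + c * b) * (b * d' + d * b')
      = (a' * b - a * b') * d\<^sup>2 + (c' * d - c * d') * b\<^sup>2"
    by (simp add: algebra_simps power2_eq_square)
  then show ?thesis using assms by (simp add: add_frac_eq power_mult_distrib)
qed

lemma quotient_rule_mult:
  fixes a b c d a' b' c' d' :: "'q::field"
  assumes "b \<noteq> 0" "d \<noteq> 0"
  shows "((a * c' + c * a') * (b * d) - (a * c) * (b * d' + d * b')) / (b * d)\<^sup>2
    = a / b * ((c' * d - c * d') / d\<^sup>2) + c / d * ((a' * b - a * b') / b\<^sup>2)"
proof -
  have "a / b * ((c' * d - c * d') / d\<^sup>2) = (a * b * (c' * d - c * d')) / (b * d)\<^sup>2"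
    and "c / d * ((a' * b - a * b') / b\<^sup>2) = (c * d * (a' * b - a * b')) / (b * d)\<^sup>2"
    using assms by (simp_all add: power2_eq_square)
  moreover have "(a * c' + c * a') * (b * d) - (a * c) * (b * d' + d * b')
      = a * b * (c' * d - c * d') + c * d * (a' * b - a * b')"
    by (simp add: algebra_simps)
  ultimately show ?thesis by (simp only: add_divide_distrib)
qed

text \<open>The extension is given by the quotient rule on a chosen representation;
  \<open>unique\<close> shows independence of the choice.\<close>

lemma derivation_fract:
  fixes \<delta> :: "'r::idom \<Rightarrow> 'r"
  assumes \<delta>: "is_derivation \<delta>"
  obtains D where "is_derivation D" and "\<And>r. D (to_fract r) = to_fract (\<delta> r)"
proof -
  have add: "\<delta> (a + b) = \<delta> a + \<delta> b" and mult: "\<delta> (a * b) = a * \<delta> b + b * \<delta> a" for a b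
    using \<delta> by (auto simp: is_derivation_def)
  define q where "q a b = (to_fract (\<delta> a) * to_fract b - to_fract a * to_fract (\<delta> b)) / (to_fract b)\<^sup>2" for a b
  define D where "D r = (SOME d. \<exists>a b. b \<noteq> 0 \<and> r = to_fract a / to_fract b \<and> d = q a b)" for r
  have unique: "q a b = q a' b'" if "b \<noteq> 0" "b' \<noteq> 0" "to_fract a / to_fract b = to_fract a' / to_fract b'" for a b a' b'
  proof -
    have ab: "a * b' = a' * b"
      using that by (simp add: frac_eq_eq flip: to_fract_mult)
    \<comment> \<open>The discrepancy is a combination of \<open>a * b' - a' * b\<close>, which is
      zero, and the difference of the derivatives of its two terms.\<close>
    have "b'\<^sup>2 * (\<delta> a * b - a * \<delta> b) - b\<^sup>2 * (\<delta> a' * b' - a' * \<delta> b')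
        = b * b' * (\<delta> (a * b') - \<delta> (a' * b)) - b' * \<delta> b * (a * b' - a' * b) - b * \<delta> b' * (a * b' - a' * b)"
      unfolding mult by (simp add: algebra_simps power2_eq_square)
    then have "b'\<^sup>2 * (\<delta> a * b - a * \<delta> b) = b\<^sup>2 * (\<delta> a' * b' - a' * \<delta> b')" using ab by simp
    then have "(to_fract b')\<^sup>2 * (to_fract (\<delta> a) * to_fract b - to_fract a * to_fract (\<delta> b))
        = (to_fract b)\<^sup>2 * (to_fract (\<delta> a') * to_fract b' - to_fract a' * to_fract (\<delta> b'))"
      by (simp flip: to_fract_mult to_fract_diff to_fract_hom.hom_power)
    then show ?thesis using that(1,2) by (simp add: q_def frac_eq_eq mult.commute)
  qed
  have D: "D (to_fract a / to_fract b) = q a b" if b: "b \<noteq> 0" for a b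
    unfolding D_def
  proof (rule some_equality)
    fix d assume "\<exists>a' b'. b' \<noteq> 0 \<and> to_fract a / to_fract b = to_fract a' / to_fract b' \<and> d = q a' b'"
    then obtain a' b' where "b' \<noteq> 0" "to_fract a / to_fract b = to_fract a' / to_fract b'" "d = q a' b'" by blast
    then show "d = q a b" using unique[OF b, of b' a a'] by simp
  qed (use b in blast)
  have rep: "\<exists>a b. b \<noteq> 0 \<and> r = to_fract a / to_fract b" for r :: "'r fract"
    by (cases r) (auto simp: Fract_conv_to_fract)
  have "is_derivation D"
    unfolding is_derivation_def
  proof (intro allI conjI)
    fix r s :: "'r fract"
    obtain a b where r: "b \<noteq> 0" "r = to_fract a / to_fract b" using rep by blast
    obtain c d where s: "d \<noteq> 0" "s = to_fract c / to_fract d" using rep by blast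
    note rs = r s
    have "r + s = to_fract (a * d + c * b) / to_fract (b * d)" using rs by (simp add: add_frac_eq)
    then have 1: "D (r + s) = q (a * d + c * b) (b * d)" using D[of "b * d" "a * d + c * b"] rs by simp
    have "r * s = to_fract (a * c) / to_fract (b * d)" using rs by simp
    then have 2: "D (r * s) = q (a * c) (b * d)" using D[of "b * d" "a * c"] rs by simp
    have nz: "to_fract b \<noteq> 0" "to_fract d \<noteq> 0" using rs by auto
    show "D (r + s) = D r + D s"
      unfolding 1 unfolding rs(2,4) D[OF rs(1)] D[OF rs(3)] q_def add mult to_fract_add to_fract_mult
      by (rule quotient_rule_add[OF nz])
    show "D (r * s) = r * D s + s * D r"
      unfolding 2 unfolding rs(2,4) D[OF rs(1)] D[OF rs(3)] q_def add mult to_fract_add to_fract_mult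
      by (rule quotient_rule_mult[OF nz])
  qed
  moreover have "\<delta> 1 = 0" using mult[of 1 1] by (simp only: mult_1) (metis add_cancel_left_right)
  then have "D (to_fract r) = to_fract (\<delta> r)" for r
    using D[of 1 r] by (simp add: q_def)
  ultimately show ?thesis using that by blast
qed

lemma is_derivation_pderiv: "is_derivation (pderiv :: 'a::idom poly \<Rightarrow> 'a poly)"
  by (simp add: is_derivation_def pderiv_add pderiv_mult)

text \<open>For \<open>D = pderiv\<close> this is the partial derivative by \<open>x\<close> on
  \<open>k[x][y]\<close>, while \<open>pderiv\<close> itself is the one by \<open>y\<close>.\<close>

lemma is_derivation_map_poly:
  assumes "is_derivation D"
  shows "is_derivation (map_poly D)"
proof -
  have add: "D (a + b) = D a + D b" and mult: "D (a * b) = a * D b + b * D a" for a b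
    using assms by (auto simp: is_derivation_def)
  have 0: "D 0 = 0" using add[of 0 0] by simp
  have sum: "D (sum f S) = (\<Sum>i\<in>S. D (f i))" for f :: "nat \<Rightarrow> 'a" and S
    by (induction S rule: infinite_finite_induct) (simp_all add: 0 add)
  have "map_poly D (p * q) = p * map_poly D q + q * map_poly D p" for p q
  proof (rule poly_eqI)
    fix n
    have "coeff (map_poly D (p * q)) n = (\<Sum>i\<le>n. coeff p i * D (coeff q (n - i))) + (\<Sum>i\<le>n. D (coeff p i) * coeff q (n - i))"
      by (simp add: coeff_map_poly 0 coeff_mult sum mult sum.distrib mult.commute[of "D _"])
    then show "coeff (map_poly D (p * q)) n = coeff (p * map_poly D q + q * map_poly D p) n"
      by (simp add: coeff_map_poly 0 coeff_mult mult.commute[of q])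
  qed
  moreover have "map_poly D (p + q) = map_poly D p + map_poly D q" for p q
    by (rule poly_eqI) (simp add: coeff_map_poly 0 add)
  ultimately show ?thesis by (simp add: is_derivation_def)
qed

lemma derivation_quotient:
  fixes x y :: "'q::field"
  assumes D: "is_derivation D" and "D x = 0" "D y = 1" and "x \<noteq> 0"
  shows "D (y / x) = 1 / x"
proof -
  have "D (x * (y / x)) = x * D (y / x) + (y / x) * D x"
    using D by (simp only: is_derivation_def)
  then show ?thesis using assms by (simp add: field_simps)
qed

section \<open>Elementary properties of discrete valuations\<close>

context
  fixes v :: "'q::field \<Rightarrow> ereal"
  assumes v: "discrete_valuation v"
begin

lemma valuation_mult: "v (x * y) = v x + v y"
  and valuation_add: "min (v x) (v y) \<le> v (x + y)"
  and valuation_zero: "v 0 = \<infinity>"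
  using v by (auto simp: discrete_valuation_def)

lemma valuation_int: "x \<noteq> 0 \<Longrightarrow> \<exists>m::int. v x = ereal (of_int m)"
  using v by (auto simp: discrete_valuation_def)

lemma valuation_one: "v 1 = 0"
  using valuation_mult[of 1 1] valuation_int[of 1] by auto

lemma valuation_uminus: "v (- x) = v x"
proof -
  have "v (-1) = 0" using valuation_mult[of "-1" "-1"] valuation_int[of "-1"] valuation_one by (auto simp: zero_ereal_def)
  then show ?thesis using valuation_mult[of "-1" x] by simp
qed

lemma valuation_divide_nonneg:
  assumes "y \<noteq> 0" and "v y \<le> v x"
  shows "0 \<le> v (x / y)"
proof (cases "x = 0")
  case False
  have "v x = v (x / y) + v y" using valuation_mult[of "x / y" y] assms by simp
  moreover obtain a b where "v (x / y) = ereal a" "v y = ereal b"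
    using valuation_int[of "x / y"] valuation_int[of y] False assms(1) by auto
  ultimately show ?thesis using assms(2) by simp
qed (simp add: valuation_zero)

lemma valuation_power: "v x = ereal a \<Longrightarrow> v (x ^ i) = ereal (real i * a)"
  by (induction i) (auto simp: valuation_one valuation_mult algebra_simps)

lemma is_subring_valuation_ring: "is_subring (valuation_ring v)"
  unfolding is_subring_def valuation_ring_def mem_Collect_eq
proof (intro conjI ballI)
  fix a b assume "a \<in> {x. 0 \<le> v x}" "b \<in> {x. 0 \<le> v x}"
  then show "0 \<le> v (a - b)" "0 \<le> v (a * b)"
    using valuation_add[of a "- b"] valuation_uminus[of b] by (auto simp: valuation_mult min_def split: if_splits)
qed (simp_all add: valuation_zero valuation_one)

end

section \<open>Values of the Jacobian ideal and of powers of (x, y)\<close>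

text \<open>The quotient \<open>y / x\<close> lies in the valuation ring and the extended derivation
  sends it to \<open>1 / x\<close>; therefore \<open>c / x\<close> lies there too.\<close>

lemma jacobian_ideal_value_ge:
  fixes v :: "'r::idom fract \<Rightarrow> ereal"
  assumes v: "discrete_valuation v" and R: "\<And>r. 0 \<le> v (to_fract r)" and \<delta>: "is_derivation \<delta>"
    and xy: "\<delta> x = 0" "\<delta> y = 1" "x \<noteq> 0" and le: "v (to_fract x) \<le> v (to_fract y)"
    and c: "c \<in> jacobian_ideal (range to_fract) (valuation_ring v)"
  shows "v (to_fract x) \<le> v c"
proof -
  obtain D where D: "is_derivation D" "\<And>r. D (to_fract r) = to_fract (\<delta> r)"
    using derivation_fract[OF \<delta>] by blast
  have nz: "to_fract x \<noteq> 0" using xy by simp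
  have "to_fract y / to_fract x \<in> valuation_ring v"
    using valuation_divide_nonneg[OF v nz le] by (simp add: valuation_ring_def)
  moreover have "D ` range to_fract \<subseteq> valuation_ring v" using R by (auto simp: D valuation_ring_def)
  ultimately have "c * D (to_fract y / to_fract x) \<in> valuation_ring v"
    using c by (intro jacobian_ideal_mult_derivation[OF is_subring_valuation_ring[OF v] D(1)])
  then have "0 \<le> v (c / to_fract x)"
    using derivation_quotient[OF D(1), of "to_fract x" "to_fract y"] xy nz by (simp add: D(2) valuation_ring_def)
  then have "v (to_fract x) + 0 \<le> v (to_fract x) + v (c / to_fract x)" by (rule add_left_mono)
  then show ?thesis using valuation_mult[OF v, of "to_fract x" "c / to_fract x"] nz by simp
qed

text \<open>Elements of value at least \<open>d * e\<close> form an ideal because \<open>v\<close>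
  is nonnegative on the ring, and it contains all monomials of degree at least
  \<open>d\<close>.\<close>

lemma origin_power_value_ge:
  fixes v :: "'a::field poly poly fract \<Rightarrow> ereal"
  assumes v: "discrete_valuation v"
    and a: "v (to_fract var_x) = ereal a" "e \<le> a" and b: "v (to_fract var_y) = ereal b" "e \<le> b" and e: "0 \<le> e"
    and R: "\<And>r. 0 \<le> v (to_fract r)" and f: "f \<in> origin_power d"
  shows "ereal (real d * e) \<le> v (to_fract f)"
proof -
  let ?L = "{p. ereal (real d * e) \<le> v (to_fract p)}"
  have "f \<in> ?L"
  proof (rule in_ideal_of_monomials)
    show "is_ideal ?L"
    proof (rule is_idealI)
      fix p q :: "'a poly poly" assume "p \<in> ?L" "q \<in> ?L"
      then show "p + q \<in> ?L"
        using valuation_add[OF v, of "to_fract p" "to_fract q"] by (auto simp: min_def split: if_splits)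
    next
      fix r p :: "'a poly poly" assume "p \<in> ?L"
      then show "r * p \<in> ?L"
        using add_mono[OF R[of r], of "ereal (real d * e)" "v (to_fract p)"] by (simp add: valuation_mult[OF v])
    qed (simp add: valuation_zero[OF v])
  next
    fix i j assume c: "coeff (coeff f j) i \<noteq> 0"
    have "d \<le> i + j" using le_add_of_coeff_nonzero[OF f c] .
    then have "real d * e \<le> real (i + j) * e" using e by (intro mult_right_mono) auto
    also have "\<dots> \<le> real i * a + real j * b"
      using a(2) b(2) by (simp add: distrib_right add_mono mult_left_mono)
    also have "ereal \<dots> = v (to_fract (var_x ^ i * var_y ^ j))"
      using valuation_power[OF v a(1)] valuation_power[OF v b(1)]
      by (simp add: valuation_mult[OF v] to_fract_hom.hom_power)
    finally show "var_x ^ i * var_y ^ j \<in> ?L" by simp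
  qed
  then show ?thesis by simp
qed

text \<open>Let \<open>e\<close> be the smaller value of the two variables. Then \<open>L\<close>
  has value at most \<open>m * e\<close>, the Jacobian ideal at least \<open>e\<close>, and elements
  of \<open>origin_power (m - 1)\<close> at least \<open>(m - 1) * e\<close>.\<close>

lemma origin_power_subset_adjoint:
  fixes L :: "'a::field poly poly set"
  assumes L: "var_x ^ m \<in> L" "var_y ^ m \<in> L" and m: "m > 0"
  shows "to_fract ` origin_power (m - 1) \<subseteq> adjoint L"
  unfolding adjoint_def
proof (intro INT_greatest image_subsetI CollectI)
  fix v :: "'a poly poly fract \<Rightarrow> ereal" and f :: "'a poly poly"
  assume "v \<in> {v. divisorial_valuation v}" and f: "f \<in> origin_power (m - 1)"
  then have v: "discrete_valuation v" and R: "\<And>r. 0 \<le> v (to_fract r)"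
    by (auto simp: divisorial_valuation_def)
  have nz: "to_fract (var_x :: 'a poly poly) \<noteq> 0" "to_fract (var_y :: 'a poly poly) \<noteq> 0"
    by (auto simp: var_x_def var_y_def)
  obtain a b where a: "v (to_fract var_x) = ereal a" and b: "v (to_fract var_y) = ereal b"
    using valuation_int[OF v nz(1)] valuation_int[OF v nz(2)] by blast
  define e where "e = min a b"
  have e: "0 \<le> e" "e \<le> a" "e \<le> b" using R[of var_x] R[of var_y] a b by (auto simp: e_def)
  let ?J = "jacobian_ideal (range to_fract) (valuation_ring v)"
  have "ereal e \<le> v c" if c: "c \<in> ?J" for c
  \<comment> \<open>The derivative is taken by the variable of larger value, so that its quotient by
    the other variable is integral.\<close>
  proof (cases "a \<le> b")
    case True
    have "v (to_fract var_x) \<le> v c"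
      using True a b by (intro jacobian_ideal_value_ge[OF v R is_derivation_pderiv _ _ _ _ c, of _ var_y])
        (auto simp: var_x_def var_y_def pderiv_pCons)
    then show ?thesis using True a by (simp add: e_def)
  next
    case False
    have "map_poly pderiv (1 :: 'a poly poly) = 0" by (rule poly_eqI) (simp add: coeff_map_poly)
    then have "v (to_fract var_y) \<le> v c"
      using False a b
      by (intro jacobian_ideal_value_ge[OF v R is_derivation_map_poly[OF is_derivation_pderiv] _ _ _ _ c, of _ var_x])
        (auto simp: var_x_def var_y_def pderiv_pCons map_poly_pCons)
    then show ?thesis using False b by (simp add: e_def)
  qed
  then have J: "ereal e \<le> value_of_set v ?J"
    unfolding value_of_set_def by (intro INF_greatest)
  have "value_of_set v (to_fract ` L) \<le> v (to_fract (var_x ^ m))" "value_of_set v (to_fract ` L) \<le> v (to_fract (var_y ^ m))"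
    unfolding value_of_set_def using L by (auto intro!: INF_lower)
  then have "value_of_set v (to_fract ` L) \<le> ereal (real m * e)"
    using valuation_power[OF v a, of m] valuation_power[OF v b, of m]
    by (cases "a \<le> b") (auto simp: e_def to_fract_hom.hom_power)
  then have "value_of_set v (to_fract ` L) - value_of_set v ?J \<le> ereal (real m * e) - ereal e"
    using J by (intro ereal_minus_mono)
  also have "\<dots> = ereal (real (m - 1) * e)" using m by (simp add: of_nat_diff algebra_simps)
  also have "\<dots> \<le> v (to_fract f)"
    using origin_power_value_ge[OF v a e(2) b e(3) e(1) R f] .
  finally show "value_of_set v (to_fract ` L) - value_of_set v ?J \<le> v (to_fract f)" .
qed

section \<open>Construction of divisorial valuations\<close>

text \<open>Multiplicativity makes \<open>\<nu> a - \<nu> b\<close> independent of the fraction, and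
  \<open>p\<close> provides the value \<open>1\<close>. The conditions avoid \<open>0\<close>
  because a natural-valued \<open>\<nu>\<close> cannot be infinite there.\<close>

lemma extend_valuation:
  fixes \<nu> :: "'r::idom \<Rightarrow> nat"
  assumes mult: "\<And>a b. a \<noteq> 0 \<Longrightarrow> b \<noteq> 0 \<Longrightarrow> \<nu> (a * b) = \<nu> a + \<nu> b"
    and add: "\<And>a b. a \<noteq> 0 \<Longrightarrow> b \<noteq> 0 \<Longrightarrow> a + b \<noteq> 0 \<Longrightarrow> min (\<nu> a) (\<nu> b) \<le> \<nu> (a + b)"
    and one: "p \<noteq> 0" "\<nu> p = 1"
  obtains v where "discrete_valuation v" and "\<And>a. a \<noteq> 0 \<Longrightarrow> v (to_fract a) = ereal (real (\<nu> a))"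
proof -
  define v where "v r = (if r = 0 then \<infinity> else
      ereal (SOME m. \<exists>a b. a \<noteq> 0 \<and> b \<noteq> 0 \<and> r = to_fract a / to_fract b \<and> m = real (\<nu> a) - real (\<nu> b)))" for r
  have v: "v (to_fract a / to_fract b) = ereal (real (\<nu> a) - real (\<nu> b))" if ab: "a \<noteq> 0" "b \<noteq> 0" for a b
  proof -
    have "(SOME m. \<exists>a' b'. a' \<noteq> 0 \<and> b' \<noteq> 0 \<and> to_fract a / to_fract b = to_fract a' / to_fract b' \<and> m = real (\<nu> a') - real (\<nu> b'))
        = real (\<nu> a) - real (\<nu> b)"
    proof (rule some_equality)
      fix m assume "\<exists>a' b'. a' \<noteq> 0 \<and> b' \<noteq> 0 \<and> to_fract a / to_fract b = to_fract a' / to_fract b' \<and> m = real (\<nu> a') - real (\<nu> b')"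
      then obtain a' b' where m: "a' \<noteq> 0" "b' \<noteq> 0" "to_fract a / to_fract b = to_fract a' / to_fract b'"
          "m = real (\<nu> a') - real (\<nu> b')" by blast
      then have "a * b' = a' * b" using ab by (simp add: frac_eq_eq flip: to_fract_mult)
      then have "\<nu> a + \<nu> b' = \<nu> a' + \<nu> b" using mult ab m by metis
      then show "m = real (\<nu> a) - real (\<nu> b)" using m(4) by linarith
    qed (use ab in blast)
    then show ?thesis using ab by (simp add: v_def)
  qed
  have rep: "\<exists>a b. a \<noteq> 0 \<and> b \<noteq> 0 \<and> r = to_fract a / to_fract b" if "r \<noteq> 0" for r :: "'r fract"
    using that by (cases r) (auto simp: Fract_conv_to_fract)
  have v1: "\<nu> 1 = 0" using mult[of 1 1] by simp
  have vR: "v (to_fract a) = ereal (real (\<nu> a))" if "a \<noteq> 0" for a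
    using v[OF that, of 1] by (simp add: v1)
  have v_mult: "v (r * s) = v r + v s" for r s
  proof (cases "r = 0 \<or> s = 0")
    case True
    then show ?thesis by (auto simp: v_def)
  next
    case False
    then obtain a b c d where rs: "a \<noteq> 0" "b \<noteq> 0" "r = to_fract a / to_fract b" "c \<noteq> 0" "d \<noteq> 0" "s = to_fract c / to_fract d"
      using rep[of r] rep[of s] by blast
    have "r * s = to_fract (a * c) / to_fract (b * d)" using rs by simp
    then show ?thesis
      using v[of "a * c" "b * d"] v[of a b] v[of c d] rs by (simp add: mult)
  qed
  have "discrete_valuation v"
    unfolding discrete_valuation_def
  proof (intro conjI allI impI)
    show "v 0 = \<infinity>" by (simp add: v_def)
    show "\<exists>x. v x = 1" using vR[OF one(1)] one(2) by (intro exI[of _ "to_fract p"]) (simp add: one_ereal_def)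
    show "v (r * s) = v r + v s" for r s by (rule v_mult)
    fix r s :: "'r fract"
    show "\<exists>m::int. v r = ereal (of_int m)" if "r \<noteq> 0"
    proof -
      obtain a b where "a \<noteq> 0" "b \<noteq> 0" "r = to_fract a / to_fract b" using rep \<open>r \<noteq> 0\<close> by blast
      then show ?thesis using v[of a b] by (intro exI[of _ "int (\<nu> a) - int (\<nu> b)"]) simp
    qed
    show "min (v r) (v s) \<le> v (r + s)"
    proof (cases "r = 0 \<or> s = 0 \<or> r + s = 0")
      case True
      then show ?thesis by (auto simp: v_def)
    next
      case False
      then obtain a b c d where rs: "a \<noteq> 0" "b \<noteq> 0" "r = to_fract a / to_fract b" "c \<noteq> 0" "d \<noteq> 0" "s = to_fract c / to_fract d"
        using rep[of r] rep[of s] by blast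
      have eq: "r + s = to_fract (a * d + c * b) / to_fract (b * d)" using rs by (simp add: add_frac_eq)
      have nz: "a * d + c * b \<noteq> 0"
      proof
        assume "a * d + c * b = 0"
        then have "r + s = 0" unfolding eq by (simp only: to_fract_hom.hom_zero div_0)
        then show False using False by blast
      qed
      have "min (\<nu> (a * d)) (\<nu> (c * b)) \<le> \<nu> (a * d + c * b)" using rs nz by (intro add) auto
      then have "min (\<nu> a + \<nu> d) (\<nu> c + \<nu> b) \<le> \<nu> (a * d + c * b)" using rs by (simp add: mult)
      moreover have "v (r + s) = ereal (real (\<nu> (a * d + c * b)) - real (\<nu> b + \<nu> d))"
        unfolding eq using v[OF nz, of "b * d"] rs by (simp add: mult)
      ultimately show ?thesis
        using v[of a b] v[of c d] rs by (auto simp: min_def split: if_splits)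
    qed
  qed
  then show ?thesis using that vR by blast
qed

section \<open>Differentials of a localization of R[w]\<close>

lemma kaehler_relations_range:
  "formal_d (to_fract r) \<in> kaehler_relations (range to_fract) A"
  unfolding kaehler_relations_def by (rule hull_inc) blast

lemma kaehler_relations_leibniz:
  "a \<in> A \<Longrightarrow> b \<in> A \<Longrightarrow> formal_d (a * b) - formal_scale a (formal_d b) - formal_scale b (formal_d a) \<in> kaehler_relations A0 A"
  unfolding kaehler_relations_def by (rule hull_inc) blast

lemma kaehler_relations_additive:
  "a \<in> A \<Longrightarrow> b \<in> A \<Longrightarrow> formal_d (a + b) - formal_d a - formal_d b \<in> kaehler_relations A0 A"
  unfolding kaehler_relations_def by (rule hull_inc) blast

lemma is_submodule_kaehler_relations: "is_submodule formal_scale A (kaehler_relations A0 A)"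
  unfolding kaehler_relations_def by (rule is_submodule_hull)

text \<open>Hypothesis \<open>loc\<close> says that the valuation ring is a localization of \<open>R[w]\<close>; then \<open>d w\<close> generates its
  differentials over \<open>R\<close>.\<close>

lemma divisorial_valuationI:
  fixes v :: "'r::idom fract \<Rightarrow> ereal"
  assumes v: "discrete_valuation v" and R: "\<And>r. 0 \<le> v (to_fract r)" and w: "0 \<le> v w"
    and loc: "\<And>r. 0 \<le> v r \<Longrightarrow> \<exists>a\<in>is_subring hull (range to_fract \<union> {w}). \<exists>s\<in>is_subring hull (range to_fract \<union> {w}). v s = 0 \<and> r = a / s"
    and c: "0 \<le> v c" "formal_scale c (formal_d w) \<in> kaehler_relations (range to_fract) (valuation_ring v)"
  shows "divisorial_valuation v" and "c \<in> jacobian_ideal (range to_fract) (valuation_ring v)"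
proof -
  define V where "V = valuation_ring v"
  define B where "B = is_subring hull (range to_fract \<union> {w})"
  let ?N = "kaehler_relations (range to_fract) V"
  have V: "is_subring V" unfolding V_def by (rule is_subring_valuation_ring[OF v])
  have B: "is_subring B" unfolding B_def by (rule is_subring_hull)
  have RV: "to_fract r \<in> V" for r using R by (simp add: V_def valuation_ring_def)
  have wV: "w \<in> V" using w by (simp add: V_def valuation_ring_def)
  have BV: "B \<subseteq> V" unfolding B_def using RV wV V by (intro hull_minimal) auto
  have unit: "s \<noteq> 0" "v (1 / s) = 0" if "v s = 0" for s
  proof -
    show "s \<noteq> 0" using that valuation_zero[OF v] by auto
    then show "v (1 / s) = 0"
      using valuation_mult[OF v, of "1 / s" s] valuation_one[OF v] that by simp
  qed
  have "V = {a / s | a s. a \<in> B \<and> s \<in> {s \<in> B. v s = 0}}"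
  proof (intro equalityI subsetI)
    fix r assume "r \<in> V"
    then show "r \<in> {a / s | a s. a \<in> B \<and> s \<in> {s \<in> B. v s = 0}}"
      using loc[of r] unfolding B_def V_def valuation_ring_def by blast
  next
    fix r assume "r \<in> {a / s | a s. a \<in> B \<and> s \<in> {s \<in> B. v s = 0}}"
    then obtain a s where as: "r = a * (1 / s)" "a \<in> B" "v s = 0" by auto
    then have "1 / s \<in> V" using unit by (simp add: V_def valuation_ring_def)
    then show "r \<in> V" using as BV V by (auto simp del: times_divide_eq_right intro: subring_mult)
  qed
  moreover have "1 \<in> {s \<in> B. v s = 0}" "0 \<notin> {s \<in> B. v s = 0}"
      "\<forall>s\<in>{s \<in> B. v s = 0}. \<forall>t\<in>{s \<in> B. v s = 0}. s * t \<in> {s \<in> B. v s = 0}"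
    by (simp_all add: valuation_zero[OF v] valuation_one[OF v] valuation_mult[OF v] subring_one[OF B] subring_mult[OF B])
  ultimately have "ess_finite_type (range to_fract) V"
    unfolding ess_finite_type_def B_def[symmetric]
    by (rule_tac exI[of _ "{w}"], rule_tac exI[of _ "{s \<in> B. v s = 0}"], intro conjI)
      (simp_all only: B_def[symmetric] finite.intros Collect_subset)
  then show "divisorial_valuation v"
    using v R by (simp add: divisorial_valuation_def V_def)
  note N = is_submodule_kaehler_relations[of V "range to_fract"]
  note add = submodule_add[OF N] and scale = submodule_scale[OF N]
  have uminus: "- f \<in> ?N" if "f \<in> ?N" for f
  proof -
    have "formal_scale (-1) f \<in> ?N" using that by (intro scale subring_uminus subring_one V)
    moreover have "formal_scale (-1) f = - f" by (rule poly_mapping_eqI) simp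
    ultimately show ?thesis by simp
  qed
  have diff: "f - g \<in> ?N" if "f \<in> ?N" "g \<in> ?N" for f g
    using add[OF that(1) uminus[OF that(2)]] by simp
  \<comment> \<open>Elements whose differential is a multiple of \<open>d w\<close>. They form a
    subring containing \<open>R\<close> and \<open>w\<close>, hence all of
    \<open>R[w]\<close>.\<close>
  define E where "E = {a \<in> V. \<exists>e\<in>V. formal_d a - formal_scale e (formal_d w) \<in> ?N}"
  have E_R: "to_fract r \<in> E" for r
    unfolding E_def using RV kaehler_relations_range subring_zero[OF V]
    by (auto intro!: bexI[of _ 0] simp: formal_scale_zero_left)
  have E_w: "w \<in> E"
    unfolding E_def using wV subring_one[OF V] submodule_zero[OF N]
    by (auto intro!: bexI[of _ 1] simp: formal_scale_one)
  have E_mult: "a * b \<in> E" if "a \<in> E" "b \<in> E" for a b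
  proof -
    from that obtain e e' where *: "a \<in> V" "b \<in> V" "e \<in> V" "e' \<in> V"
        "formal_d a - formal_scale e (formal_d w) \<in> ?N" "formal_d b - formal_scale e' (formal_d w) \<in> ?N"
      by (auto simp: E_def)
    have "(formal_d (a * b) - formal_scale a (formal_d b) - formal_scale b (formal_d a))
       + (formal_scale a (formal_d b - formal_scale e' (formal_d w)) + formal_scale b (formal_d a - formal_scale e (formal_d w))) \<in> ?N"
      using * by (intro add scale kaehler_relations_leibniz)
    also have "(formal_d (a * b) - formal_scale a (formal_d b) - formal_scale b (formal_d a))
       + (formal_scale a (formal_d b - formal_scale e' (formal_d w)) + formal_scale b (formal_d a - formal_scale e (formal_d w)))
       = formal_d (a * b) - formal_scale (a * e' + b * e) (formal_d w)"
      by (simp add: formal_scale_diff formal_scale_mult formal_scale_add_left)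
    finally show ?thesis
      unfolding E_def using * by (intro CollectI conjI bexI[of _ "a * e' + b * e"] subring_add subring_mult V)
  qed
  have E_add: "a + b \<in> E" if "a \<in> E" "b \<in> E" for a b
  proof -
    from that obtain e e' where *: "a \<in> V" "b \<in> V" "e \<in> V" "e' \<in> V"
        "formal_d a - formal_scale e (formal_d w) \<in> ?N" "formal_d b - formal_scale e' (formal_d w) \<in> ?N"
      by (auto simp: E_def)
    have "(formal_d (a + b) - formal_d a - formal_d b)
       + ((formal_d a - formal_scale e (formal_d w)) + (formal_d b - formal_scale e' (formal_d w))) \<in> ?N"
      using * by (intro add kaehler_relations_additive)
    also have "(formal_d (a + b) - formal_d a - formal_d b)
       + ((formal_d a - formal_scale e (formal_d w)) + (formal_d b - formal_scale e' (formal_d w)))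
       = formal_d (a + b) - formal_scale (e + e') (formal_d w)"
      by (simp add: formal_scale_add_left)
    finally show ?thesis
      unfolding E_def using * by (intro CollectI conjI bexI[of _ "e + e'"] subring_add V)
  qed
  have "is_subring E"
    unfolding is_subring_def
  proof (intro conjI ballI)
    show "0 \<in> E" "1 \<in> E" using E_R[of 0] E_R[of 1] by simp_all
    fix a b assume ab: "a \<in> E" "b \<in> E"
    then show "a * b \<in> E" by (rule E_mult)
    have "a + to_fract (- 1) * b \<in> E" using ab by (intro E_add E_mult E_R)
    then show "a - b \<in> E" by (simp add: to_fract_uminus)
  qed
  then have BE: "B \<subseteq> E" unfolding B_def using E_R E_w by (intro hull_minimal) auto
  have gen: "\<exists>e\<in>V. formal_d r - formal_scale e (formal_d w) \<in> ?N" if r: "r \<in> V" for r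
  proof -
    obtain a s where as: "a \<in> B" "s \<in> B" "v s = 0" "r = a / s"
      using r loc[of r] unfolding B_def V_def valuation_ring_def by blast
    have s: "s \<noteq> 0" "1 / s \<in> V" using unit[OF as(3)] by (simp_all add: V_def valuation_ring_def)
    have sV: "s \<in> V" using as BV by blast
    obtain e e' where e: "e \<in> V" "e' \<in> V" "formal_d a - formal_scale e (formal_d w) \<in> ?N"
        "formal_d s - formal_scale e' (formal_d w) \<in> ?N"
    proof -
      have "a \<in> E" "s \<in> E" using as BE by blast+
      then show ?thesis using that unfolding E_def by blast
    qed
    \<comment> \<open>The Leibniz rule for \<open>s * r = a\<close> is solved for
      \<open>d r\<close>, which is possible because \<open>s\<close> is a unit of
      \<open>V\<close>.\<close>
    have k: "formal_d (s * r) - formal_scale s (formal_d r) - formal_scale r (formal_d s) \<in> ?N"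
      by (rule kaehler_relations_leibniz[OF sV r])
    have "formal_scale (1 / s) ((formal_d a - formal_scale e (formal_d w)) - (formal_d (s * r) - formal_scale s (formal_d r) - formal_scale r (formal_d s))
        - formal_scale r (formal_d s - formal_scale e' (formal_d w))) \<in> ?N"
      by (rule scale[OF s(2) diff[OF diff[OF e(3) k] scale[OF r e(4)]]])
    also have "formal_scale (1 / s) ((formal_d a - formal_scale e (formal_d w)) - (formal_d (s * r) - formal_scale s (formal_d r) - formal_scale r (formal_d s))
        - formal_scale r (formal_d s - formal_scale e' (formal_d w)))
        = formal_d r - formal_scale ((1 / s) * (e - r * e')) (formal_d w)"
    proof -
      have "s * r = a" using as s by simp
      then show ?thesis
        using s(1) by (intro poly_mapping_eqI) (simp add: lookup_minus lookup_add field_simps)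
    qed
    finally show ?thesis
      by (rule bexI) (intro subring_mult subring_diff V e r s)
  qed
  show "c \<in> jacobian_ideal (range to_fract) (valuation_ring v)"
    using c gen unfolding V_def[symmetric]
    by (intro annihilator_in_jacobian_ideal[OF V wV]) (auto simp: V_def valuation_ring_def)
qed

text \<open>A single element \<open>c\<close> bounds the value of the Jacobian ideal from above, so
  one \<open>c\<close> is enough to constrain the adjoint.\<close>

lemma adjoint_value_ge:
  assumes q: "q \<in> adjoint L" and v: "divisorial_valuation v"
    and c: "c \<in> jacobian_ideal (range to_fract) (valuation_ring v)" "v c = ereal b"
    and L: "\<And>l. l \<in> L \<Longrightarrow> ereal a \<le> v (to_fract l)"
  shows "ereal (a - b) \<le> v q"
proof -
  have "ereal a - ereal b \<le> value_of_set v (to_fract ` L) - value_of_set v (jacobian_ideal (range to_fract) (valuation_ring v))"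
  proof (rule ereal_minus_mono)
    show "ereal a \<le> value_of_set v (to_fract ` L)"
      unfolding value_of_set_def using L by (intro INF_greatest) auto
    show "value_of_set v (jacobian_ideal (range to_fract) (valuation_ring v)) \<le> ereal b"
      unfolding value_of_set_def c(2)[symmetric] by (rule INF_lower[OF c(1)])
  qed
  also have "\<dots> \<le> v q" using q v by (auto simp: adjoint_def)
  finally show ?thesis by simp
qed

section \<open>The order valuation at the origin\<close>

definition origin_order :: "'a::field poly poly \<Rightarrow> nat" where
  "origin_order p = (LEAST d. form d p \<noteq> 0)"

lemma form_origin_order:
  assumes "p \<noteq> 0"
  shows "form (origin_order p) p \<noteq> 0"
proof -
  have "\<exists>d. form d p \<noteq> 0" using assms poly_eqI_form[of p 0] by (metis form_0)
  then show ?thesis unfolding origin_order_def by (rule LeastI_ex)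
qed

lemma in_origin_power_iff: "p \<noteq> 0 \<Longrightarrow> p \<in> origin_power d \<longleftrightarrow> d \<le> origin_order p"
  using form_origin_order[of p] not_less_Least[of _ "\<lambda>d. form d p \<noteq> 0"]
  by (auto simp: origin_power_def origin_order_def[symmetric] not_le[symmetric])

lemma origin_order_eqI:
  assumes "p \<in> origin_power d" and "form d p \<noteq> 0"
  shows "origin_order p = d"
proof (rule antisym)
  show "origin_order p \<le> d" unfolding origin_order_def by (rule Least_le) fact
  have "p \<noteq> 0" using assms(2) by auto
  then show "d \<le> origin_order p" using assms(1) by (simp add: in_origin_power_iff)
qed

lemma origin_order_homogenize: "degree u \<le> d \<Longrightarrow> u \<noteq> 0 \<Longrightarrow> origin_order (homogenize d u) = d"
  by (intro origin_order_eqI) (simp_all add: form_homogenize homogenize_in_origin_power)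

lemma origin_order_var:
  "origin_order (var_x :: 'a::field poly poly) = 1" "origin_order (var_y :: 'a poly poly) = 1"
  using monomial_eq[of 1 0, where ?'a = 'a] monomial_eq[of 0 1, where ?'a = 'a]
    origin_order_homogenize[of "monom (1 :: 'a) 0" 1] origin_order_homogenize[of "monom (1 :: 'a) 1" 1]
  by (simp_all add: degree_monom_eq)

text \<open>Orders add because lowest parts multiply in the domain \<open>k[t]\<close>. The
  valuation ring is a localization of \<open>R[y/x]\<close>, and
  \<open>x d(y/x) = dy - (y/x) dx\<close> is zero in the differentials over \<open>R\<close>, which
  puts \<open>x\<close> into the Jacobian ideal.\<close>

lemma order_valuation:
  obtains v :: "'a::field poly poly fract \<Rightarrow> ereal" where "divisorial_valuation v"
    and "to_fract var_x \<in> jacobian_ideal (range to_fract) (valuation_ring v)"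
    and "\<And>p. p \<noteq> 0 \<Longrightarrow> v (to_fract p) = ereal (real (origin_order p))"
proof -
  have x: "var_x \<noteq> (0 :: 'a poly poly)" "origin_order (var_x :: 'a poly poly) = 1"
    and y: "var_y \<noteq> (0 :: 'a poly poly)" "origin_order (var_y :: 'a poly poly) = 1"
    using origin_order_var by (simp_all add: var_x_def var_y_def)
  obtain v where v: "discrete_valuation v" and v_eq: "\<And>p :: 'a poly poly. p \<noteq> 0 \<Longrightarrow> v (to_fract p) = ereal (real (origin_order p))"
  proof (rule extend_valuation[of origin_order var_x])
    fix a b :: "'a poly poly" assume ab: "a \<noteq> 0" "b \<noteq> 0"
    then have "a \<in> origin_power (origin_order a)" "b \<in> origin_power (origin_order b)"
      by (simp_all add: in_origin_power_iff)
    from origin_power_mult[OF this] show "origin_order (a * b) = origin_order a + origin_order b"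
      using ab form_origin_order by (intro origin_order_eqI) auto
    assume nz: "a + b \<noteq> 0"
    let ?m = "min (origin_order a) (origin_order b)"
    have "a \<in> origin_power ?m" "b \<in> origin_power ?m" using ab by (simp_all add: in_origin_power_iff)
    then have "a + b \<in> origin_power ?m" by (rule ideal_add[OF is_ideal_origin_power])
    then show "?m \<le> origin_order (a + b)" using nz by (simp add: in_origin_power_iff)
  qed (use x in auto)
  have R: "0 \<le> v (to_fract p)" for p
    using v_eq[of p] by (cases "p = 0") (auto simp: valuation_zero[OF v])
  define X Y where "X = to_fract (var_x :: 'a poly poly)" and "Y = to_fract (var_y :: 'a poly poly)"
  have nz: "X \<noteq> 0" "Y \<noteq> 0" using x y by (simp_all add: X_def Y_def)
  have vX: "v X = 1" and vY: "v Y = 1" using v_eq x y by (simp_all add: X_def Y_def one_ereal_def)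
  define B where "B = is_subring hull (range to_fract \<union> {Y / X})"
  have B: "is_subring B" unfolding B_def by (rule is_subring_hull)
  have RB: "to_fract p \<in> B" for p unfolding B_def by (rule hull_inc) simp
  have wB: "Y / X \<in> B" unfolding B_def by (rule hull_inc) simp
  \<comment> \<open>On monomials of degree at least \<open>d\<close>:
    \<open>x^i y^j / x^d = x^(i+j-d) (y/x)^j\<close>.\<close>
  have divB: "to_fract p / X ^ d \<in> B" if p: "p \<in> origin_power d" for p d
  proof -
    have "p \<in> {p. to_fract p / X ^ d \<in> B}"
    proof (rule in_ideal_of_monomials)
      show "is_ideal {p. to_fract p / X ^ d \<in> B}"
      proof (rule is_idealI)
        fix r p assume "p \<in> {p. to_fract p / X ^ d \<in> B}"
        then show "r * p \<in> {p. to_fract p / X ^ d \<in> B}"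
          using subring_mult[OF B RB[of r], of "to_fract p / X ^ d"] by simp
      qed (auto simp: subring_zero[OF B] add_divide_distrib intro: subring_add[OF B])
    next
      fix i j assume c: "coeff (coeff p j) i \<noteq> 0"
      have "d \<le> i + j" using le_add_of_coeff_nonzero[OF p c] .
      then have "X ^ i * X ^ j = X ^ (i + j - d) * X ^ d" by (simp flip: power_add)
      then have "to_fract (var_x ^ i * var_y ^ j) / X ^ d = X ^ (i + j - d) * (Y / X) ^ j"
        using nz by (simp add: X_def[symmetric] Y_def[symmetric] to_fract_hom.hom_power power_divide frac_eq_eq mult_ac)
      also have "\<dots> \<in> B" using RB[of var_x] wB by (intro subring_mult subring_power B) (simp_all add: X_def)
      finally show "var_x ^ i * var_y ^ j \<in> {p. to_fract p / X ^ d \<in> B}" by simp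
    qed
    then show ?thesis by simp
  qed
  have loc: "\<exists>a\<in>B. \<exists>s\<in>B. v s = 0 \<and> r = a / s" if r: "0 \<le> v r" for r
  proof (cases "r = 0")
    case True
    then show ?thesis using subring_zero[OF B] subring_one[OF B] valuation_one[OF v] by (intro bexI[of _ 0] bexI[of _ 1]) auto
  next
    case False
    then obtain p q where pq: "q \<noteq> 0" "r = to_fract p / to_fract q"
      by (cases r) (auto simp: Fract_conv_to_fract)
    then have "p \<noteq> 0" using False by auto
    \<comment> \<open>Dividing numerator and denominator by \<open>X ^ d\<close> keeps both in
      \<open>B\<close> and gives the denominator value \<open>0\<close>.\<close>
    define d where "d = origin_order q"
    have "v (r * to_fract q) = v r + v (to_fract q)" by (rule valuation_mult[OF v])
    then have "v (to_fract q) \<le> v (to_fract p)"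
      using pq r add_right_mono[of 0 "v r" "v (to_fract q)"] by simp
    then have "d \<le> origin_order p" using v_eq pq \<open>p \<noteq> 0\<close> by (simp add: d_def)
    then have "p \<in> origin_power d" "q \<in> origin_power d"
      using pq \<open>p \<noteq> 0\<close> by (simp_all add: in_origin_power_iff d_def)
    moreover have "v (to_fract q / X ^ d) = 0"
    proof -
      have "v (to_fract q / X ^ d * X ^ d) = v (to_fract q / X ^ d) + v (X ^ d)" by (rule valuation_mult[OF v])
      then have "ereal (real d) = v (to_fract q / X ^ d) + ereal (real d)"
        using nz v_eq[OF pq(1)] valuation_power[OF v, of X 1 d] vX by (simp add: d_def one_ereal_def)
      then show ?thesis by (cases "v (to_fract q / X ^ d)") auto
    qed
    moreover have "r = (to_fract p / X ^ d) / (to_fract q / X ^ d)" using pq nz by simp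
    ultimately show ?thesis using divB by blast
  qed
  have w: "0 \<le> v (Y / X)" using valuation_divide_nonneg[OF v nz(1), of Y] vX vY by simp
  have "formal_scale X (formal_d (Y / X)) \<in> kaehler_relations (range to_fract) (valuation_ring v)"
  proof -
    let ?N = "kaehler_relations (range to_fract) (valuation_ring v)"
    note N = is_submodule_kaehler_relations[of "valuation_ring v" "range to_fract"]
    have V: "X \<in> valuation_ring v" "Y / X \<in> valuation_ring v" "- (Y / X) \<in> valuation_ring v" "-1 \<in> valuation_ring v"
      using w vX valuation_uminus[OF v] valuation_one[OF v] by (auto simp: valuation_ring_def)
    have "formal_scale (-1) (formal_d (X * (Y / X)) - formal_scale X (formal_d (Y / X)) - formal_scale (Y / X) (formal_d X))
        + (formal_d Y + formal_scale (- (Y / X)) (formal_d X)) \<in> ?N"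
      using V by (intro submodule_add[OF N] submodule_scale[OF N] kaehler_relations_leibniz)
        (simp_all add: X_def Y_def kaehler_relations_range)
    also have "formal_scale (-1) (formal_d (X * (Y / X)) - formal_scale X (formal_d (Y / X)) - formal_scale (Y / X) (formal_d X))
        + (formal_d Y + formal_scale (- (Y / X)) (formal_d X)) = formal_scale X (formal_d (Y / X))"
      using nz by (intro poly_mapping_eqI) (simp add: lookup_add lookup_minus)
    finally show ?thesis .
  qed
  moreover have "0 \<le> v X" using vX by simp
  ultimately have "divisorial_valuation v" "X \<in> jacobian_ideal (range to_fract) (valuation_ring v)"
    using divisorial_valuationI[OF v R w loc[unfolded B_def]] by blast+
  then show ?thesis using that v_eq by (simp add: X_def)
qed

text \<open>The degree of \<open>blowup p\<close> is the total degree of \<open>p\<close>.\<close>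

lemma is_unit_of_degree_blowup:
  assumes "p \<noteq> 0" and "degree (blowup p) = 0"
  shows "p dvd (1 :: 'a::field poly poly)"
proof -
  define c where "c = coeff (coeff p 0) 0"
  have "p = [:[:c:]:]"
  proof (intro poly_eqI)
    fix j i
    have "form (i + j) p = 0" if "i + j > 0" using assms(2) that by (simp add: form_def coeff_eq_0)
    then have "coeff (coeff p j) i = 0" if "i + j > 0"
      using coeff_form[of "i + j" p j] that by simp
    then show "coeff (coeff p j) i = coeff (coeff [:[:c:]:] j) i"
      by (cases "i + j > 0") (auto simp: c_def coeff_pCons split: nat.splits)
  qed
  moreover from this have "c \<noteq> 0" using assms(1) by auto
  ultimately have "1 = p * [:[:inverse c:]:]" by (simp add: pCons_one)
  then show ?thesis by (rule dvdI)
qed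

lemma degree_blowup_mult:
  "p \<noteq> 0 \<Longrightarrow> q \<noteq> 0 \<Longrightarrow> degree (blowup (p * q)) = degree (blowup p) + degree (blowup q)"
  by (simp add: blowup_hom.hom_mult degree_mult_eq blowup_eq_0_iff)

section \<open>Valuations of prime elements\<close>

definition exponent_of :: "'a::field poly poly \<Rightarrow> 'a poly poly \<Rightarrow> nat" where
  "exponent_of q p = (GREATEST N. q ^ N dvd p)"

text \<open>A prime element has positive total degree, so the total degree of \<open>p\<close>
  bounds the exponents and the greatest one exists.\<close>

lemma power_dvd_iff_exponent_of:
  assumes q: "prime_elem q" and p: "p \<noteq> 0"
  shows "q ^ N dvd p \<longleftrightarrow> N \<le> exponent_of q p"
proof -
  have "q \<noteq> 0" "\<not> q dvd 1" using q by (auto simp: prime_elem_def)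
  then have dq: "degree (blowup q) > 0" using is_unit_of_degree_blowup by blast
  have pow: "degree (blowup (q ^ N)) = N * degree (blowup q)" for N
    using \<open>q \<noteq> 0\<close> by (simp add: blowup_hom.hom_power degree_power_eq blowup_eq_0_iff)
  have bound: "N \<le> degree (blowup p)" if "q ^ N dvd p" for N
  proof -
    from that obtain r where r: "p = q ^ N * r" by (rule dvdE)
    then have "degree (blowup p) = N * degree (blowup q) + degree (blowup r)"
      using p \<open>q \<noteq> 0\<close> degree_blowup_mult[of "q ^ N" r] pow by auto
    moreover have "N \<le> N * degree (blowup q)" using dq by simp
    ultimately show ?thesis by linarith
  qed
  have "q ^ exponent_of q p dvd p"
    unfolding exponent_of_def using bound by (intro GreatestI_nat[of "\<lambda>N. q ^ N dvd p" 0 "degree (blowup p)"]) auto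
  then have "q ^ N dvd p" if "N \<le> exponent_of q p" using that le_imp_power_dvd dvd_trans by blast
  moreover have "N \<le> exponent_of q p" if "q ^ N dvd p"
    unfolding exponent_of_def using bound that by (intro Greatest_le_nat) auto
  ultimately show ?thesis by blast
qed

lemma exponent_of_mult:
  assumes q: "prime_elem q" and nz: "a \<noteq> 0" "b \<noteq> 0"
  shows "exponent_of q (a * b) = exponent_of q a + exponent_of q b"
proof (rule antisym)
  have "q \<noteq> 0" using q by (auto simp: prime_elem_def)
  obtain a' where a': "a = q ^ exponent_of q a * a'" using power_dvd_iff_exponent_of[OF q nz(1)] by (metis dvdE le_refl)
  obtain b' where b': "b = q ^ exponent_of q b * b'" using power_dvd_iff_exponent_of[OF q nz(2)] by (metis dvdE le_refl)
  have na: "\<not> q dvd a'"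
  proof
    assume "q dvd a'"
    then have "q ^ Suc (exponent_of q a) dvd a" by (subst a') (simp add: mult_dvd_mono mult.commute[of q])
    then show False
      using power_dvd_iff_exponent_of[OF q nz(1), of "Suc (exponent_of q a)"] by (simp del: power_Suc)
  qed
  have nb: "\<not> q dvd b'"
  proof
    assume "q dvd b'"
    then have "q ^ Suc (exponent_of q b) dvd b" by (subst b') (simp add: mult_dvd_mono mult.commute[of q])
    then show False
      using power_dvd_iff_exponent_of[OF q nz(2), of "Suc (exponent_of q b)"] by (simp del: power_Suc)
  qed
  show "exponent_of q (a * b) \<le> exponent_of q a + exponent_of q b"
  proof (rule ccontr)
    assume "\<not> ?thesis"
    then have "q ^ Suc (exponent_of q a + exponent_of q b) dvd a * b"
      using power_dvd_iff_exponent_of[OF q, of "a * b" "Suc (exponent_of q a + exponent_of q b)"] nz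
      by (simp del: power_Suc)
    moreover have "a * b = q ^ (exponent_of q a + exponent_of q b) * (a' * b')"
      using a' b' by (metis (no_types, lifting) mult.assoc mult.left_commute power_add)
    ultimately have "q ^ (exponent_of q a + exponent_of q b) * q dvd q ^ (exponent_of q a + exponent_of q b) * (a' * b')"
      by (simp add: mult.commute)
    then have "q dvd a' * b'" using \<open>q \<noteq> 0\<close> by simp
    then show False using na nb q by (simp add: prime_elem_dvd_mult_iff)
  qed
  have "q ^ exponent_of q a * q ^ exponent_of q b dvd a * b"
    using power_dvd_iff_exponent_of[OF q] nz by (intro mult_dvd_mono) auto
  then show "exponent_of q a + exponent_of q b \<le> exponent_of q (a * b)"
    using power_dvd_iff_exponent_of[OF q, of "a * b" "exponent_of q a + exponent_of q b"] nz by (simp add: power_add)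
qed

text \<open>The valuation ring is the localization of \<open>R\<close> at the prime
  \<open>q\<close>. With \<open>w = 0\<close> in \<open>divisorial_valuationI\<close> its
  differentials over \<open>R\<close> vanish, so \<open>1\<close> lies in the Jacobian
  ideal.\<close>

lemma prime_valuation:
  fixes q :: "'a::field poly poly"
  assumes q: "prime_elem q"
  obtains v where "divisorial_valuation v"
    and "1 \<in> jacobian_ideal (range to_fract) (valuation_ring v)"
    and "\<And>p. p \<noteq> 0 \<Longrightarrow> v (to_fract p) = ereal (real (exponent_of q p))"
proof -
  note dvd = power_dvd_iff_exponent_of[OF q]
  have "q \<noteq> 0" "\<not> q dvd 1" using q by (auto simp: prime_elem_def)
  have "exponent_of q q = 1"
  proof (rule antisym)
    have "\<not> q ^ 2 dvd q"
    proof
      assume "q ^ 2 dvd q"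
      then have "q * q dvd q * 1" by (simp add: power2_eq_square)
      then show False using \<open>q \<noteq> 0\<close> \<open>\<not> q dvd 1\<close> by (simp only: dvd_mult_cancel_left simp_thms)
    qed
    then show "exponent_of q q \<le> 1" using dvd[OF \<open>q \<noteq> 0\<close>, of 2] by simp
    show "1 \<le> exponent_of q q" using dvd[OF \<open>q \<noteq> 0\<close>, of 1] by simp
  qed
  then obtain v where v: "discrete_valuation v" and v_eq: "\<And>p. p \<noteq> 0 \<Longrightarrow> v (to_fract p) = ereal (real (exponent_of q p))"
  proof (rule extend_valuation[of "exponent_of q" q, rotated 3])
    fix a b :: "'a poly poly" assume ab: "a \<noteq> 0" "b \<noteq> 0" and nz: "a + b \<noteq> 0"
    let ?m = "min (exponent_of q a) (exponent_of q b)"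
    have "q ^ ?m dvd a + b" using ab by (intro dvd_add) (simp_all add: dvd)
    then show "?m \<le> exponent_of q (a + b)" using nz by (simp add: dvd)
  qed (use \<open>q \<noteq> 0\<close> exponent_of_mult[OF q] in auto)
  have R: "0 \<le> v (to_fract p)" for p
    using v_eq[of p] by (cases "p = 0") (auto simp: valuation_zero[OF v])
  let ?B = "is_subring hull (range to_fract \<union> {0 :: 'a poly poly fract})"
  have RB: "to_fract p \<in> ?B" for p by (rule hull_inc) simp
  have loc: "\<exists>a\<in>?B. \<exists>s\<in>?B. v s = 0 \<and> r = a / s" if r: "0 \<le> v r" for r
  proof (cases "r = 0")
    case True
    then show ?thesis using RB[of 0] RB[of 1] valuation_one[OF v] by (intro bexI[of _ 0] bexI[of _ 1]) auto
  next
    case False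
    then obtain a b where ab: "b \<noteq> 0" "r = to_fract a / to_fract b"
      by (cases r) (auto simp: Fract_conv_to_fract)
    then have "a \<noteq> 0" using False by auto
    have "v (r * to_fract b) = v r + v (to_fract b)" by (rule valuation_mult[OF v])
    then have "v (to_fract b) \<le> v (to_fract a)"
      using ab r add_right_mono[of 0 "v r" "v (to_fract b)"] by simp
    then have "exponent_of q b \<le> exponent_of q a" using v_eq ab \<open>a \<noteq> 0\<close> by simp
    then obtain a' b' where eq: "a = q ^ exponent_of q b * a'" "b = q ^ exponent_of q b * b'"
      using dvd[OF \<open>a \<noteq> 0\<close>] dvd[OF ab(1)] by (metis dvdE le_refl)
    have "b' \<noteq> 0" using eq ab by auto
    \<comment> \<open>Additivity leaves exponent \<open>0\<close> for \<open>b'\<close>, which is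
      thus a unit of the valuation ring.\<close>
    have "exponent_of q b = exponent_of q (q ^ exponent_of q b) + exponent_of q b'"
      using eq(2) exponent_of_mult[OF q, of "q ^ exponent_of q b" b'] \<open>q \<noteq> 0\<close> \<open>b' \<noteq> 0\<close> by simp
    moreover have "exponent_of q b \<le> exponent_of q (q ^ exponent_of q b)"
      using dvd[of "q ^ exponent_of q b" "exponent_of q b"] \<open>q \<noteq> 0\<close> by simp
    ultimately have "v (to_fract b') = 0" using v_eq[OF \<open>b' \<noteq> 0\<close>] by (simp add: zero_ereal_def)
    moreover have "r = to_fract a' / to_fract b'"
      using ab(2) \<open>q \<noteq> 0\<close> eq by (metis mult_divide_mult_cancel_left power_not_zero to_fract_eq_0_iff to_fract_mult)
    ultimately show ?thesis using RB by blast
  qed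
  have "formal_scale 1 (formal_d 0) \<in> kaehler_relations (range to_fract) (valuation_ring v)"
    using kaehler_relations_range[of 0] by (simp add: formal_scale_one)
  moreover have "0 \<le> v 1" "0 \<le> v 0" using valuation_one[OF v] valuation_zero[OF v] by simp_all
  ultimately show ?thesis
    using divisorial_valuationI[OF v R _ loc] that v_eq by blast
qed

text \<open>Induction on the total degree of the denominator: the valuation of a prime factor of the
  denominator forces this prime to divide the numerator, and it can be cancelled.\<close>

lemma fract_integral:
  fixes r :: "'a::field poly poly fract"
  assumes "\<And>v. divisorial_valuation v \<Longrightarrow>
      1 \<in> jacobian_ideal (range to_fract) (valuation_ring v) \<Longrightarrow> 0 \<le> v r"
  shows "r \<in> range to_fract"
proof -
  have "r \<in> range to_fract" if "b \<noteq> 0" "r = to_fract a / to_fract b" for a b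
    using that
  proof (induction "degree (blowup b)" arbitrary: a b rule: less_induct)
    case less
    show ?case
    proof (cases "b dvd 1 \<or> a = 0")
      case True
      then consider b' where "1 = b * b'" | "a = 0" by (auto elim: dvdE)
      then show ?thesis
      proof cases
        case 1
        then have "to_fract b * to_fract b' = 1" by (metis to_fract_1 to_fract_mult)
        then have "to_fract b' = 1 / to_fract b" using less.prems by (simp add: eq_divide_eq mult.commute)
        then have "r = to_fract (a * b')" using less.prems by simp
        then show ?thesis by blast
      next
        case 2
        then have "r = to_fract 0" using less.prems by simp
        then show ?thesis by blast
      qed
    next
      case False
      then obtain F where F: "mset_factors F b" using mset_factors_exist less.prems by blast
      then obtain q where "q \<in># F" by (auto simp: mset_factors_def)
      then have q: "q dvd b" "irreducible q" using F mset_factors_imp_dvd by (auto simp: mset_factors_def)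
      then have prime: "prime_elem q" by (simp add: prime_elem_iff_irreducible)
      then have "q \<noteq> 0" "\<not> q dvd 1" by (auto simp: prime_elem_def)
      obtain v where v: "divisorial_valuation v" "1 \<in> jacobian_ideal (range to_fract) (valuation_ring v)"
          "\<And>p. p \<noteq> 0 \<Longrightarrow> v (to_fract p) = ereal (real (exponent_of q p))"
        using prime_valuation[OF prime] by blast
      then have dv: "discrete_valuation v" by (simp add: divisorial_valuation_def)
      have "0 \<le> v r" using assms[OF v(1,2)] .
      then have "v (to_fract b) \<le> v (to_fract a)"
        using valuation_mult[OF dv, of r "to_fract b"] less.prems add_right_mono[of 0 "v r" "v (to_fract b)"] by simp
      moreover have "1 \<le> exponent_of q b"
        using q(1) power_dvd_iff_exponent_of[OF prime, of b 1] less.prems by simp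
      ultimately have "1 \<le> exponent_of q a" using v(3) less.prems False by simp
      then have "q dvd a" using power_dvd_iff_exponent_of[OF prime, of a 1] False by simp
      with q(1) obtain a' b' where eq: "a = q * a'" "b = q * b'" by (auto elim!: dvdE)
      have nz: "b' \<noteq> 0" using eq less.prems by auto
      have "degree (blowup b) = degree (blowup q) + degree (blowup b')"
        unfolding eq using \<open>q \<noteq> 0\<close> nz by (rule degree_blowup_mult)
      moreover have "degree (blowup q) > 0"
        using is_unit_of_degree_blowup \<open>q \<noteq> 0\<close> \<open>\<not> q dvd 1\<close> by blast
      ultimately have "degree (blowup b') < degree (blowup b)" by simp
      moreover have "r = to_fract a' / to_fract b'"
        using less.prems \<open>q \<noteq> 0\<close> unfolding eq by simp
      ultimately show ?thesis using less.hyps nz by blast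
    qed
  qed
  moreover obtain a b where "b \<noteq> 0" "r = to_fract a / to_fract b"
    by (cases r) (auto simp: Fract_conv_to_fract)
  ultimately show ?thesis by blast
qed

section \<open>Upper bound for the adjoint\<close>

lemma adjoint_subset_origin_power:
  fixes L :: "'a::field poly poly set"
  assumes L: "L \<subseteq> origin_power m" and m: "m > 0"
  shows "adjoint L \<subseteq> to_fract ` origin_power (m - 1)"
proof
  fix r assume r: "r \<in> adjoint L"
  have "r \<in> range to_fract"
  proof (rule fract_integral)
    fix v :: "'a poly poly fract \<Rightarrow> ereal"
    assume v: "divisorial_valuation v" and one: "1 \<in> jacobian_ideal (range to_fract) (valuation_ring v)"
    then have "discrete_valuation v" "\<And>p. 0 \<le> v (to_fract p)" by (simp_all add: divisorial_valuation_def)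
    then have "ereal (0 - 0) \<le> v r"
      by (intro adjoint_value_ge[OF r v one]) (simp_all add: valuation_one flip: zero_ereal_def)
    then show "0 \<le> v r" by (simp add: zero_ereal_def)
  qed
  then obtain p where p: "r = to_fract p" by blast
  obtain v where v: "divisorial_valuation v"
    and x: "to_fract (var_x :: 'a poly poly) \<in> jacobian_ideal (range to_fract) (valuation_ring v)"
    and v_eq: "\<And>p. p \<noteq> 0 \<Longrightarrow> v (to_fract p) = ereal (real (origin_order p))"
    using order_valuation by blast
  have dv: "discrete_valuation v" using v by (simp add: divisorial_valuation_def)
  have "v (to_fract var_x) = ereal 1"
    using v_eq[of var_x] origin_order_var(1)[where ?'a = 'a] by (simp add: var_x_def)
  \<comment> \<open>Elements of \<open>L\<close> have order at least \<open>m\<close>, and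
    \<open>var_x\<close> in the Jacobian ideal costs \<open>1\<close>.\<close>
  then have "ereal (real m - 1) \<le> v r"
  proof (rule adjoint_value_ge[OF r v x])
    fix l assume "l \<in> L"
    then show "ereal (real m) \<le> v (to_fract l)"
      using L v_eq[of l] in_origin_power_iff[of l m]
      by (cases "l = 0") (auto simp: valuation_zero[OF dv])
  qed
  then have "p \<in> origin_power (m - 1)"
    using p v_eq[of p] in_origin_power_iff[of p "m - 1"] m
    by (cases "p = 0") (auto simp: ideal_zero[OF is_ideal_origin_power] of_nat_diff)
  then show "r \<in> to_fract ` origin_power (m - 1)" using p by blast
qed

theorem corollary6p6:
  fixes n s :: nat and k :: "nat \<Rightarrow> nat" and I :: "'a::field poly poly set"
  assumes "infinite (UNIV :: 'a set)"
    and "strict_mono_on {1..s} k"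
    and "\<forall>i\<in>{1..s}. 0 < k i \<and> k i < n"
    and "Gcd (insert n (k ` {1..s})) = 1"
    and "I = ideal_generated
           ({var_x ^ n, var_y ^ n} \<union> {var_x ^ (n - k i) * var_y ^ k i | i. i \<in> {1..s}})"
  shows "to_fract ` core I = adjoint (ideal_power I 2)"
proof -
  \<comment> \<open>The exponents of \<open>y\<close> among the generators; \<open>0\<close> belongs
    to \<open>var_x ^ n\<close> and leaves the gcd unchanged.\<close>
  define X where "X = insert 0 (insert n (k ` {1..s}))"
  have n: "n > 0"
  proof (cases "{1..s} = {}")
    case True
    then show ?thesis using assms(4) by (cases n) auto
  next
    case False
    then show ?thesis using assms(3) by (metis all_not_in_conv gr_zeroI not_less_zero)
  qed
  have X: "X \<subseteq> {..n}" "0 \<in> X" "n \<in> X" "Gcd X = 1"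
    using assms(3,4) by (auto simp: X_def)
  have I: "I = ideal_generated ((\<lambda>i. var_x ^ (n - i) * var_y ^ i) ` X)"
    unfolding assms(5) X_def by (intro arg_cong[where f = ideal_generated]) auto
  have core: "core I = origin_power (2 * n - 1)"
    by (rule core_eq_origin_power[OF assms(1) n X I])
  have mem: "var_x ^ n \<in> I" "var_y ^ n \<in> I"
    unfolding assms(5) by (auto intro: ideal_generated_base)
  have "I \<subseteq> origin_power n"
    unfolding I by (rule monomial_ideal_subset_origin_power[OF X(1)])
  from ideal_power_subset_origin_power[OF this, of 2]
  have L: "ideal_power I 2 \<subseteq> origin_power (2 * n)" by (simp add: mult.commute)
  have "(var_x ^ n) ^ 2 \<in> ideal_power I 2" "(var_y ^ n) ^ 2 \<in> ideal_power I 2"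
    using mem by (intro power_in_ideal_power; simp)+
  then have "var_x ^ (2 * n) \<in> ideal_power I 2" "var_y ^ (2 * n) \<in> ideal_power I 2"
    by (simp_all add: mult.commute flip: power_mult)
  \<comment> \<open>Both bounds for the adjoint are used with \<open>m = 2 * n\<close>, so that
    \<open>m - 1\<close> is the exponent found for the core.\<close>
  then show ?thesis
    unfolding core using n
    by (intro equalityI origin_power_subset_adjoint adjoint_subset_origin_power L) simp_all
qed

end
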